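(* Let $f$ be a continuous convex real function defined on a cube $\underline{I}=I_1\times\cdots\times I_n$ in $\mathbb{R}^n$ (each $I_i\subset\mathbb{R}$ an interval). Let $A_1,\dots,A_n$ be mutually commuting $C^*$-subalgebras of a $C^*$-algebra $A$, and let $\tau$ be a finite trace on $A$. Then the function $$(x_1,\dots,x_n)\mapsto \tau\bigl(f(x_1,\dots,x_n)\bigr),$$ defined on $n$-tuples with $x_i\in (A_i)_{\mathrm{sa}}^{I_i}$ for each $i$, is convex on $\bigoplus_{i=1}^n (A_i)_{\mathrm{sa}}^{I_i}$. If $\tau$ is only a densely defined, lower semi-continuous trace on $A$, the result still holds provided $f\ge 0$ (the function may then attain the value $+\infty$).
   Context: $A$ is a $C^*$-algebra of operators on a Hilbert space. Mutually commuting means $ab=ba$ for all $a\in A_i$, $b\in A_j$, $i\neq j$. $(A_i)_{\mathrm{sa}}^{I_i}$ is the convex set of self-adjoint elements of $A_i$ whose spectrum is contained in $I_i$, and $\bigoplus_i (A_i)_{\mathrm{sa}}^{I_i}$ is the set of $n$-tuples $\underline{x}=(x_1,\dots,x_n)$ with $x_i\in (A_i)_{\mathrm{sa}}^{I_i}$. Functional calculus: the $x_i$ commute, so if $E_i$ is the spectral measure of $x_i$, there is a product spectral measure $E$ on $\underline{I}$ with $E(S_1\times\cdots\times S_n)=E_1(S_1)\cdots E_n(S_n)$, and $f(\underline{x})=\int f(\lambda_1,\dots,\lambda_n)\,dE(\lambda_1,\dots,\lambda_n)$, which is regarded as an element of $A$. A trace on $A$ is an additive, positively homogeneous functional $\tau:A_+\to[0,\infty]$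 with $\tau(x^*x)=\tau(xx^* )$ for all $x\in A$. It is finite if it takes only finite values (it then extends to a positive linear functional on $A$), and densely defined if it is finite on a dense subset of $A_+$. *)

theory Defs
  imports "HOL-Analysis.Analysis"
begin

section \<open>Complex Hilbert spaces and their bounded operators\<close>

text \<open>The distribution has real inner product spaces only.  A complex Hilbert space is a complete
  real inner product space with a compatible complex scalar multiplication and a sesquilinear form,
  linear in the first argument, whose real part is the real inner product.\<close>

class complex_hilbert_space = real_inner + complete_space +
  fixes cscale :: "complex \<Rightarrow> 'a \<Rightarrow> 'a"  (infixr "*\<^sub>C" 75)
    and cinner :: "'a \<Rightarrow> 'a \<Rightarrow> complex"
  assumes cscale_add_right: "c *\<^sub>C (x + y) = c *\<^sub>C x + c *\<^sub>C y"
    and cscale_add_left: "(c + d) *\<^sub>C x = c *\<^sub>C x + d *\<^sub>C x"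
    and cscale_cscale: "c *\<^sub>C d *\<^sub>C x = (c * d) *\<^sub>C x"
    and cscale_of_real: "of_real r *\<^sub>C x = r *\<^sub>R x"
    and cinner_commute: "cinner x y = cnj (cinner y x)"
    and cinner_add_left: "cinner (x + y) z = cinner x z + cinner y z"
    and cinner_cscale_left: "cinner (c *\<^sub>C x) y = c * cinner x y"
    and Re_cinner: "Re (cinner x y) = x \<bullet> y"

lemma norm_cscale: "norm (c *\<^sub>C x) = cmod c * norm x"
  for x :: "'h::complex_hilbert_space"
proof -
  have "cinner (c *\<^sub>C x) (c *\<^sub>C x) = c * cnj c * cinner x x"
    by (metis cinner_commute cinner_cscale_left complex_cnj_mult mult.assoc mult.commute)
  also have "c * cnj c = of_real ((cmod c)\<^sup>2)"
    by (rule complex_norm_square [symmetric])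
  finally have "(c *\<^sub>C x) \<bullet> (c *\<^sub>C x) = (cmod c)\<^sup>2 * (x \<bullet> x)"
    by (simp flip: Re_cinner)
  then show ?thesis
    by (simp add: norm_eq_sqrt_inner real_sqrt_mult)
qed

text \<open>The type \<open>'h \<Rightarrow>\<^sub>L 'h\<close> consists of the bounded real-linear operators, normed by the
  operator norm; \<open>bounded_ops\<close> is the algebra \<open>B(H)\<close> inside it.\<close>

definition bounded_ops :: "('h::complex_hilbert_space \<Rightarrow>\<^sub>L 'h) set" where
  "bounded_ops = {T :: 'h \<Rightarrow>\<^sub>L 'h. \<forall>c \<xi>. T (c *\<^sub>C \<xi>) = c *\<^sub>C T \<xi>}"

lift_definition op_cscale :: "complex \<Rightarrow> ('h::complex_hilbert_space \<Rightarrow>\<^sub>L 'h) \<Rightarrow> 'h \<Rightarrow>\<^sub>L 'h"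
  is "\<lambda>c T \<xi>. c *\<^sub>C T \<xi>"
proof -
  fix c and T :: "'h \<Rightarrow> 'h"
  assume T: "bounded_linear T"
  have "bounded_linear (\<lambda>\<eta>::'h. c *\<^sub>C \<eta>)"
  proof (rule bounded_linear_intro)
    show "c *\<^sub>C (r *\<^sub>R \<eta>) = r *\<^sub>R (c *\<^sub>C \<eta>)" for r and \<eta> :: 'h
      by (metis cscale_cscale cscale_of_real mult.commute)
    show "norm (c *\<^sub>C \<eta>) \<le> norm \<eta> * cmod c" for \<eta> :: 'h
      by (simp add: norm_cscale)
  qed (rule cscale_add_right)
  from bounded_linear_compose [OF this T] show "bounded_linear (\<lambda>\<xi>. c *\<^sub>C T \<xi>)" .
qed

definition is_adjoint ::
    "('h::complex_hilbert_space \<Rightarrow>\<^sub>L 'h) \<Rightarrow> ('h \<Rightarrow>\<^sub>L 'h) \<Rightarrow> bool" where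
  "is_adjoint T S \<longleftrightarrow> (\<forall>\<xi> \<eta>. cinner (T \<xi>) \<eta> = cinner \<xi> (S \<eta>))"

definition spectrum :: "('h::complex_hilbert_space \<Rightarrow>\<^sub>L 'h) \<Rightarrow> complex set" where
  "spectrum T = {c. \<not> (\<exists>S\<in>bounded_ops.
      S o\<^sub>L (T - op_cscale c id_blinfun) = id_blinfun \<and>
      (T - op_cscale c id_blinfun) o\<^sub>L S = id_blinfun)}"


section \<open>Algebras of operators and traces\<close>

text \<open>Norm-closed *-subalgebras of \<open>B(H)\<close>; the identity operator need not belong to them.\<close>

definition cstar_algebra :: "('h::complex_hilbert_space \<Rightarrow>\<^sub>L 'h) set \<Rightarrow> bool" where
  "cstar_algebra A \<longleftrightarrow> A \<subseteq> bounded_ops \<and> 0 \<in> A \<and>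
     (\<forall>a\<in>A. \<forall>b\<in>A. a + b \<in> A) \<and>
     (\<forall>c. \<forall>a\<in>A. op_cscale c a \<in> A) \<and>
     (\<forall>a\<in>A. \<forall>b\<in>A. a o\<^sub>L b \<in> A) \<and>
     (\<forall>a\<in>A. \<exists>b\<in>A. is_adjoint a b) \<and>
     closed A"

definition cstar_subalgebra ::
    "('h::complex_hilbert_space \<Rightarrow>\<^sub>L 'h) set \<Rightarrow> ('h \<Rightarrow>\<^sub>L 'h) set \<Rightarrow> bool" where
  "cstar_subalgebra B A \<longleftrightarrow> cstar_algebra B \<and> B \<subseteq> A"

definition mutually_commuting :: "('n \<Rightarrow> ('h::complex_hilbert_space \<Rightarrow>\<^sub>L 'h) set) \<Rightarrow> bool" where
  "mutually_commuting B \<longleftrightarrow>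
     (\<forall>i j. i \<noteq> j \<longrightarrow> (\<forall>a\<in>B i. \<forall>b\<in>B j. a o\<^sub>L b = b o\<^sub>L a))"

definition sa_part ::
    "('h::complex_hilbert_space \<Rightarrow>\<^sub>L 'h) set \<Rightarrow> real set \<Rightarrow> ('h \<Rightarrow>\<^sub>L 'h) set" where
  "sa_part A J = {a\<in>A. is_adjoint a a \<and> spectrum a \<subseteq> of_real ` J}"

definition sa_tuples ::
    "('n \<Rightarrow> ('h::complex_hilbert_space \<Rightarrow>\<^sub>L 'h) set) \<Rightarrow> ('n \<Rightarrow> real set) \<Rightarrow> (('h \<Rightarrow>\<^sub>L 'h)^'n) set" where
  "sa_tuples B I = {x. \<forall>i. x $ i \<in> sa_part (B i) (I i)}"

definition pos_part :: "('h::complex_hilbert_space \<Rightarrow>\<^sub>L 'h) set \<Rightarrow> ('h \<Rightarrow>\<^sub>L 'h) set" where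
  "pos_part A = {a\<in>A. is_adjoint a a \<and> (\<forall>\<xi>. 0 \<le> Re (cinner (a \<xi>) \<xi>))}"

text \<open>A trace is a function on \<open>pos_part A\<close>; its values elsewhere are irrelevant.
  In homogeneity the convention \<open>0 \<cdot> \<infinity> = 0\<close> of \<^typ>\<open>ennreal\<close> is in force.\<close>

definition is_trace ::
    "('h::complex_hilbert_space \<Rightarrow>\<^sub>L 'h) set \<Rightarrow> (('h \<Rightarrow>\<^sub>L 'h) \<Rightarrow> ennreal) \<Rightarrow> bool" where
  "is_trace A \<tau> \<longleftrightarrow>
     (\<forall>a\<in>pos_part A. \<forall>b\<in>pos_part A. \<tau> (a + b) = \<tau> a + \<tau> b) \<and>
     (\<forall>r\<ge>0. \<forall>a\<in>pos_part A. \<tau> (r *\<^sub>R a) = ennreal r * \<tau> a) \<and>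
     (\<forall>a\<in>A. \<forall>b\<in>A. is_adjoint a b \<longrightarrow> \<tau> (b o\<^sub>L a) = \<tau> (a o\<^sub>L b))"

definition finite_trace ::
    "('h::complex_hilbert_space \<Rightarrow>\<^sub>L 'h) set \<Rightarrow> (('h \<Rightarrow>\<^sub>L 'h) \<Rightarrow> ennreal) \<Rightarrow> bool" where
  "finite_trace A \<tau> \<longleftrightarrow> is_trace A \<tau> \<and> (\<forall>a\<in>pos_part A. \<tau> a < \<infinity>)"

definition densely_defined_trace ::
    "('h::complex_hilbert_space \<Rightarrow>\<^sub>L 'h) set \<Rightarrow> (('h \<Rightarrow>\<^sub>L 'h) \<Rightarrow> ennreal) \<Rightarrow> bool" where
  "densely_defined_trace A \<tau> \<longleftrightarrow>
     is_trace A \<tau> \<and> pos_part A \<subseteq> closure {a\<in>pos_part A. \<tau> a < \<infinity>}"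

definition lower_semicontinuous_on :: "'a::topological_space set \<Rightarrow> ('a \<Rightarrow> ennreal) \<Rightarrow> bool" where
  "lower_semicontinuous_on S g \<longleftrightarrow> (\<forall>t. closedin (top_of_set S) {a\<in>S. g a \<le> t})"

text \<open>The extension of a finite trace to a (real) linear functional on the self-adjoint part of
  \<open>A\<close>, where every element is a difference of two positive ones.\<close>

definition trace_functional ::
    "('h::complex_hilbert_space \<Rightarrow>\<^sub>L 'h) set \<Rightarrow> (('h \<Rightarrow>\<^sub>L 'h) \<Rightarrow> ennreal) \<Rightarrow> ('h \<Rightarrow>\<^sub>L 'h) \<Rightarrow> real" where
  "trace_functional A \<tau> a =
     (THE r. \<exists>p\<in>pos_part A. \<exists>q\<in>pos_part A. a = p - q \<and> r = enn2real (\<tau> p) - enn2real (\<tau> q))"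


section \<open>Spectral measures and functional calculus in several variables\<close>

definition spectral_measure ::
    "'a measure \<Rightarrow> ('a set \<Rightarrow> 'h::complex_hilbert_space \<Rightarrow>\<^sub>L 'h) \<Rightarrow> bool" where
  "spectral_measure M E \<longleftrightarrow>
     (\<forall>S\<in>sets M. E S \<in> bounded_ops \<and> is_adjoint (E S) (E S) \<and> E S o\<^sub>L E S = E S) \<and>
     E (space M) = id_blinfun \<and>
     (\<forall>S\<in>sets M. \<forall>T\<in>sets M. E (S \<inter> T) = E S o\<^sub>L E T) \<and>
     (\<forall>F::nat \<Rightarrow> 'a set. range F \<subseteq> sets M \<longrightarrow> disjoint_family F \<longrightarrow>
        (\<forall>\<xi>. (\<lambda>k. E (F k) \<xi>) sums E (\<Union>k. F k) \<xi>))"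

definition scalar_measure ::
    "'a measure \<Rightarrow> ('a set \<Rightarrow> 'h::complex_hilbert_space \<Rightarrow>\<^sub>L 'h) \<Rightarrow> 'h \<Rightarrow> 'a measure" where
  "scalar_measure M E \<xi> =
     measure_of (space M) (sets M) (\<lambda>S. ennreal (Re (cinner (E S \<xi>) \<xi>)))"

text \<open>\<open>T\<close> is the spectral integral of the real function \<open>g\<close> with respect to \<open>E\<close>.  By polarization
  the quadratic form determines \<open>T\<close>, so the positive measures \<open>\<langle>E(\<cdot>)\<xi>, \<xi>\<rangle>\<close> suffice.\<close>

definition is_spectral_integral ::
    "'a measure \<Rightarrow> ('a set \<Rightarrow> 'h::complex_hilbert_space \<Rightarrow>\<^sub>L 'h) \<Rightarrow> ('a \<Rightarrow> real) \<Rightarrow> ('h \<Rightarrow>\<^sub>L 'h) \<Rightarrow> bool" where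
  "is_spectral_integral M E g T \<longleftrightarrow> T \<in> bounded_ops \<and>
     (\<forall>\<xi>. integrable (scalar_measure M E \<xi>) g \<and>
          cinner (T \<xi>) \<xi> = of_real (integral\<^sup>L (scalar_measure M E \<xi>) g))"

text \<open>Spectral measures are unique on Borel sets; \<open>SOME\<close> only fixes their irrelevant values on
  other sets.\<close>

definition spectral_measure_of ::
    "('h::complex_hilbert_space \<Rightarrow>\<^sub>L 'h) \<Rightarrow> real set \<Rightarrow> 'h \<Rightarrow>\<^sub>L 'h" where
  "spectral_measure_of x =
     (SOME E. spectral_measure borel E \<and> is_spectral_integral borel E (\<lambda>t. t) x)"

text \<open>The product \<open>E\<^sub>1(S\<^sub>1) \<cdots> E\<^sub>n(S\<^sub>n)\<close> is formed along any enumeration of the index type; the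
  factors commute.\<close>

definition product_spectral_measure ::
    "('n::finite \<Rightarrow> real set \<Rightarrow> 'h::complex_hilbert_space \<Rightarrow>\<^sub>L 'h) \<Rightarrow>
     (real^'n) set \<Rightarrow> 'h \<Rightarrow>\<^sub>L 'h" where
  "product_spectral_measure E =
     (SOME P. spectral_measure borel P \<and>
        (\<forall>S. (\<forall>i. S i \<in> sets borel) \<longrightarrow>
          (\<forall>is. distinct is \<and> set is = UNIV \<longrightarrow>
             P {v. \<forall>i. v $ i \<in> S i} = foldr (\<lambda>i T. E i (S i) o\<^sub>L T) is id_blinfun)))"

definition cube :: "('n::finite \<Rightarrow> real set) \<Rightarrow> (real^'n) set" where
  "cube I = {v. \<forall>i. v $ i \<in> I i}"

text \<open>Here \<open>f\<close> matters on \<open>cube I\<close> only: the spectral measure lives on all of \<open>\<real>\<^sup>n\<close>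
  but is concentrated on the cube when the spectrum of each \<open>x $ i\<close> lies in \<open>I i\<close>.\<close>

definition fun_calc ::
    "('n::finite \<Rightarrow> real set) \<Rightarrow> (real^'n \<Rightarrow> real) \<Rightarrow>
     ('h::complex_hilbert_space \<Rightarrow>\<^sub>L 'h)^'n \<Rightarrow> 'h \<Rightarrow>\<^sub>L 'h" where
  "fun_calc I f x =
     (THE T. is_spectral_integral borel
        (product_spectral_measure (\<lambda>i. spectral_measure_of (x $ i)))
        (\<lambda>v. indicat_real (cube I) v * f v) T)"


section \<open>Convexity of extended-valued functions\<close>

definition ennreal_convex_on :: "'a::real_vector set \<Rightarrow> ('a \<Rightarrow> ennreal) \<Rightarrow> bool" where
  "ennreal_convex_on S g \<longleftrightarrow> convex S \<and>
     (\<forall>x\<in>S. \<forall>y\<in>S. \<forall>u\<ge>0. \<forall>v\<ge>0. u + v = 1 \<longrightarrow>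
        g (u *\<^sub>R x + v *\<^sub>R y) \<le> ennreal u * g x + ennreal v * g y)"

end

theory Submission
  imports Defs "HOL-Probability.Helly_Selection" "HOL-Real_Asymp.Real_Asymp"
begin

text \<open>The commuting self-adjoint operators \<open>x\<^sub>1, \<dots>, x\<^sub>n\<close> have a joint functional calculus
  \<open>g \<mapsto> g(x)\<close>, multiplicative and positive, and \<open>g(x) \<in> A\<close> for continuous \<open>g\<close> if \<open>1 \<in> A\<close> or \<open>g(0) = 0\<close>.
  Let \<open>z = u x + v y\<close> and \<open>f \<ge> 0\<close>.  Up to \<open>\<delta>\<close>, \<open>f\<close> is a maximum of finitely many affine minorants \<open>l\<^sub>k\<close>;
  let the continuous functions \<open>s\<^sub>k\<^sup>2\<close> be subordinate to the sets where \<open>l\<^sub>k\<close> is nearly maximal, with sum at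
  most \<open>1\<close>, and zero where \<open>f \<le> \<delta>\<close>.  From \<open>f(x) \<ge> l\<^sub>k(x)\<close> and \<open>l\<^sub>k(z) = u l\<^sub>k(x) + v l\<^sub>k(y)\<close>,
  \<open>u \<tau>(f(x)) + v \<tau>(f(y)) \<ge> \<Sum>\<^sub>k \<tau>(s\<^sub>k(z) (u f(x) + v f(y)) s\<^sub>k(z)) \<ge> \<Sum>\<^sub>k \<tau>(s\<^sub>k(z) l\<^sub>k(z) s\<^sub>k(z))\<close>,
  where the first inequality is the trace property.  The right-hand side is the trace of an element of \<open>A\<close>
  close in norm to \<open>f(z)\<close>, so lower semicontinuity gives the claim as \<open>\<delta> \<rightarrow> 0\<close>.  Density of the domain
  of \<open>\<tau>\<close> makes all \<open>\<tau>(s\<^sub>k(z)\<^sup>2)\<close> finite.  If \<open>1 \<notin> A\<close>, then \<open>f(x) \<in> A\<close> forces \<open>f(0) = 0\<close>.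
  A finite trace is bounded, and a general \<open>f\<close> becomes nonnegative after subtracting an affine function
  \<open>l \<le> f + \<delta>\<close> with \<open>l(x) \<in> A\<close>.

  The spectral theorem is obtained from Hausdorff's moment problem: for \<open>0 \<le> x \<le> 1\<close> the numbers
  \<open>\<langle>x\<^sup>k (1 - x)\<^sup>l \<xi>, \<xi>\<rangle>\<close> are nonnegative and are therefore the moments of a measure on \<open>[0, 1]\<close>.\<close>

text \<open>The inequality \<open>f(z) \<le> u f(x) + v f(y)\<close> is false for operators in
  general. Comparison with affine minorants does hold, and it survives compression by functions of
  \<open>z\<close>; only reassembling the compressed pieces of \<open>f(x)\<close> and
  \<open>f(y)\<close>, which need not commute with \<open>z\<close>, requires the trace. Two
  obstacles shape the details. Traces may be infinite, so nothing may be subtracted: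
  \<open>l\<^sub>k(x)\<close> is made positive by adding a constant \<open>C\<close>, and
  \<open>C \<tau>(s\<^sub>k(z)\<^sup>2)\<close> can be cancelled afterwards only because it is
  finite, which is why \<open>s\<^sub>k\<close> is cut off where \<open>f\<close> is small. And
  \<open>A\<close> may lack a unit, so \<open>l\<^sub>k(z)\<close> can lie outside \<open>A\<close>,
  although its compression by \<open>s\<^sub>k(z)\<close> lies inside.

  Spectral theory is carried out over real inner product spaces; complex linearity is commutation
  with the scalars, which spectral projections inherit. The joint measure of a tuple comes from a
  single operator that encodes countably many commuting spectral projections, so that it is an image
  of a measure on the line.\<close>

instance complex_hilbert_space \<subseteq> banach ..

section \<open>Symmetric and positive operators\<close>

text \<open>For complex-linear operators this is self-adjointness
  (\<open>is_adjoint_self_iff\<close>), so that the complex structure can be set aside until the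
  spectral theorem is available.\<close>

definition symm_op :: "('h::real_inner \<Rightarrow>\<^sub>L 'h) \<Rightarrow> bool" where
  "symm_op T \<longleftrightarrow> (\<forall>\<xi> \<eta>. T \<xi> \<bullet> \<eta> = \<xi> \<bullet> T \<eta>)"

definition pos_op :: "('h::real_inner \<Rightarrow>\<^sub>L 'h) \<Rightarrow> bool" where
  "pos_op T \<longleftrightarrow> symm_op T \<and> (\<forall>\<xi>. 0 \<le> T \<xi> \<bullet> \<xi>)"

lemma symm_opD: "symm_op T \<Longrightarrow> T \<xi> \<bullet> \<eta> = \<xi> \<bullet> T \<eta>"
  by (simp add: symm_op_def)

lemma pos_op_symm: "pos_op T \<Longrightarrow> symm_op T"
  and pos_opD: "pos_op T \<Longrightarrow> 0 \<le> T \<xi> \<bullet> \<xi>"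
  by (simp_all add: pos_op_def)

lemma symm_op_simps [simp]: "symm_op 0" "symm_op id_blinfun"
  by (simp_all add: symm_op_def)

lemma symm_op_add: "symm_op S \<Longrightarrow> symm_op T \<Longrightarrow> symm_op (S + T)"
  and symm_op_diff: "symm_op S \<Longrightarrow> symm_op T \<Longrightarrow> symm_op (S - T)"
  and symm_op_scaleR: "symm_op T \<Longrightarrow> symm_op (r *\<^sub>R T)"
  and symm_op_uminus: "symm_op T \<Longrightarrow> symm_op (- T)"
  and symm_op_sandwich: "symm_op S \<Longrightarrow> symm_op T \<Longrightarrow> symm_op (S o\<^sub>L T o\<^sub>L S)"
  by (simp_all add: symm_op_def blinfun.bilinear_simps inner_add_left inner_add_right
        inner_diff_left inner_diff_right)

lemma symm_op_comp:
  assumes "symm_op S" "symm_op T" "S o\<^sub>L T = T o\<^sub>L S"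
  shows "symm_op (S o\<^sub>L T)"
proof -
  have "S (T \<xi>) \<bullet> \<eta> = \<xi> \<bullet> (T o\<^sub>L S) \<eta>" for \<xi> \<eta>
    using assms(1,2) by (simp add: symm_opD)
  then show ?thesis
    by (simp add: symm_op_def flip: assms(3))
qed

lemma symm_op_sum: "(\<And>i. i \<in> J \<Longrightarrow> symm_op (T i)) \<Longrightarrow> symm_op (\<Sum>i\<in>J. T i)"
  by (induction J rule: infinite_finite_induct) (auto intro: symm_op_add)

text \<open>The adjoint of \<open>S o\<^sub>L T\<close> is \<open>T o\<^sub>L S\<close>. Below,
  commutation is often obtained this way, from the symmetry of a product that is known as a spectral
  integral.\<close>

lemma symm_op_comp_commute: "symm_op S \<Longrightarrow> symm_op T \<Longrightarrow> symm_op (S o\<^sub>L T) \<Longrightarrow> S o\<^sub>L T = T o\<^sub>L S"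
  by (rule blinfun_eqI, rule vector_eq_rdot [THEN iffD1])
    (metis symm_opD blinfun_apply_blinfun_compose)

lemma pos_op_simps [simp]: "pos_op 0" "pos_op id_blinfun"
  by (simp_all add: pos_op_def)

lemma pos_op_add: "pos_op S \<Longrightarrow> pos_op T \<Longrightarrow> pos_op (S + T)"
  and pos_op_scaleR: "pos_op T \<Longrightarrow> 0 \<le> r \<Longrightarrow> pos_op (r *\<^sub>R T)"
  by (simp_all add: pos_op_def symm_op_add symm_op_scaleR blinfun.bilinear_simps inner_add_left)

lemma pos_op_sum: "(\<And>i. i \<in> J \<Longrightarrow> pos_op (T i)) \<Longrightarrow> pos_op (\<Sum>i\<in>J. T i)"
  by (induction J rule: infinite_finite_induct) (auto intro: pos_op_add)

lemma pos_op_sandwich: "symm_op S \<Longrightarrow> pos_op T \<Longrightarrow> pos_op (S o\<^sub>L T o\<^sub>L S)"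
  by (simp add: pos_op_def symm_op_sandwich symm_opD[of S])

lemma pos_op_square: "symm_op S \<Longrightarrow> pos_op (S o\<^sub>L S)"
  by (simp add: pos_op_def symm_op_comp) (metis inner_ge_zero symm_opD)

lemma symm_op_polar:
  assumes "symm_op T"
  shows "T \<xi> \<bullet> \<eta> = (T (\<xi> + \<eta>) \<bullet> (\<xi> + \<eta>) - T (\<xi> - \<eta>) \<bullet> (\<xi> - \<eta>)) / 4"
proof -
  have "T \<eta> \<bullet> \<xi> = T \<xi> \<bullet> \<eta>"
    using symm_opD[OF assms, of \<xi> \<eta>] by (simp only: inner_commute)
  then show ?thesis
    by (simp add: blinfun.bilinear_simps inner_add_left inner_add_right
        inner_diff_left inner_diff_right)
qed

text \<open>By polarisation. Operator identities are checked on quadratic forms throughout, where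
  they become identities between measures or integrals.\<close>

lemma symm_op_eqI:
  assumes "symm_op S" "symm_op T" "\<And>\<xi>. S \<xi> \<bullet> \<xi> = T \<xi> \<bullet> \<xi>"
  shows "S = T"
proof (rule blinfun_eqI)
  fix \<xi>
  have "S \<xi> \<bullet> \<eta> = T \<xi> \<bullet> \<eta>" for \<eta>
    by (subst (1 2) symm_op_polar) (simp_all add: assms)
  then show "S \<xi> = T \<xi>" by (metis vector_eq_rdot)
qed

lemma pos_op_Cauchy_Schwarz:
  assumes "pos_op T"
  shows "(T \<xi> \<bullet> \<eta>)\<^sup>2 \<le> (T \<xi> \<bullet> \<xi>) * (T \<eta> \<bullet> \<eta>)"
proof -
  define a b c where "a = T \<eta> \<bullet> \<eta>" and "b = T \<xi> \<bullet> \<eta>" and "c = T \<xi> \<bullet> \<xi>"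
  have b': "T \<eta> \<bullet> \<xi> = b"
    using symm_opD[OF pos_op_symm[OF assms], of \<xi> \<eta>] by (simp add: b_def inner_commute)
  have q: "0 \<le> c + 2 * t * b + t\<^sup>2 * a" for t
    using pos_opD[OF assms, of "\<xi> + t *\<^sub>R \<eta>"] b'
    by (simp add: blinfun.bilinear_simps inner_add_left inner_add_right a_def b_def c_def
        power2_eq_square algebra_simps)
  have a: "0 \<le> a" using pos_opD[OF assms] by (simp add: a_def)
  show ?thesis
  proof (cases "a = 0")
    case True
    have "b = 0"
    proof (rule ccontr)
      assume "b \<noteq> 0"
      \<comment> \<open>A nonconstant linear function of \<open>t\<close> cannot stay nonnegative;
        at this \<open>t\<close> the value of \<open>c + 2 * t * b\<close> is
        \<open>-1\<close>.\<close>
      then show False using q[of "- (c + 1) / (2 * b)"] True by (simp add: field_simps)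
    qed
    then show ?thesis using True by (simp add: a_def b_def)
  next
    case False
    with a have a: "0 < a" by simp
    have "0 \<le> a * (c + 2 * (- b / a) * b + (- b / a)\<^sup>2 * a)"
      using q[of "- b / a"] a by (intro mult_nonneg_nonneg) linarith+
    also have "\<dots> = c * a - b\<^sup>2"
      using a by (simp add: field_simps power2_eq_square)
    finally show ?thesis by (simp add: a_def b_def c_def)
  qed
qed

text \<open>Cauchy-Schwarz for the form of \<open>T\<close>, applied to \<open>\<xi>\<close> and
  \<open>T \<xi>\<close>. It upgrades convergence of quadratic forms to convergence of
  vectors.\<close>

lemma pos_op_norm_le:
  assumes T: "pos_op T" and C: "\<And>\<xi>. T \<xi> \<bullet> \<xi> \<le> C * (norm \<xi>)\<^sup>2"
  shows "(norm (T \<xi>))\<^sup>2 \<le> C * (T \<xi> \<bullet> \<xi>)"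
proof (cases "T \<xi> = 0")
  case False
  have "(T \<xi> \<bullet> T \<xi>)\<^sup>2 \<le> (T \<xi> \<bullet> \<xi>) * (T (T \<xi>) \<bullet> T \<xi>)"
    by (rule pos_op_Cauchy_Schwarz[OF T])
  also have "\<dots> \<le> (T \<xi> \<bullet> \<xi>) * (C * (norm (T \<xi>))\<^sup>2)"
    by (intro mult_left_mono C pos_opD[OF T])
  finally have "(norm (T \<xi>))\<^sup>2 * (norm (T \<xi>))\<^sup>2 \<le> (C * (T \<xi> \<bullet> \<xi>)) * (norm (T \<xi>))\<^sup>2"
    by (simp only: power2_norm_eq_inner power2_eq_square[of "T \<xi> \<bullet> T \<xi>"] ac_simps)
  then show ?thesis by (rule mult_right_le_imp_le) (use False in simp)
qed simp

lemma inner_op_le: "\<bar>T \<xi> \<bullet> \<xi>\<bar> \<le> norm T * (norm \<xi>)\<^sup>2"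
  for T :: "'h::real_inner \<Rightarrow>\<^sub>L 'h"
proof -
  have "\<bar>T \<xi> \<bullet> \<xi>\<bar> \<le> norm (T \<xi>) * norm \<xi>" by (rule Cauchy_Schwarz_ineq2)
  also have "\<dots> \<le> norm T * norm \<xi> * norm \<xi>"
    by (intro mult_right_mono norm_blinfun) auto
  finally show ?thesis by (simp add: power2_eq_square)
qed

lemma pos_op_norm_minus:
  assumes "symm_op T" "norm T \<le> c"
  shows "pos_op (c *\<^sub>R id_blinfun - T)"
proof -
  have "T \<xi> \<bullet> \<xi> \<le> c * (\<xi> \<bullet> \<xi>)" for \<xi>
    using inner_op_le[of T \<xi>] mult_right_mono[OF assms(2), of "(norm \<xi>)\<^sup>2"]
    by (simp add: power2_norm_eq_inner)
  then show ?thesis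
    using assms(1) by (simp add: pos_op_def symm_op_diff symm_op_scaleR blinfun.bilinear_simps inner_diff_left)
qed

text \<open>Vigier's theorem. The quadratic forms converge by monotonicity, and
  \<open>pos_op_norm_le\<close> for \<open>T n - T m\<close> makes the vectors Cauchy. The same
  estimate with \<open>m = 0\<close> bounds the limit operator.\<close>

lemma incseq_op_convergent:
  fixes T :: "nat \<Rightarrow> 'h::{real_inner,banach} \<Rightarrow>\<^sub>L 'h"
  assumes sym: "\<And>k. symm_op (T k)" and mono: "\<And>\<xi> m n. m \<le> n \<Longrightarrow> T m \<xi> \<bullet> \<xi> \<le> T n \<xi> \<bullet> \<xi>"
    and bdd: "\<And>\<xi> k. T k \<xi> \<bullet> \<xi> \<le> c * (norm \<xi>)\<^sup>2"
  obtains S where "symm_op S" "\<And>\<xi>. (\<lambda>k. T k \<xi>) \<longlonglongrightarrow> S \<xi>"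
proof -
  define C where "C = \<bar>c\<bar> + norm (T 0)"
  have C: "0 \<le> C" by (simp add: C_def)
  have pos: "pos_op (T n - T m)" if "m \<le> n" for m n
    using mono[OF that] by (simp add: pos_op_def symm_op_diff sym blinfun.bilinear_simps inner_diff_left)
  have up: "(T n - T m) \<xi> \<bullet> \<xi> \<le> C * (norm \<xi>)\<^sup>2" if "m \<le> n" for m n \<xi>
  proof -
    have "c * (norm \<xi>)\<^sup>2 \<le> \<bar>c\<bar> * (norm \<xi>)\<^sup>2" by (intro mult_right_mono) auto
    then show ?thesis
      using bdd[of n \<xi>] mono[of 0 m \<xi>] inner_op_le[of "T 0" \<xi>]
      by (simp add: C_def blinfun.diff_left inner_diff_left distrib_right)
  qed
  have est: "(norm (T n \<xi> - T m \<xi>))\<^sup>2 \<le> C * (T n \<xi> \<bullet> \<xi> - T m \<xi> \<bullet> \<xi>)" if "m \<le> n" for m n \<xi>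
    using pos_op_norm_le[OF pos up, OF that that, of \<xi>] by (simp add: blinfun.bilinear_simps inner_diff_left)
  have cauchy: "Cauchy (\<lambda>k. T k \<xi>)" for \<xi>
  proof (rule metric_CauchyI)
    fix e :: real assume e: "0 < e"
    have "convergent (\<lambda>k. T k \<xi> \<bullet> \<xi>)"
    proof (rule Bseq_mono_convergent)
      have "\<bar>T k \<xi> \<bullet> \<xi>\<bar> \<le> \<bar>T 0 \<xi> \<bullet> \<xi>\<bar> + \<bar>c * (norm \<xi>)\<^sup>2\<bar>" for k
        using mono[of 0 k \<xi>] bdd[of k \<xi>] by linarith
      then show "Bseq (\<lambda>k. T k \<xi> \<bullet> \<xi>)" by (intro BseqI') auto
    qed (use mono in auto)
    then have "Cauchy (\<lambda>k. T k \<xi> \<bullet> \<xi>)" by (rule convergent_Cauchy)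
    then obtain M where M: "\<And>m n. m \<ge> M \<Longrightarrow> n \<ge> M \<Longrightarrow> dist (T m \<xi> \<bullet> \<xi>) (T n \<xi> \<bullet> \<xi>) < e\<^sup>2 / (C + 1)"
      using metric_CauchyD[of _ "e\<^sup>2 / (C + 1)"] C e by (metis add_nonneg_pos divide_pos_pos zero_less_one zero_less_power)
    have "dist (T m \<xi>) (T n \<xi>) < e" if "m \<ge> M" "n \<ge> M" "m \<le> n" for m n
    proof -
      have "(norm (T n \<xi> - T m \<xi>))\<^sup>2 \<le> C * (T n \<xi> \<bullet> \<xi> - T m \<xi> \<bullet> \<xi>)" using est that by simp
      also have "\<dots> \<le> (C + 1) * (T n \<xi> \<bullet> \<xi> - T m \<xi> \<bullet> \<xi>)" using mono[OF that(3), of \<xi>] by (simp add: algebra_simps)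
      also have "\<dots> < (C + 1) * (e\<^sup>2 / (C + 1))"
        using M[OF that(1,2)] C by (intro mult_strict_left_mono) (auto simp: dist_real_def)
      also have "\<dots> = e\<^sup>2" using C by simp
      finally show ?thesis using e by (simp add: dist_norm norm_minus_commute power2_less_imp_less)
    qed
    then show "\<exists>M. \<forall>m\<ge>M. \<forall>n\<ge>M. dist (T m \<xi>) (T n \<xi>) < e"
      by (metis dist_commute nat_le_linear)
  qed
  define L where "L \<xi> = lim (\<lambda>k. T k \<xi>)" for \<xi>
  have L: "(\<lambda>k. T k \<xi>) \<longlonglongrightarrow> L \<xi>" for \<xi>
    using Cauchy_convergent[OF cauchy] by (simp add: L_def convergent_LIMSEQ_iff)
  have nb: "norm (T k \<xi>) \<le> norm \<xi> * (norm (T 0) + C)" for k \<xi>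
  proof -
    have "(norm (T k \<xi> - T 0 \<xi>))\<^sup>2 \<le> C * (T k \<xi> \<bullet> \<xi> - T 0 \<xi> \<bullet> \<xi>)" using est by simp
    also have "\<dots> \<le> C * (C * (norm \<xi>)\<^sup>2)"
      using up[of 0 k \<xi>] C by (intro mult_left_mono) (auto simp: blinfun.bilinear_simps inner_diff_left)
    also have "\<dots> = (C * norm \<xi>)\<^sup>2" by (simp add: power2_eq_square)
    finally have "norm (T k \<xi> - T 0 \<xi>) \<le> C * norm \<xi>" by (rule power2_le_imp_le) (use C in simp)
    then show ?thesis
      using norm_triangle_sub[of "T k \<xi>" "T 0 \<xi>"] norm_blinfun[of "T 0" \<xi>] by (simp add: algebra_simps)
  qed
  have bl: "bounded_linear L"
  proof (rule bounded_linear_intro)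
    show "L (\<xi> + \<eta>) = L \<xi> + L \<eta>" for \<xi> \<eta>
      using tendsto_add[OF L[of \<xi>] L[of \<eta>]] L[of "\<xi> + \<eta>"] by (simp add: blinfun.bilinear_simps LIMSEQ_unique)
    show "L (r *\<^sub>R \<xi>) = r *\<^sub>R L \<xi>" for r \<xi>
      using tendsto_scaleR[OF tendsto_const L[of \<xi>], of r] L[of "r *\<^sub>R \<xi>"] by (simp add: blinfun.bilinear_simps LIMSEQ_unique)
    show "norm (L \<xi>) \<le> norm \<xi> * (norm (T 0) + C)" for \<xi>
      by (rule LIMSEQ_le_const2[OF tendsto_norm[OF L]]) (use nb in auto)
  qed
  have "(L \<xi>) \<bullet> \<eta> = \<xi> \<bullet> L \<eta>" for \<xi> \<eta>
    using tendsto_inner[OF L[of \<xi>] tendsto_const, of \<eta>] tendsto_inner[OF tendsto_const L[of \<eta>], of \<xi>]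
      symm_opD[OF sym, of _ \<xi> \<eta>] by (auto intro: LIMSEQ_unique)
  then show ?thesis
    using that[of "Blinfun L"] L bl by (simp add: symm_op_def bounded_linear_Blinfun_apply)
qed

section \<open>Hausdorff's moment problem\<close>

text \<open>The model is \<open>c k l = \<integral> t ^ k * (1 - t) ^ l\<close>: the recursion is
  \<open>1 = t + (1 - t)\<close>, and the sum expands \<open>(t + (1 - t)) ^ N\<close> under the
  integral.\<close>

lemma hausdorff_binomial_sum:
  fixes c :: "nat \<Rightarrow> nat \<Rightarrow> real"
  assumes "\<And>k l. c k l = c (Suc k) l + c k (Suc l)"
  shows "(\<Sum>j\<le>N. real (N choose j) * c (a + j) (b + (N - j))) = c a b"
proof (induction N arbitrary: a b)
  case (Suc N)
  have "(\<Sum>j\<le>Suc N. real (Suc N choose j) * c (a + j) (b + (Suc N - j)))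
      = (\<Sum>j\<le>N. real (N choose j) * c (a + j) (Suc b + (N - j))) + (\<Sum>j\<le>N. real (N choose j) * c (Suc a + j) (b + (N - j)))"
  proof -
    have "(\<Sum>j\<le>Suc N. real (Suc N choose j) * c (a + j) (b + (Suc N - j)))
      = c a (b + Suc N) + (\<Sum>j\<le>N. real (Suc N choose Suc j) * c (Suc a + j) (b + (N - j)))"
      by (subst sum.atMost_Suc_shift) simp
    also have "\<dots> = c a (b + Suc N) + (\<Sum>j\<le>N. real (N choose Suc j) * c (Suc a + j) (b + (N - j)))
        + (\<Sum>j\<le>N. real (N choose j) * c (Suc a + j) (b + (N - j)))"
      by (simp add: algebra_simps sum.distrib)
    also have "c a (b + Suc N) + (\<Sum>j\<le>N. real (N choose Suc j) * c (Suc a + j) (b + (N - j)))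
        = (\<Sum>j\<le>Suc N. real (N choose j) * c (a + j) (b + (Suc N - j)))"
      by (simp only: sum.atMost_Suc_shift) simp
    also have "\<dots> = (\<Sum>j\<le>N. real (N choose j) * c (a + j) (Suc b + (N - j)))"
      by (auto intro!: sum.cong simp: Suc_diff_le)
    finally show ?thesis .
  qed
  then show ?case using Suc[of a "Suc b"] Suc[of "Suc a" b] assms[of a b] by simp
qed simp

text \<open>The quotient is a product of factors \<open>(k - i) / (n - i)\<close>, each close to
  \<open>k / n\<close>. For \<open>k < i\<close> a factor is negative, and \<open>2 * m < n\<close>
  keeps it above \<open>-1\<close>, since comparing the products factor by factor demands moduli at
  most one.\<close>

lemma binomial_quotient_approx:
  assumes k: "k \<le> n" and n: "2 * m < n"
  shows "\<bar>real (k choose m) / real (n choose m) - (real k / real n) ^ m\<bar> \<le> real m * (real m / (real n - real m))"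
proof -
  have *: "real (k choose m) / real (n choose m) = (\<Prod>i<m. (real k - real i) / (real n - real i))"
    by (simp add: binomial_gbinomial gbinomial_prod_rev prod_dividef atLeast0LessThan)
  have "\<bar>(\<Prod>i<m. (real k - real i) / (real n - real i)) - (\<Prod>i<m. real k / real n)\<bar>
      \<le> (\<Sum>i<m. \<bar>(real k - real i) / (real n - real i) - real k / real n\<bar>)"
    unfolding real_norm_def[symmetric]
    by (rule norm_prod_diff) (use k n in \<open>auto simp: abs_le_iff field_simps\<close>)
  also have "\<dots> \<le> (\<Sum>i<m. real m / (real n - real m))"
  proof (rule sum_mono)
    fix i assume "i \<in> {..<m}"
    then have i: "i < m" by simp
    have "(real k - real i) / (real n - real i) - real k / real n
        = - (real i / (real n - real i) * ((real n - real k) / real n))"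
      using n i by (simp add: field_simps)
    then have "\<bar>(real k - real i) / (real n - real i) - real k / real n\<bar>
        = real i / (real n - real i) * ((real n - real k) / real n)"
      using n i k by (simp add: abs_mult)
    also have "\<dots> \<le> real i / (real n - real i) * 1"
      using n i k by (intro mult_left_mono) auto
    also have "\<dots> \<le> real m / (real n - real m)"
      using n i by (simp add: frac_le)
    finally show "\<bar>(real k - real i) / (real n - real i) - real k / real n\<bar> \<le> real m / (real n - real m)" .
  qed
  finally show ?thesis by (simp add: *)
qed

text \<open>Replacing \<open>(k/n)\<^sup>m\<close> by the quotient of binomials turns the \<open>m\<close>-th moment of the \<open>n\<close>-th
  approximating measure into the exact moment.\<close>

lemma hausdorff_factorial_moment:
  fixes c :: "nat \<Rightarrow> nat \<Rightarrow> real"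
  assumes rec: "\<And>k l. c k l = c (Suc k) l + c k (Suc l)" and m: "m \<le> n"
  shows "(\<Sum>k\<le>n. real (n choose k) * c k (n - k) * (real (k choose m) / real (n choose m))) = c m 0"
proof -
  have "(\<Sum>k\<le>n. real (n choose k) * c k (n - k) * (real (k choose m) / real (n choose m)))
      = (\<Sum>k\<in>{m..n}. real ((n - m) choose (k - m)) * c k (n - k))"
  proof (rule sum.mono_neutral_cong_right)
    fix k assume "k \<in> {m..n}"
    then have k: "m \<le> k" "k \<le> n" by auto
    have "real (n choose k) * real (k choose m) = real (n choose m) * real ((n - m) choose (k - m))"
      using choose_mult[OF k] by (metis of_nat_mult)
    moreover have "real (n choose m) \<noteq> 0" using m by simp
    ultimately show "real (n choose k) * c k (n - k) * (real (k choose m) / real (n choose m))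
        = real ((n - m) choose (k - m)) * c k (n - k)"
      by (simp add: divide_simps mult.commute mult.left_commute)
  qed auto
  also have "\<dots> = (\<Sum>j\<le>n - m. real ((n - m) choose j) * c (m + j) (0 + ((n - m) - j)))"
    by (rule sum.reindex_bij_witness[of _ "\<lambda>j. m + j" "\<lambda>k. k - m"]) (use m in auto)
  also have "\<dots> = c m 0" by (rule hausdorff_binomial_sum) (rule rec)
  finally show ?thesis .
qed

text \<open>The point \<open>k / n\<close> gets the mass \<open>c k (n - k)\<close> times a binomial
  coefficient; if \<open>c\<close> comes from a measure, the result is that measure smeared by
  binomial distributions. All masses sit in the unit interval, so Helly's theorem yields a weak
  limit along a subsequence, whose moments are the limits of the moments.\<close>

lemma hausdorff_moments_prob:
  fixes c :: "nat \<Rightarrow> nat \<Rightarrow> real"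
  assumes nonneg: "\<And>k l. 0 \<le> c k l" and rec: "\<And>k l. c k l = c (Suc k) l + c k (Suc l)"
    and one: "c 0 0 = 1"
  obtains M where "real_distribution M" "AE t in M. t \<in> {0..1}"
    "\<And>k. (\<integral>t. t ^ k \<partial>M) = c k 0"
proof -
  define w where "w n k = real (n choose k) * c k (n - k)" for n k
  have w0: "0 \<le> w n k" for n k by (simp add: w_def nonneg)
  have w1: "(\<Sum>k\<le>n. w n k) = 1" for n
    using hausdorff_binomial_sum[where c = c, OF rec, of n 0 0] one by (simp add: w_def)
  define \<mu> where "\<mu> n = distr (point_measure {..n} (\<lambda>k. ennreal (w n k))) borel (\<lambda>k. real k / real n)" for n
  have ps: "prob_space (point_measure {..n} (\<lambda>k. ennreal (w n k)))" for n
    by (intro prob_spaceI) (simp add: emeasure_point_measure_finite space_point_measure sum_ennreal w0 w1)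
  have rd: "real_distribution (\<mu> n)" for n
    unfolding \<mu>_def real_distribution_def real_distribution_axioms_def
    by (auto intro!: prob_space.prob_space_distr[OF ps] simp: measurable_point_measure_eq1)
  have int: "(\<integral>t. f t \<partial>\<mu> n) = (\<Sum>k\<le>n. w n k * f (real k / real n))"
    if "f \<in> borel_measurable borel" for f :: "real \<Rightarrow> real" and n
    unfolding \<mu>_def using that
    by (subst integral_distr)
      (auto simp: lebesgue_integral_point_measure_finite w0 measurable_point_measure_eq1)
  \<comment> \<open>Tightness is stated with half-open intervals, and the point \<open>0\<close> may
    carry mass; hence the left end \<open>-1\<close>.\<close>
  have mass: "measure (\<mu> n) {-1<..1} = 1" for n
  proof -
    interpret real_distribution "\<mu> n" by (rule rd)
    have "measure (\<mu> n) {-1<..1} = (\<integral>t. indicator {-1<..1} t \<partial>\<mu> n)" by simp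
    also have "\<dots> = (\<Sum>k\<le>n. w n k * indicator {-1<..1} (real k / real n))" by (rule int) simp
    also have "\<dots> = (\<Sum>k\<le>n. w n k)"
      by (auto intro!: sum.cong simp: indicator_def divide_le_eq less_le_trans[of "-1" 0])
    finally show ?thesis using w1 by simp
  qed
  have "tight \<mu>"
    unfolding tight_def using rd
    by (intro conjI allI impI, blast, intro exI[of _ "-1"] exI[of _ 1]) (simp add: mass)
  then obtain r M where r: "strict_mono r" and M: "real_distribution M" and conv: "weak_conv_m (\<mu> \<circ> r) M"
    using tight_imp_convergent_subsubsequence[of \<mu> id] by (auto simp: strict_mono_def)
  interpret M: real_distribution M by (rule M)
  have conv': "(\<lambda>n. \<integral>t. f t \<partial>\<mu> (r n)) \<longlonglongrightarrow> (\<integral>t. f t \<partial>M)"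
    if "continuous_on UNIV f" "\<And>t. \<bar>f t\<bar> \<le> B" for f :: "real \<Rightarrow> real" and B
    using weak_conv_imp_integral_bdd_continuous_conv[of "\<mu> \<circ> r" M f B] rd M conv that
    by (auto simp: continuous_on_eq_continuous_at)
  \<comment> \<open>A bounded continuous function vanishing exactly on the unit interval; weak
    convergence carries its zero integrals over to \<open>M\<close>.\<close>
  define \<delta> where "\<delta> t = min 1 (max (- t) (max 0 (t - 1)))" for t :: real
  have \<delta>: "continuous_on UNIV \<delta>" "\<And>t. \<bar>\<delta> t\<bar> \<le> 1"
    by (auto simp: \<delta>_def intro!: continuous_intros)
  have [measurable]: "\<delta> \<in> borel_measurable borel" by (rule borel_measurable_continuous_onI[OF \<delta>(1)])
  have "(\<integral>t. \<delta> t \<partial>\<mu> n) = 0" for n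
  proof -
    have "(\<integral>t. \<delta> t \<partial>\<mu> n) = (\<Sum>k\<le>n. w n k * \<delta> (real k / real n))"
      by (rule int) (rule borel_measurable_continuous_onI[OF \<delta>(1)])
    also have "\<dots> = 0"
    proof (rule sum.neutral, safe)
      fix k assume "k \<le> n"
      then have "0 \<le> real k / real n" "real k / real n \<le> 1" by (auto simp: divide_le_eq)
      then show "w n k * \<delta> (real k / real n) = 0" by (simp add: \<delta>_def)
    qed
    finally show ?thesis .
  qed
  then have "(\<integral>t. \<delta> t \<partial>M) = 0"
    using conv'[OF \<delta>] by (simp add: LIMSEQ_const_iff)
  moreover have "integrable M \<delta>"
    by (rule M.integrable_const_bound[of _ 1]) (use \<delta> in auto)
  moreover have "0 \<le> \<delta> t" for t by (simp add: \<delta>_def)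
  ultimately have "AE t in M. \<delta> t = 0"
    using integral_nonneg_eq_0_iff_AE[of M \<delta>] by simp
  then have AE: "AE t in M. t \<in> {0..1}"
    by eventually_elim (auto simp: \<delta>_def split: if_splits)
  have mom: "(\<integral>t. t ^ m \<partial>M) = c m 0" for m
  proof -
    \<comment> \<open>Weak convergence tests bounded functions only; the truncation agrees with
      \<open>t ^ m\<close> where the measures live.\<close>
    define g where "g t = (max 0 (min 1 t)) ^ m" for t :: real
    have g: "continuous_on UNIV g" "\<And>t. \<bar>g t\<bar> \<le> 1"
      by (auto simp: g_def power_abs intro!: continuous_intros power_le_one)
    have [measurable]: "g \<in> borel_measurable borel" by (rule borel_measurable_continuous_onI[OF g(1)])
    have gi: "(\<integral>t. g t \<partial>\<mu> n) = (\<Sum>k\<le>n. w n k * (real k / real n) ^ m)" for n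
    proof -
      have "(\<integral>t. g t \<partial>\<mu> n) = (\<Sum>k\<le>n. w n k * g (real k / real n))"
        by (rule int) (rule borel_measurable_continuous_onI[OF g(1)])
      then show ?thesis by (auto intro!: sum.cong simp: g_def divide_le_eq)
    qed
    have "(\<lambda>n. \<integral>t. g t \<partial>\<mu> n) \<longlonglongrightarrow> c m 0"
    proof (rule LIM_zero_cancel, rule Lim_null_comparison)
      show "(\<lambda>n. real m * (real m / (real n - real m))) \<longlonglongrightarrow> 0"
        by real_asymp
      show "\<forall>\<^sub>F n in sequentially. norm ((\<integral>t. g t \<partial>\<mu> n) - c m 0) \<le> real m * (real m / (real n - real m))"
        using eventually_gt_at_top[of "2 * m"]
      proof eventually_elim
        case (elim n)
        have "c m 0 - (\<integral>t. g t \<partial>\<mu> n)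
          = (\<Sum>k\<le>n. w n k * (real (k choose m) / real (n choose m) - (real k / real n) ^ m))"
          using hausdorff_factorial_moment[where c = c, OF rec, of m n] elim
          by (simp add: gi w_def right_diff_distrib sum_subtractf)
        also have "\<bar>\<dots>\<bar> \<le> (\<Sum>k\<le>n. \<bar>w n k * (real (k choose m) / real (n choose m) - (real k / real n) ^ m)\<bar>)"
          by (rule sum_abs)
        also have "\<dots> \<le> (\<Sum>k\<le>n. w n k * (real m * (real m / (real n - real m))))"
          unfolding abs_mult abs_of_nonneg[OF w0] using elim w0 binomial_quotient_approx
          by (intro sum_mono mult_left_mono) auto
        also have "\<dots> = real m * (real m / (real n - real m))"
          by (simp only: sum_distrib_right[symmetric] w1 mult_1)
        finally show ?case by (simp add: abs_minus_commute)
      qed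
    qed
    then have "(\<lambda>n. \<integral>t. g t \<partial>\<mu> (r n)) \<longlonglongrightarrow> c m 0"
      using LIMSEQ_subseq_LIMSEQ[OF _ r] by (auto simp: o_def)
    with conv'[OF g] have "(\<integral>t. g t \<partial>M) = c m 0" by (rule LIMSEQ_unique)
    moreover have "(\<integral>t. g t \<partial>M) = (\<integral>t. t ^ m \<partial>M)"
      by (rule integral_cong_AE) (use AE in \<open>auto simp: g_def\<close>)
    ultimately show ?thesis by simp
  qed
  show ?thesis using that[OF M AE mom] .
qed

text \<open>Division by \<open>c 0 0\<close> reduces to probability measures; if it is zero,
  positivity and the recursion propagate the zero to all of \<open>c\<close>. The mixed moments
  follow from the pure ones by the recursion.\<close>

theorem hausdorff_moments:
  fixes c :: "nat \<Rightarrow> nat \<Rightarrow> real"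
  assumes nonneg: "\<And>k l. 0 \<le> c k l" and rec: "\<And>k l. c k l = c (Suc k) l + c k (Suc l)"
  obtains M where "finite_measure M" "sets M = sets borel" "AE t in M. t \<in> {0..1}"
    "\<And>k l. (\<integral>t. t ^ k * (1 - t) ^ l \<partial>M) = c k l"
proof -
  obtain M :: "real measure" where M: "finite_measure M" "sets M = sets borel" "AE t in M. t \<in> {0..1}"
    and mom: "\<And>k. (\<integral>t. t ^ k \<partial>M) = c k 0"
  proof (cases "c 0 0 = 0")
    case True
    have "c 0 l = 0" for l
    proof (induction l)
      case (Suc l)
      then show ?case using rec[of 0 l] nonneg[of 0 "Suc l"] nonneg[of "Suc 0" l] by linarith
    qed (rule True)
    then have "c k l = 0" for k l
    proof (induction k arbitrary: l)
      case (Suc k)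
      then show ?case using rec[of k l] by simp
    qed
    moreover have "finite_measure (null_measure borel :: real measure)"
      by (rule finite_measureI) simp
    moreover have "AE t in null_measure borel. t \<in> {0..1::real}"
      by (rule AE_I[of _ _ UNIV]) auto
    ultimately show ?thesis
      using that[of "null_measure borel"] by simp
  next
    case False
    with nonneg[of 0 0] have pos: "0 < c 0 0" by simp
    obtain N where N: "real_distribution N" "AE t in N. t \<in> {0..1}" "\<And>k. (\<integral>t. t ^ k \<partial>N) = c k 0 / c 0 0"
    proof (rule hausdorff_moments_prob)
      show "c k l / c 0 0 = c (Suc k) l / c 0 0 + c k (Suc l) / c 0 0" for k l
        by (subst rec) (rule add_divide_distrib)
    qed (use pos nonneg in auto)
    interpret N: real_distribution N by (rule N)
    define M where "M = density N (\<lambda>_. ennreal (c 0 0))"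
    have "finite_measure M"
      by (rule finite_measureI) (simp add: M_def emeasure_density N.emeasure_eq_measure nn_integral_cmult_indicator ennreal_mult_eq_top_iff)
    moreover have "AE t in M. t \<in> {0..1}" unfolding M_def by (subst AE_density) (use N in auto)
    moreover have "(\<integral>t. t ^ k \<partial>M) = c k 0" for k
      unfolding M_def using pos N(3)[of k] by (subst integral_density) auto
    ultimately show ?thesis using that[of M] by (simp add: M_def)
  qed
  interpret finite_measure M by (rule M)
  have [measurable_cong]: "sets M = sets borel" by (rule M)
  have intg: "integrable M (\<lambda>t. t ^ k * (1 - t) ^ l)" for k l
  proof (rule integrable_const_bound[of _ 1])
    show "AE t in M. norm (t ^ k * (1 - t) ^ l) \<le> 1"
      using M(3) by eventually_elim (auto simp: abs_mult power_abs intro!: mult_le_one power_le_one)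
  qed measurable
  have "(\<integral>t. t ^ k * (1 - t) ^ l \<partial>M) = c k l" for k l
  proof (induction l arbitrary: k)
    case (Suc l)
    have "(\<integral>t. t ^ k * (1 - t) ^ Suc l \<partial>M) = (\<integral>t. t ^ k * (1 - t) ^ l - t ^ Suc k * (1 - t) ^ l \<partial>M)"
      by (simp add: algebra_simps)
    also have "\<dots> = c k l - c (Suc k) l"
      using Suc by (subst Bochner_Integration.integral_diff) (auto intro!: intg simp del: power_Suc)
    finally show ?case using rec[of k l] by simp
  qed (simp add: mom)
  with M show ?thesis using that by blast
qed

section \<open>Projection-valued measures\<close>

text \<open>For Borel sets this is \<open>scalar_measure\<close>, freed of the complex inner product
  (\<open>scalar_measure_eq\<close>).\<close>

definition pvm_measure :: "('a::topological_space set \<Rightarrow> 'h::real_inner \<Rightarrow>\<^sub>L 'h) \<Rightarrow> 'h \<Rightarrow> 'a measure" where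
  "pvm_measure E \<xi> = measure_of UNIV (sets borel) (\<lambda>S. ennreal (E S \<xi> \<bullet> \<xi>))"

locale pvm =
  fixes E :: "'a::topological_space set \<Rightarrow> 'h::{real_inner,banach} \<Rightarrow>\<^sub>L 'h"
  assumes symm: "S \<in> sets borel \<Longrightarrow> symm_op (E S)"
    and UNIV: "E UNIV = id_blinfun"
    and Int: "S \<in> sets borel \<Longrightarrow> T \<in> sets borel \<Longrightarrow> E (S \<inter> T) = E S o\<^sub>L E T"
    and sums: "range F \<subseteq> sets borel \<Longrightarrow> disjoint_family F \<Longrightarrow> (\<lambda>k::nat. E (F k) \<xi>) sums E (\<Union>k. F k) \<xi>"
begin

lemma idem: "S \<in> sets borel \<Longrightarrow> E S (E S \<xi>) = E S \<xi>"
  using Int[of S S] by (metis Int_absorb blinfun_apply_blinfun_compose)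

lemma inner_eq_norm: "S \<in> sets borel \<Longrightarrow> E S \<xi> \<bullet> \<xi> = (norm (E S \<xi>))\<^sup>2"
  using symm_opD[OF symm, of S "E S \<xi>" \<xi>] by (simp add: idem power2_norm_eq_inner)

lemma empty: "E {} = 0"
proof (rule blinfun_eqI)
  fix \<xi>
  have "(\<lambda>k::nat. E {} \<xi>) sums E (\<Union>k::nat. {}) \<xi>"
    by (rule sums) (auto simp: disjoint_family_on_def)
  then have "(\<lambda>k::nat. E {} \<xi>) \<longlonglongrightarrow> 0" by (intro summable_LIMSEQ_zero sums_summable)
  then show "E {} \<xi> = (0 :: 'h \<Rightarrow>\<^sub>L 'h) \<xi>" by (simp add: LIMSEQ_const_iff)
qed

lemma space_measure [simp]: "space (pvm_measure E \<xi>) = UNIV"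
  and sets_measure [simp, measurable_cong]: "sets (pvm_measure E \<xi>) = sets borel"
  by (simp_all add: pvm_measure_def space_measure_of_conv sets.sigma_sets_eq[of borel, simplified])

lemma emeasure_measure:
  assumes "S \<in> sets borel"
  shows "emeasure (pvm_measure E \<xi>) S = ennreal (E S \<xi> \<bullet> \<xi>)"
proof (rule emeasure_measure_of[OF pvm_measure_def])
  show "positive (sets (pvm_measure E \<xi>)) (\<lambda>S. ennreal (E S \<xi> \<bullet> \<xi>))"
    by (simp add: positive_def empty)
  show "countably_additive (sets (pvm_measure E \<xi>)) (\<lambda>S. ennreal (E S \<xi> \<bullet> \<xi>))"
  proof (rule countably_additiveI)
    fix F :: "nat \<Rightarrow> 'a set"
    assume F: "range F \<subseteq> sets (pvm_measure E \<xi>)" "disjoint_family F"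
    then have "(\<lambda>k. E (F k) \<xi> \<bullet> \<xi>) sums (E (\<Union>k. F k) \<xi> \<bullet> \<xi>)"
      by (intro bounded_linear.sums[OF bounded_linear_inner_left] sums) auto
    then show "(\<Sum>k. ennreal (E (F k) \<xi> \<bullet> \<xi>)) = ennreal (E (\<Union>k. F k) \<xi> \<bullet> \<xi>)"
      using F by (intro suminf_ennreal_eq) (auto simp: inner_eq_norm)
  qed
qed (use assms in auto)

lemma measure_measure: "S \<in> sets borel \<Longrightarrow> measure (pvm_measure E \<xi>) S = E S \<xi> \<bullet> \<xi>"
  by (simp add: measure_def emeasure_measure inner_eq_norm)

lemma finite_measure: "finite_measure (pvm_measure E \<xi>)"
  by (rule finite_measureI) (simp add: emeasure_measure)

lemma measure_UNIV: "measure (pvm_measure E \<xi>) UNIV = (norm \<xi>)\<^sup>2"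
  by (simp add: measure_measure UNIV power2_norm_eq_inner)

lemma Compl: "S \<in> sets borel \<Longrightarrow> E (- S) = id_blinfun - E S"
proof (rule symm_op_eqI)
  fix \<xi> assume S: "S \<in> sets borel"
  interpret finite_measure "pvm_measure E \<xi>" by (rule finite_measure)
  show "E (- S) \<xi> \<bullet> \<xi> = (id_blinfun - E S) \<xi> \<bullet> \<xi>"
    using finite_measure_compl[of S] S UNIV
    by (simp add: measure_measure Compl_eq_Diff_UNIV blinfun.diff_left inner_diff_left)
qed (auto intro!: symm symm_op_diff)

lemma AE_measure:
  assumes "S \<in> sets borel" "E S = id_blinfun"
  shows "AE t in pvm_measure E \<xi>. t \<in> S"
proof (rule AE_I[of _ _ "- S"])
  show "emeasure (pvm_measure E \<xi>) (- S) = 0"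
    using assms by (simp add: emeasure_measure Compl)
qed (use assms in auto)

end

lemma pvm_vimage:
  assumes "pvm E" and [measurable]: "\<phi> \<in> borel_measurable borel"
  shows "pvm (\<lambda>S. E (\<phi> -` S))"
proof -
  interpret pvm E by fact
  have m: "S \<in> sets borel \<Longrightarrow> \<phi> -` S \<in> sets borel" for S
    using measurable_sets[OF assms(2), of S] by simp
  show ?thesis
  proof
    show "(\<lambda>k. E (\<phi> -` F k) \<xi>) sums E (\<phi> -` (\<Union>k. F k)) \<xi>"
      if "range F \<subseteq> sets borel" "disjoint_family F" for F :: "nat \<Rightarrow> _" and \<xi>
      unfolding vimage_UN using that
      by (intro sums) (auto simp: disjoint_family_on_def intro!: m)
  qed (auto simp: symm Int UNIV m)
qed

lemma pvm_measure_vimage: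
  assumes "pvm E" and [measurable]: "\<phi> \<in> borel_measurable borel"
  shows "pvm_measure (\<lambda>S. E (\<phi> -` S)) \<xi> = distr (pvm_measure E \<xi>) borel \<phi>"
proof -
  interpret pvm E by fact
  interpret V: pvm "\<lambda>S. E (\<phi> -` S)" by (rule pvm_vimage) fact+
  show ?thesis
  proof (rule measure_eqI)
    fix S assume "S \<in> sets (pvm_measure (\<lambda>S. E (\<phi> -` S)) \<xi>)"
    then have S: "S \<in> sets borel" by simp
    then have "\<phi> -` S \<in> sets borel" using measurable_sets[OF assms(2), of S] by simp
    with S show "emeasure (pvm_measure (\<lambda>S. E (\<phi> -` S)) \<xi>) S = emeasure (distr (pvm_measure E \<xi>) borel \<phi>) S"
      by (simp add: V.emeasure_measure emeasure_distr emeasure_measure)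
  qed simp
qed

section \<open>The spectral theorem\<close>

text \<open>A monotone class argument restricted to what operators can follow: limits are bounded
  and increasing, as in Vigier's theorem. The base functions are those whose integrals are the
  Hausdorff moments, and Bernstein polynomials are combinations of them; continuous functions,
  half-lines and Borel sets follow in this order.\<close>

lemma indicator_class_induct:
  fixes Q :: "(real \<Rightarrow> real) \<Rightarrow> bool"
  assumes base: "\<And>k l. Q (\<lambda>t. t ^ k * (1 - t) ^ l)"
    and add: "\<And>f g. Q f \<Longrightarrow> Q g \<Longrightarrow> Q (\<lambda>t. f t + g t)"
    and scale: "\<And>c f. Q f \<Longrightarrow> Q (\<lambda>t. c * f t)"
    and lim: "\<And>F f C. (\<And>n. Q (F n)) \<Longrightarrow> f \<in> borel_measurable borel \<Longrightarrow>
        (\<And>n t. t \<in> {0..1} \<Longrightarrow> F n t \<le> F (Suc n) t) \<Longrightarrow> (\<And>n t. t \<in> {0..1} \<Longrightarrow> \<bar>F n t\<bar> \<le> C) \<Longrightarrow>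
        (\<And>t. t \<in> {0..1} \<Longrightarrow> (\<lambda>n. F n t) \<longlonglongrightarrow> f t) \<Longrightarrow> Q f"
    and S: "S \<in> sets borel"
  shows "Q (indicator S)"
proof -
  have one: "Q (\<lambda>t. 1)" and zero: "Q (\<lambda>t. 0)" using base[of 0 0] scale[OF base[of 0 0], of 0] by auto
  have sum: "Q (\<lambda>t. \<Sum>i\<in>J. f i t)" if "\<And>i. i \<in> J \<Longrightarrow> Q (f i)" "finite J" for f :: "nat \<Rightarrow> real \<Rightarrow> real" and J
    using that(2,1) by (induction J rule: finite_induct) (auto intro: zero add)
  have cont: "Q f" if f: "continuous_on UNIV f" for f
  proof -
    \<comment> \<open>Approximating \<open>f - 2 * e n\<close> within \<open>e n\<close> makes the
      polynomials increase: \<open>p n < f - e n\<close>, whereas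
      \<open>p (Suc n) > f - 3 * e (Suc n)\<close>, and \<open>3 * e (Suc n)\<close> is less than
      \<open>e n\<close>.\<close>
    define e where "e n = (1/4::real) ^ n" for n
    have e: "0 < e n" "e (Suc n) = e n / 4" "e n \<le> 1" for n by (auto simp: e_def power_le_one)
    have "\<exists>p. Q p \<and> (\<forall>t\<in>{0..1}. \<bar>(f t - 2 * e n) - p t\<bar> < e n)" for n
    proof -
      have "continuous_on {0..1} (\<lambda>t. f t - 2 * e n)"
        by (intro continuous_intros continuous_on_subset[OF f]) auto
      from Bernstein_Weierstrass[OF this e(1)] obtain N where
        "\<forall>t\<in>{0..1}. \<bar>(f t - 2 * e n) - (\<Sum>k\<le>N. (f (k/N) - 2 * e n) * Bernstein N k t)\<bar> < e n"
        by blast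
      moreover have "Q (\<lambda>t. \<Sum>k\<le>N. (f (k/N) - 2 * e n) * Bernstein N k t)"
        unfolding Bernstein_def using scale[OF scale[OF base]] by (intro sum) (auto simp: mult.assoc)
      ultimately show ?thesis by blast
    qed
    then obtain p where p: "\<And>n. Q (p n)" "\<And>n t. t \<in> {0..1} \<Longrightarrow> \<bar>(f t - 2 * e n) - p n t\<bar> < e n" by metis
    obtain C where C: "\<And>t. t \<in> {0..1} \<Longrightarrow> \<bar>f t\<bar> \<le> C"
      using compact_imp_bounded[OF compact_continuous_image[OF continuous_on_subset[OF f] compact_Icc[of 0 1]]]
      by (force simp: bounded_iff)
    show ?thesis
    proof (rule lim[of p])
      show "f \<in> borel_measurable borel" by (rule borel_measurable_continuous_onI[OF f])
      show "p n t \<le> p (Suc n) t" if "t \<in> {0..1}" for n t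
        using p(2)[OF that, of n] p(2)[OF that, of "Suc n"] e(1)[of n] e(2)[of n] by linarith
      show "\<bar>p n t\<bar> \<le> C + 3" if "t \<in> {0..1}" for n t
        using p(2)[OF that, of n] C[OF that] e(1)[of n] e(3)[of n] by linarith
      show "(\<lambda>n. p n t) \<longlonglongrightarrow> f t" if "t \<in> {0..1}" for t
      proof (rule LIM_zero_cancel, rule Lim_null_comparison)
        show "\<forall>\<^sub>F n in sequentially. norm (p n t - f t) \<le> 3 * e n"
          using p(2)[OF that] e(1) by (intro always_eventually allI) (smt (verit) real_norm_def)
        show "(\<lambda>n. 3 * e n) \<longlonglongrightarrow> 0"
          unfolding e_def by (rule tendsto_mult_right_zero) (rule LIMSEQ_power_zero, simp)
      qed
    qed (rule p)
  qed
  have half: "Q (indicator {a<..})" for a :: real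
  proof (rule lim)
    show "Q (\<lambda>t. min 1 (max 0 (real n * (t - a))))" for n
      by (rule cont) (intro continuous_intros)
    show "min 1 (max 0 (real n * (t - a))) \<le> min 1 (max 0 (real (Suc n) * (t - a)))" for n t
    proof -
      have "max 0 (real n * (t - a)) \<le> max 0 (real (Suc n) * (t - a))"
      proof (cases "a \<le> t")
        case True
        then have "real n * (t - a) \<le> real (Suc n) * (t - a)" by (intro mult_right_mono) auto
        then show ?thesis by (rule max.mono[OF order_refl])
      next
        case False
        then have "real n * (t - a) \<le> 0" by (simp add: mult_nonneg_nonpos)
        then show ?thesis by linarith
      qed
      then show ?thesis by linarith
    qed
    show "\<bar>min 1 (max 0 (real n * (t - a)))\<bar> \<le> 1" for n t by auto
    show "(\<lambda>n. min 1 (max 0 (real n * (t - a)))) \<longlonglongrightarrow> indicator {a<..} t" for t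
    proof (cases "a < t")
      case True
      have "\<forall>\<^sub>F n in sequentially. 1 / (t - a) \<le> real n"
        using filterlim_real_sequentially by (simp add: filterlim_at_top)
      then have "\<forall>\<^sub>F n in sequentially. min 1 (max 0 (real n * (t - a))) = indicator {a<..} t"
        by eventually_elim (use True in \<open>auto simp: field_simps\<close>)
      then show ?thesis by (rule tendsto_eventually)
    next
      case False
      then have "real n * (t - a) \<le> 0" for n by (simp add: mult_nonneg_nonpos)
      then have "min 1 (max 0 (real n * (t - a))) = 0" for n
        by (simp add: max_absorb1)
      with False show ?thesis by simp
    qed
  qed auto
  have stable: "Int_stable (range (\<lambda>a::real. {a<..}))"
  proof -
    have "{a<..} \<inter> {b<..} = {max a b<..}" for a b :: real by auto
    then show ?thesis unfolding Int_stable_def by (metis (no_types, lifting) imageE rangeI)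
  qed
  have sub: "range (\<lambda>a::real. {a<..}) \<subseteq> Pow UNIV" by simp
  have "S \<in> sigma_sets UNIV (range (\<lambda>a::real. {a<..}))"
    using S by (simp add: borel_Ioi)
  with stable sub show ?thesis
  proof (induction rule: sigma_sets_induct_disjoint)
    case (compl A)
    have "(indicator (UNIV - A) :: real \<Rightarrow> real) = (\<lambda>t. 1 + (-1) * indicator A t)" by (auto simp: indicator_def)
    then show ?case using add[OF one scale[OF compl(2), of "-1"]] by metis
  next
    case (union A)
    show ?case
    proof (rule lim)
      show "Q (\<lambda>t. \<Sum>i<n. indicator (A i) t)" for n using union by (intro sum) auto
      show "(\<lambda>n. \<Sum>i<n. indicator (A i) t) \<longlonglongrightarrow> (indicator (\<Union>i. A i) t :: real)" for t :: real
        using indicator_sums[of A t] union(1) by (auto simp: sums_def disjoint_family_on_def)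
      show "\<bar>\<Sum>i<n. indicator (A i) t\<bar> \<le> (1::real)" for n t
      proof -
        have "(\<Sum>i<n. indicator (A i) t) = (indicator (\<Union>i<n. A i) t :: real)"
          using union(1) by (subst indicator_UN_disjoint) (auto simp: disjoint_family_on_def)
        then show ?thesis by simp
      qed
      have "A i \<in> sets borel" for i using union(2) by (auto simp: borel_Ioi)
      then show "indicator (\<Union>i. A i) \<in> borel_measurable borel" by measurable
    qed auto
  next
    case (basic A)
    then show ?case using half by auto
  next
    case empty
    then show ?case using zero by (simp add: indicator_def[abs_def])
  qed
qed

section \<open>Operators with prescribed quadratic forms\<close>

lemma blinfun_compose_assoc: "(a o\<^sub>L b) o\<^sub>L c = a o\<^sub>L (b o\<^sub>L c)"
  by (rule blinfun_eqI) simp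

lemma blinfun_compose_id [simp]: "a o\<^sub>L id_blinfun = a" "id_blinfun o\<^sub>L a = a"
  by (rule blinfun_eqI, simp)+

lemmas blinfun_compose_simps = bounded_bilinear.add_left[OF bounded_bilinear_blinfun_compose]
  bounded_bilinear.add_right[OF bounded_bilinear_blinfun_compose]
  bounded_bilinear.diff_left[OF bounded_bilinear_blinfun_compose]
  bounded_bilinear.diff_right[OF bounded_bilinear_blinfun_compose]
  bounded_bilinear.scaleR_left[OF bounded_bilinear_blinfun_compose]
  bounded_bilinear.scaleR_right[OF bounded_bilinear_blinfun_compose]
  bounded_bilinear.minus_left[OF bounded_bilinear_blinfun_compose]
  bounded_bilinear.minus_right[OF bounded_bilinear_blinfun_compose]

text \<open>The measures \<open>M \<xi>\<close> are given separately for each vector, so integration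
  against them yields no operator by itself; operators exist for the base functions and pass to
  indicators along increasing limits. A pair \<open>(h, W)\<close> in \<open>R\<close> stands for an
  operator \<open>W\<close> representing \<open>h\<close>; that \<open>T o\<^sub>L W\<close> is
  symmetric and represents the product of the functions is carried through the limits. The pair of
  \<open>1\<close> and the identity gives the form of \<open>T\<close> itself.\<close>

lemma moment_class:
  fixes M :: "'h::{real_inner,banach} \<Rightarrow> real measure" and R :: "((real \<Rightarrow> real) \<times> ('h \<Rightarrow>\<^sub>L 'h)) set"
  assumes fin: "\<And>\<xi>. finite_measure (M \<xi>)" and sets: "\<And>\<xi>. sets (M \<xi>) = sets borel"
    and AE: "\<And>\<xi>. AE t in M \<xi>. t \<in> {0..1}" and mass: "\<And>\<xi>. measure (M \<xi>) UNIV = (norm \<xi>)\<^sup>2"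
    and one: "(\<lambda>_. 1, id_blinfun) \<in> R"
    and R: "\<And>h W. (h, W) \<in> R \<Longrightarrow> h \<in> borel_measurable borel \<and> (\<exists>C. \<forall>t\<in>{0..1}. \<bar>h t\<bar> \<le> C)"
    and base: "\<And>k l. \<exists>T. symm_op T \<and> (\<forall>(h, W)\<in>R. symm_op (T o\<^sub>L W) \<and>
      (\<forall>\<xi>. T (W \<xi>) \<bullet> \<xi> = (\<integral>t. t ^ k * (1 - t) ^ l * h t \<partial>M \<xi>)))"
    and S: "S \<in> sets borel"
  obtains T where "symm_op T" "\<And>h W. (h, W) \<in> R \<Longrightarrow> symm_op (T o\<^sub>L W)"
    "\<And>h W \<xi>. (h, W) \<in> R \<Longrightarrow> T (W \<xi>) \<bullet> \<xi> = (\<integral>t. indicator S t * h t \<partial>M \<xi>)"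
proof -
  define Op where "Op f T \<longleftrightarrow> symm_op T \<and> (\<forall>(h, W)\<in>R. symm_op (T o\<^sub>L W) \<and>
      (\<forall>\<xi>. T (W \<xi>) \<bullet> \<xi> = (\<integral>t. f t * h t \<partial>M \<xi>)))" for f T
  have OpD: "symm_op T" "(h, W) \<in> R \<Longrightarrow> symm_op (T o\<^sub>L W)"
    "(h, W) \<in> R \<Longrightarrow> T (W \<xi>) \<bullet> \<xi> = (\<integral>t. f t * h t \<partial>M \<xi>)" if "Op f T" for f T h W \<xi>
    using that unfolding Op_def by blast+
  define Q where "Q f \<longleftrightarrow> f \<in> borel_measurable borel \<and> (\<exists>C. \<forall>t\<in>{0..1::real}. \<bar>f t\<bar> \<le> C) \<and> (\<exists>T. Op f T)" for f
  have [measurable_cong]: "sets (M \<xi>) = sets borel" for \<xi> by (rule sets)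
  have intg: "integrable (M \<xi>) f" if "f \<in> borel_measurable borel" "\<And>t. t \<in> {0..1} \<Longrightarrow> \<bar>f t\<bar> \<le> C" for f and C :: real and \<xi>
  proof -
    interpret finite_measure "M \<xi>" by (rule fin)
    show ?thesis
      by (rule integrable_const_bound[of _ C], rule eventually_mono[OF AE]) (use that in auto)
  qed
  have intg': "integrable (M \<xi>) (\<lambda>t. f t * h t)"
    if f: "f \<in> borel_measurable borel" "\<And>t. t \<in> {0..1} \<Longrightarrow> \<bar>f t\<bar> \<le> C" and h: "(h, W) \<in> R" for f h W and C :: real and \<xi>
  proof -
    obtain D where D: "h \<in> borel_measurable borel" "\<And>t. t \<in> {0..1} \<Longrightarrow> \<bar>h t\<bar> \<le> D" using R[OF h] by blast
    show ?thesis
      by (rule intg[where C = "C * D"])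
        (use f D in \<open>auto simp: abs_mult intro!: mult_mono order_trans[OF abs_ge_zero]\<close>)
  qed
  have "Q (indicator S)"
  proof (rule indicator_class_induct[OF _ _ _ _ S])
    show "Q (\<lambda>t. t ^ k * (1 - t) ^ l)" for k l
      unfolding Q_def
    proof (intro conjI exI[of _ 1])
      show "\<forall>t\<in>{0..1::real}. \<bar>t ^ k * (1 - t) ^ l\<bar> \<le> 1"
        by (auto simp: abs_mult power_abs intro!: mult_le_one power_le_one)
      show "\<exists>T. Op (\<lambda>t. t ^ k * (1 - t) ^ l) T" using base[of k l] by (simp add: Op_def)
    qed measurable
  next
    fix f g assume "Q f" "Q g"
    then obtain C D T U where f: "f \<in> borel_measurable borel" "\<And>t. t \<in> {0..1} \<Longrightarrow> \<bar>f t\<bar> \<le> C" "Op f T"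
      and g: "g \<in> borel_measurable borel" "\<And>t. t \<in> {0..1} \<Longrightarrow> \<bar>g t\<bar> \<le> D" "Op g U"
      unfolding Q_def by blast
    have "\<forall>t\<in>{0..1}. \<bar>f t + g t\<bar> \<le> C + D"
      using f(2) g(2) by (meson abs_triangle_ineq add_mono order_trans)
    moreover have "Op (\<lambda>t. f t + g t) (T + U)"
      unfolding Op_def
    proof (intro conjI ballI, safe)
      show "symm_op (T + U)" using f g by (auto simp: Op_def intro: symm_op_add)
      fix h W assume h: "(h, W) \<in> R"
      show "symm_op ((T + U) o\<^sub>L W)" using OpD(2)[OF f(3) h] OpD(2)[OF g(3) h] by (simp add: blinfun_compose_simps symm_op_add)
      fix \<xi>
      have "(\<integral>t. (f t + g t) * h t \<partial>M \<xi>) = (\<integral>t. f t * h t \<partial>M \<xi>) + (\<integral>t. g t * h t \<partial>M \<xi>)"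
        using intg'[OF f(1,2) h] intg'[OF g(1,2) h] by (simp add: distrib_right)
      then show "(T + U) (W \<xi>) \<bullet> \<xi> = (\<integral>t. (f t + g t) * h t \<partial>M \<xi>)"
        using OpD(3)[OF f(3) h] OpD(3)[OF g(3) h] by (simp add: blinfun.add_left inner_add_left)
    qed
    ultimately show "Q (\<lambda>t. f t + g t)" using f(1) g(1) unfolding Q_def by auto
  next
    fix f :: "real \<Rightarrow> real" and c :: real assume "Q f"
    then obtain C T where f: "f \<in> borel_measurable borel" "\<And>t. t \<in> {0..1} \<Longrightarrow> \<bar>f t\<bar> \<le> C" "Op f T"
      unfolding Q_def by blast
    have "\<forall>t\<in>{0..1}. \<bar>c * f t\<bar> \<le> \<bar>c\<bar> * C"
      using f(2) by (auto simp: abs_mult intro!: mult_left_mono)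
    moreover have "Op (\<lambda>t. c * f t) (c *\<^sub>R T)"
      using f(3) by (auto simp: Op_def blinfun_compose_simps blinfun.scaleR_left mult.assoc intro!: symm_op_scaleR)
    ultimately show "Q (\<lambda>t. c * f t)" using f(1) unfolding Q_def by auto
  next
    fix F f and C :: real
    assume Q: "\<And>n. Q (F n)" and f: "f \<in> borel_measurable borel"
      and inc: "\<And>n t. t \<in> {0..1} \<Longrightarrow> F n t \<le> F (Suc n) t" and C: "\<And>n t. t \<in> {0..1} \<Longrightarrow> \<bar>F n t\<bar> \<le> C"
      and lim: "\<And>t. t \<in> {0..1} \<Longrightarrow> (\<lambda>n. F n t) \<longlonglongrightarrow> f t"
    have Fm: "F n \<in> borel_measurable borel" for n using Q[of n] by (simp add: Q_def)
    obtain T where T: "\<And>n. Op (F n) (T n)" using Q unfolding Q_def by metis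
    have T1: "T n \<xi> \<bullet> \<xi> = (\<integral>t. F n t \<partial>M \<xi>)" for n \<xi>
      using OpD(3)[OF T one, of n \<xi>] by simp
    obtain U where U: "symm_op U" "\<And>\<xi>. (\<lambda>n. T n \<xi>) \<longlonglongrightarrow> U \<xi>"
    proof (rule incseq_op_convergent)
      show "symm_op (T n)" for n using T by (simp add: Op_def)
      show "T m \<xi> \<bullet> \<xi> \<le> T n \<xi> \<bullet> \<xi>" if "m \<le> n" for m n \<xi>
        unfolding T1
      proof (rule integral_mono_AE)
        show "AE t in M \<xi>. F m t \<le> F n t"
          using AE by eventually_elim (metis lift_Suc_mono_le[of "\<lambda>n. F n _", OF inc] that)
      qed (use intg[OF Fm C] in auto)
      show "T n \<xi> \<bullet> \<xi> \<le> C * (norm \<xi>)\<^sup>2" for n \<xi>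
      proof -
        interpret finite_measure "M \<xi>" by (rule fin)
        have "(\<integral>t. F n t \<partial>M \<xi>) \<le> (\<integral>t. C \<partial>M \<xi>)"
        proof (rule integral_mono_AE)
          show "AE t in M \<xi>. F n t \<le> C"
            by (rule eventually_mono[OF AE]) (use C in \<open>auto simp: abs_le_iff\<close>)
        qed (use intg[OF Fm C] in auto)
        then show ?thesis using mass[of \<xi>] sets_eq_imp_space_eq[OF sets[of \<xi>]] by (simp add: T1 mult.commute)
      qed
    qed (rule that)
    have "\<bar>f t\<bar> \<le> C" if "t \<in> {0..1}" for t
      by (rule LIMSEQ_le_const2[OF tendsto_rabs[OF lim[OF that]]]) (use C that in auto)
    moreover have "Op f U"
      unfolding Op_def
    proof (intro conjI ballI, safe)
      fix h W assume h: "(h, W) \<in> R"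
      have "symm_op (T n o\<^sub>L W)" for n using OpD(2)[OF T h] .
      then have "T n (W \<xi>) \<bullet> \<eta> = \<xi> \<bullet> T n (W \<eta>)" for n \<xi> \<eta> by (auto simp: symm_op_def)
      then have "U (W \<xi>) \<bullet> \<eta> = \<xi> \<bullet> U (W \<eta>)" for \<xi> \<eta>
        using tendsto_inner[OF U(2)[of "W \<xi>"] tendsto_const, of \<eta>]
          tendsto_inner[OF tendsto_const U(2)[of "W \<eta>"], of \<xi>]
        by (simp add: LIMSEQ_unique)
      then show "symm_op (U o\<^sub>L W)" by (simp add: symm_op_def)
      fix \<xi>
      obtain D where D: "h \<in> borel_measurable borel" "\<And>t. t \<in> {0..1} \<Longrightarrow> \<bar>h t\<bar> \<le> D" using R[OF h] by blast
      interpret finite_measure "M \<xi>" by (rule fin)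
      have "(\<lambda>n. \<integral>t. F n t * h t \<partial>M \<xi>) \<longlonglongrightarrow> (\<integral>t. f t * h t \<partial>M \<xi>)"
      proof (rule integral_dominated_convergence[where w = "\<lambda>_. C * D"])
        show "AE t in M \<xi>. (\<lambda>n. F n t * h t) \<longlonglongrightarrow> f t * h t"
          using AE by eventually_elim (intro tendsto_mult lim tendsto_const)
        show "AE t in M \<xi>. norm (F n t * h t) \<le> C * D" for n
          using AE by eventually_elim
            (use C D in \<open>auto simp: abs_mult intro!: mult_mono order_trans[OF abs_ge_zero]\<close>)
      qed (use f Fm D in auto)
      moreover have "(\<integral>t. F n t * h t \<partial>M \<xi>) = T n (W \<xi>) \<bullet> \<xi>" for n using OpD(3)[OF T h] by simp
      ultimately show "U (W \<xi>) \<bullet> \<xi> = (\<integral>t. f t * h t \<partial>M \<xi>)"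
        using tendsto_inner[OF U(2)[of "W \<xi>"] tendsto_const, of \<xi>] by (auto intro: LIMSEQ_unique)
    qed (rule U)
    ultimately show "Q f" using f unfolding Q_def by blast
  qed
  then obtain T where "Op (indicator S) T" unfolding Q_def by blast
  then show ?thesis using that[of T] unfolding Op_def by blast
qed

primrec opow :: "('h::real_inner \<Rightarrow>\<^sub>L 'h) \<Rightarrow> nat \<Rightarrow> 'h \<Rightarrow>\<^sub>L 'h" where
  "opow x 0 = id_blinfun"
| "opow x (Suc n) = x o\<^sub>L opow x n"

lemma opow_commute: "S o\<^sub>L x = x o\<^sub>L S \<Longrightarrow> S o\<^sub>L opow x n = opow x n o\<^sub>L S"
  by (induction n) (simp, metis blinfun_compose_assoc opow.simps(2))

lemma opow_add: "opow x (m + n) = opow x m o\<^sub>L opow x n"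
  by (induction m) (simp_all add: blinfun_compose_assoc)

text \<open>Two passes through \<open>moment_class\<close>. In the first, \<open>R1\<close> holds
  the functions \<open>t ^ k * (1 - t) ^ l\<close> and yields \<open>E S\<close> together with its
  commutation with \<open>B k l\<close>. This is the base case of the second, where
  \<open>R2\<close> holds the projections just found and yields multiplicativity, in particular
  idempotence.\<close>

lemma spectral_theorem_unit:
  fixes x :: "'h::{real_inner,banach} \<Rightarrow>\<^sub>L 'h"
  assumes x: "pos_op x" and y: "pos_op (id_blinfun - x)"
  obtains E where "pvm E" "E {0..1} = id_blinfun" "\<And>\<xi>. (\<integral>t. t \<partial>pvm_measure E \<xi>) = x \<xi> \<bullet> \<xi>"
proof -
  define y where "y = id_blinfun - x"
  define B where "B k l = opow x k o\<^sub>L opow y l" for k l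
  have y: "pos_op y" using assms by (simp add: y_def)
  have xy: "x o\<^sub>L y = y o\<^sub>L x" by (simp add: y_def blinfun_compose_simps)
  have yo: "y o\<^sub>L opow x k = opow x k o\<^sub>L y" for k by (rule opow_commute) (simp add: xy)
  have oo: "opow y l o\<^sub>L opow x k = opow x k o\<^sub>L opow y l" for k l
    by (rule opow_commute[symmetric]) (simp add: yo)
  have xo: "x o\<^sub>L opow y l = opow y l o\<^sub>L x" for l by (rule opow_commute) (simp add: xy)
  have xx: "x o\<^sub>L opow x l = opow x l o\<^sub>L x" and yy: "y o\<^sub>L opow y l = opow y l o\<^sub>L y" for l
    by (rule opow_commute, simp)+
  have B_mult: "B k l o\<^sub>L B k' l' = B (k + k') (l + l')" for k l k' l'
    unfolding B_def opow_add by (metis blinfun_compose_assoc oo)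
  have B_Suc: "B (Suc k) l = x o\<^sub>L B k l" "B (Suc k) l = B k l o\<^sub>L x"
    "B k (Suc l) = y o\<^sub>L B k l" "B k (Suc l) = B k l o\<^sub>L y" for k l
    unfolding B_def opow.simps by (metis blinfun_compose_assoc xo yo xx yy)+
  have B_rec: "B k l = B (Suc k) l + B k (Suc l)" for k l
  proof -
    have "B (Suc k) l + B k (Suc l) = (x + y) o\<^sub>L B k l"
      by (simp only: B_Suc(1,3) blinfun_compose_simps)
    then show ?thesis by (simp add: y_def)
  qed
  \<comment> \<open>Positivity of the product of \<open>x\<close> and \<open>y\<close>: multiplied
    by \<open>1 = x + y\<close> it splits into two compressions of positive operators.\<close>
  have B_11: "B (Suc 0) (Suc 0) = (x o\<^sub>L y o\<^sub>L x) + (y o\<^sub>L x o\<^sub>L y)"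
  proof -
    have "B (Suc 0) (Suc 0) = (x o\<^sub>L y) o\<^sub>L (x + y)" by (simp add: B_def y_def)
    also have "\<dots> = (x o\<^sub>L y o\<^sub>L x) + (y o\<^sub>L x o\<^sub>L y)"
      by (simp only: blinfun_compose_simps xy)
    finally show ?thesis .
  qed
  have B_pos: "pos_op (B k l)" for k l
  proof (induction "k + l" arbitrary: k l rule: less_induct)
    case less
    \<comment> \<open>An exponent of at least two loses a pair of equal factors to a compression;
      only degrees zero and one and the product of \<open>x\<close> and \<open>y\<close>
      remain.\<close>
    consider "2 \<le> k" | "2 \<le> l" | "k = 0" "l = 0" | "k = 1" "l = 0" | "k = 0" "l = 1" | "k = 1" "l = 1"
      by linarith
    then show ?case
    proof cases
      case 1
      then have k: "k = Suc (Suc (k - 2))" by simp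
      have "B k l = x o\<^sub>L B (k - 2) l o\<^sub>L x"
        by (subst k, subst B_Suc(2), subst B_Suc(1)) simp
      then show ?thesis using less[of "k - 2" l] 1 by (simp add: pos_op_sandwich pos_op_symm x)
    next
      case 2
      then have l: "l = Suc (Suc (l - 2))" by simp
      have "B k l = y o\<^sub>L B k (l - 2) o\<^sub>L y"
        by (subst l, subst B_Suc(4), subst B_Suc(3)) simp
      then show ?thesis using less[of k "l - 2"] 2 by (simp add: pos_op_sandwich pos_op_symm y)
    next
      case 6
      then show ?thesis using B_11 x y by (simp add: pos_op_add pos_op_sandwich pos_op_symm)
    qed (simp_all add: B_def x y)
  qed
  have ex: "\<exists>M. finite_measure M \<and> sets M = sets borel \<and> (AE t in M. t \<in> {0..1}) \<and>
      (\<forall>k l. (\<integral>t. t ^ k * (1 - t) ^ l \<partial>M) = B k l \<xi> \<bullet> \<xi>)" for \<xi>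
  proof (rule hausdorff_moments)
    show "B k l \<xi> \<bullet> \<xi> = B (Suc k) l \<xi> \<bullet> \<xi> + B k (Suc l) \<xi> \<bullet> \<xi>" for k l
      by (subst B_rec) (simp add: blinfun.add_left inner_add_left)
  qed (use pos_opD[OF B_pos] in auto)
  have "\<exists>M. \<forall>\<xi>. finite_measure (M \<xi>) \<and> sets (M \<xi>) = sets borel \<and> (AE t in M \<xi>. t \<in> {0..1}) \<and>
      (\<forall>k l. (\<integral>t. t ^ k * (1 - t) ^ l \<partial>M \<xi>) = B k l \<xi> \<bullet> \<xi>)"
    by (rule choice) (intro allI ex)
  then obtain M where fin: "\<And>\<xi>. finite_measure (M \<xi>)" and sets: "\<And>\<xi>. sets (M \<xi>) = sets borel"
    and AE: "\<And>\<xi>. AE t in M \<xi>. t \<in> {0..1}"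
    and mom: "\<And>k l \<xi>. (\<integral>t. t ^ k * (1 - t) ^ l \<partial>M \<xi>) = B k l \<xi> \<bullet> \<xi>"
    by blast
  have space: "space (M \<xi>) = UNIV" for \<xi> using sets_eq_imp_space_eq[OF sets] by simp
  have mass: "measure (M \<xi>) UNIV = (norm \<xi>)\<^sup>2" for \<xi>
  proof -
    interpret finite_measure "M \<xi>" by (rule fin)
    show ?thesis using mom[of \<xi> 0 0] by (simp add: B_def space power2_norm_eq_inner)
  qed
  define R1 where "R1 = {(\<lambda>t::real. t ^ k * (1 - t) ^ l, B k l) | k l. True}"
  have exE: "\<exists>T. symm_op T \<and> (\<forall>k l. symm_op (T o\<^sub>L B k l) \<and>
      (\<forall>\<xi>. T (B k l \<xi>) \<bullet> \<xi> = (\<integral>t. indicator S t * (t ^ k * (1 - t) ^ l) \<partial>M \<xi>)))" if S: "S \<in> sets borel" for S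
  proof (rule moment_class[OF fin sets AE mass _ _ _ S, of R1])
    show "(\<lambda>_. 1, id_blinfun) \<in> R1"
      unfolding R1_def by (auto intro!: exI[of _ 0] simp: B_def)
    show "h \<in> borel_measurable borel \<and> (\<exists>C. \<forall>t\<in>{0..1}. \<bar>h t\<bar> \<le> C)" if "(h, W) \<in> R1" for h W
      using that by (auto simp: R1_def abs_mult power_abs intro!: exI[of _ 1] mult_le_one power_le_one)
    show "\<exists>T. symm_op T \<and> (\<forall>(h, W)\<in>R1. symm_op (T o\<^sub>L W) \<and>
        (\<forall>\<xi>. T (W \<xi>) \<bullet> \<xi> = (\<integral>t. t ^ k * (1 - t) ^ l * h t \<partial>M \<xi>)))" for k l
    proof (intro exI[of _ "B k l"] conjI ballI, safe)
      fix h W assume "(h, W) \<in> R1"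
      then obtain k' l' where h: "h = (\<lambda>t. t ^ k' * (1 - t) ^ l')" "W = B k' l'" by (auto simp: R1_def)
      show "symm_op (B k l o\<^sub>L W)" using pos_op_symm[OF B_pos] by (simp add: h B_mult)
      fix \<xi>
      have "(\<lambda>t. t ^ k * (1 - t) ^ l * h t) = (\<lambda>t. t ^ (k + k') * (1 - t) ^ (l + l'))"
        by (auto simp: h power_add)
      then show "B k l (W \<xi>) \<bullet> \<xi> = (\<integral>t. t ^ k * (1 - t) ^ l * h t \<partial>M \<xi>)"
        using B_mult[of k l k' l'] by (simp add: mom h flip: blinfun_apply_blinfun_compose)
    qed (rule pos_op_symm[OF B_pos])
  next
    fix T assume "symm_op T" "\<And>h W. (h, W) \<in> R1 \<Longrightarrow> symm_op (T o\<^sub>L W)"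
      "\<And>h W \<xi>. (h, W) \<in> R1 \<Longrightarrow> T (W \<xi>) \<bullet> \<xi> = (\<integral>t. indicator S t * h t \<partial>M \<xi>)"
    then show ?thesis unfolding R1_def by (intro exI[of _ T]) blast
  qed
  have exE': "\<exists>E. \<forall>S. S \<in> sets borel \<longrightarrow> symm_op (E S) \<and> (\<forall>k l. symm_op (E S o\<^sub>L B k l) \<and>
      (\<forall>\<xi>. E S (B k l \<xi>) \<bullet> \<xi> = (\<integral>t. indicator S t * (t ^ k * (1 - t) ^ l) \<partial>M \<xi>)))"
    by (rule choice) (use exE in blast)
  obtain E where E: "\<forall>S. S \<in> sets borel \<longrightarrow> symm_op (E S) \<and> (\<forall>k l. symm_op (E S o\<^sub>L B k l) \<and>
      (\<forall>\<xi>. E S (B k l \<xi>) \<bullet> \<xi> = (\<integral>t. indicator S t * (t ^ k * (1 - t) ^ l) \<partial>M \<xi>)))"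
    by (rule that[OF someI_ex[OF exE']])
  have E_symm: "symm_op (E S)" and E_symm': "symm_op (E S o\<^sub>L B k l)"
    and E_int: "E S (B k l \<xi>) \<bullet> \<xi> = (\<integral>t. indicator S t * (t ^ k * (1 - t) ^ l) \<partial>M \<xi>)"
    if "S \<in> sets borel" for S k l \<xi>
    using E[rule_format, OF that] by simp_all
  have E_meas: "E S \<xi> \<bullet> \<xi> = measure (M \<xi>) S" if "S \<in> sets borel" for S \<xi>
    using E_int[OF that, of 0 0] by (simp add: B_def space)
  have E_UNIV: "E UNIV = id_blinfun"
    by (rule symm_op_eqI) (simp_all add: E_symm E_meas mass power2_norm_eq_inner)
  define R2 where "R2 = {(indicator S :: real \<Rightarrow> real, E S) | S. S \<in> sets borel}"
  have E_Int: "E (T \<inter> S) = E T o\<^sub>L E S" if S: "S \<in> sets borel" and T: "T \<in> sets borel" for S T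
  proof (rule moment_class[OF fin sets AE mass _ _ _ T, of R2])
    show "(\<lambda>_. 1, id_blinfun) \<in> R2"
      unfolding R2_def by (auto intro!: exI[of _ UNIV] simp: E_UNIV)
    show "h \<in> borel_measurable borel \<and> (\<exists>C. \<forall>t\<in>{0..1}. \<bar>h t\<bar> \<le> C)" if "(h, W) \<in> R2" for h W
      using that by (auto simp: R2_def intro!: exI[of _ 1])
    show "\<exists>T. symm_op T \<and> (\<forall>(h, W)\<in>R2. symm_op (T o\<^sub>L W) \<and>
        (\<forall>\<xi>. T (W \<xi>) \<bullet> \<xi> = (\<integral>t. t ^ k * (1 - t) ^ l * h t \<partial>M \<xi>)))" for k l
    proof (intro exI[of _ "B k l"] conjI ballI, safe)
      fix h W assume "(h, W) \<in> R2"
      then obtain S where h: "h = indicator S" "W = E S" and S: "S \<in> sets borel" by (auto simp: R2_def)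
      have comm: "B k l o\<^sub>L W = E S o\<^sub>L B k l"
        unfolding h
        by (rule symm_op_comp_commute[symmetric]) (rule E_symm[OF S] pos_op_symm[OF B_pos] E_symm'[OF S])+
      show "symm_op (B k l o\<^sub>L W)" using E_symm'[OF S] by (simp add: comm)
      show "B k l (W \<xi>) \<bullet> \<xi> = (\<integral>t. t ^ k * (1 - t) ^ l * h t \<partial>M \<xi>)" for \<xi>
        using comm E_int[OF S, of k l \<xi>] by (metis (no_types, lifting) Bochner_Integration.integral_cong blinfun_apply_blinfun_compose h(1) mult.commute)
    qed (rule pos_op_symm[OF B_pos])
  next
    fix T' assume T': "symm_op T'" "\<And>h W. (h, W) \<in> R2 \<Longrightarrow> symm_op (T' o\<^sub>L W)"
      "\<And>h W \<xi>. (h, W) \<in> R2 \<Longrightarrow> T' (W \<xi>) \<bullet> \<xi> = (\<integral>t. indicator T t * h t \<partial>M \<xi>)"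
    have R2: "(indicator S, E S) \<in> R2" if "S \<in> sets borel" for S using that by (auto simp: R2_def)
    have eq: "T' (E S \<xi>) \<bullet> \<xi> = measure (M \<xi>) (T \<inter> S)" if "S \<in> sets borel" for S \<xi>
      using T'(3)[OF R2[OF that], of \<xi>] by (simp add: space flip: indicator_inter_arith)
    have "T' = E T"
      by (rule symm_op_eqI) (use T' T E_symm E_meas eq[of UNIV] in \<open>simp_all add: E_UNIV\<close>)
    then show ?thesis
      using T'(2)[OF R2[OF S]] eq[OF S] S T by (intro symm_op_eqI) (auto simp: E_symm E_meas)
  qed
  have "pvm E"
  proof
    fix F :: "nat \<Rightarrow> real set" and \<xi>
    assume F: "range F \<subseteq> sets borel" "disjoint_family F"
    interpret finite_measure "M \<xi>" by (rule fin)
    have Fs: "F i \<in> sets (M \<xi>)" for i using F by (auto simp: sets)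
    have idem: "E S (E S \<eta>) = E S \<eta>" if "S \<in> sets borel" for S \<eta>
      using E_Int[OF that that] by (metis Int_absorb blinfun_apply_blinfun_compose)
    have norm: "(norm (E S \<eta>))\<^sup>2 = measure (M \<eta>) S" if "S \<in> sets borel" for S \<eta>
      using symm_opD[OF E_symm[OF that], of "E S \<eta>" \<eta>] E_meas[OF that] by (simp add: idem that power2_norm_eq_inner)
    \<comment> \<open>The partial sums miss the union by a projection again, so the squared norm of
      the error is the measure of sets that decrease to the empty set.\<close>
    have "E (\<Union>i. F i) - (\<Sum>i<n. E (F i)) = E ((\<Union>i. F i) - (\<Union>i<n. F i))" for n
    proof (rule symm_op_eqI)
      fix \<eta>
      interpret finite_measure "M \<eta>" by (rule fin)
      have Fs: "F i \<in> sets (M \<eta>)" for i using F by (auto simp: sets)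
      have "measure (M \<eta>) (\<Union>i<n. F i) = (\<Sum>i<n. measure (M \<eta>) (F i))"
        by (rule finite_measure_finite_Union) (use F Fs in \<open>auto simp: disjoint_family_on_def\<close>)
      moreover have "measure (M \<eta>) ((\<Union>i. F i) - (\<Union>i<n. F i)) = measure (M \<eta>) (\<Union>i. F i) - measure (M \<eta>) (\<Union>i<n. F i)"
        by (rule finite_measure_Diff) (use Fs in auto)
      ultimately show "(E (\<Union>i. F i) - (\<Sum>i<n. E (F i))) \<eta> \<bullet> \<eta> = E ((\<Union>i. F i) - (\<Union>i<n. F i)) \<eta> \<bullet> \<eta>"
        using F Fs by (simp add: E_meas sets blinfun.diff_left blinfun.sum_left inner_diff_left inner_sum_left)
    qed (use F Fs in \<open>auto simp: sets intro!: symm_op_diff symm_op_sum E_symm\<close>)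
    then have eq: "(E (\<Union>i. F i) - (\<Sum>i<n. E (F i))) \<xi> = E ((\<Union>i. F i) - (\<Union>i<n. F i)) \<xi>" for n
      by simp
    have D: "(\<Union>i. F i) - (\<Union>i<n. F i) \<in> sets borel" for n
      using Fs by (auto simp: sets)
    have "norm ((\<Sum>i<n. E (F i) \<xi>) - E (\<Union>i. F i) \<xi>) = sqrt (measure (M \<xi>) ((\<Union>i. F i) - (\<Union>i<n. F i)))" for n
    proof -
      have "(norm ((\<Sum>i<n. E (F i) \<xi>) - E (\<Union>i. F i) \<xi>))\<^sup>2 = measure (M \<xi>) ((\<Union>i. F i) - (\<Union>i<n. F i))"
        using norm[OF D, of n \<xi>] eq[of n] by (simp add: blinfun.diff_left blinfun.sum_left norm_minus_commute)
      then show ?thesis by (metis norm_ge_zero real_sqrt_unique)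
    qed
    moreover have "(\<lambda>n. measure (M \<xi>) ((\<Union>i. F i) - (\<Union>i<n. F i))) \<longlonglongrightarrow> 0"
    proof -
      have "(\<lambda>n. measure (M \<xi>) ((\<Union>i. F i) - (\<Union>i<n. F i))) \<longlonglongrightarrow> measure (M \<xi>) (\<Inter>n. (\<Union>i. F i) - (\<Union>i<n. F i))"
        by (rule finite_Lim_measure_decseq) (use Fs in \<open>auto simp: decseq_def\<close>)
      moreover have "(\<Inter>n. (\<Union>i. F i) - (\<Union>i<n. F i)) = {}" by auto
      ultimately show ?thesis by (metis measure_empty)
    qed
    ultimately have "(\<lambda>n. norm ((\<Sum>i<n. E (F i) \<xi>) - E (\<Union>i. F i) \<xi>)) \<longlonglongrightarrow> 0"
      using tendsto_real_sqrt[of _ 0] by fastforce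
    then show "(\<lambda>k. E (F k) \<xi>) sums E (\<Union>k. F k) \<xi>"
      unfolding sums_def by (metis LIM_zero_cancel tendsto_norm_zero_iff)
  qed (simp_all add: E_symm E_UNIV E_Int)
  moreover have "pvm_measure E \<xi> = M \<xi>" for \<xi>
  proof (rule measure_eqI)
    interpret pvm E by fact
    interpret finite_measure "M \<xi>" by (rule fin)
    show "sets (pvm_measure E \<xi>) = sets (M \<xi>)" by (simp add: sets)
    show "emeasure (pvm_measure E \<xi>) S = emeasure (M \<xi>) S" if "S \<in> sets (pvm_measure E \<xi>)" for S
      using that by (simp add: emeasure_measure E_meas emeasure_eq_measure)
  qed
  moreover have "E {0..1} = id_blinfun"
  proof (rule symm_op_eqI)
    fix \<xi>
    interpret finite_measure "M \<xi>" by (rule fin)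
    have "measure (M \<xi>) {0..1} = measure (M \<xi>) UNIV"
      by (rule finite_measure_eq_AE) (use AE in \<open>auto simp: sets\<close>)
    then show "E {0..1} \<xi> \<bullet> \<xi> = id_blinfun \<xi> \<bullet> \<xi>" by (simp add: E_meas mass power2_norm_eq_inner)
  qed (simp_all add: E_symm)
  ultimately show ?thesis
    using that[of E] mom[of _ 1 0] by (simp add: B_def)
qed

section \<open>Spectral integrals\<close>

text \<open>The way from operator inequalities to spectral projections:
  \<open>E S \<eta> = \<eta>\<close> concentrates the measure of \<open>\<eta>\<close> on
  \<open>S\<close>, where a positive function has positive integral unless the total mass
  \<open>(norm \<eta>)\<^sup>2\<close> is zero.\<close>

lemma (in pvm) eq_0_of_integral_le_0:
  fixes f :: "'a \<Rightarrow> real"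
  assumes S: "S \<in> sets borel" and \<eta>: "E S \<eta> = \<eta>" and f: "integrable (pvm_measure E \<eta>) f"
    and pos: "\<And>t. t \<in> S \<Longrightarrow> 0 < f t" and le: "(\<integral>t. f t \<partial>pvm_measure E \<eta>) \<le> 0"
  shows "\<eta> = 0"
proof -
  interpret finite_measure "pvm_measure E \<eta>" by (rule finite_measure)
  have "emeasure (pvm_measure E \<eta>) (- S) = 0"
    using S \<eta> by (simp add: emeasure_measure Compl blinfun.diff_left)
  then have AE: "AE t in pvm_measure E \<eta>. t \<in> S"
    by (intro AE_I[of _ _ "- S"]) (use S in auto)
  then have nn: "AE t in pvm_measure E \<eta>. 0 \<le> f t"
    by (rule eventually_mono) (rule less_imp_le[OF pos])
  have "(\<integral>t. f t \<partial>pvm_measure E \<eta>) = 0"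
    using integral_nonneg_AE[OF nn] le by simp
  then have "AE t in pvm_measure E \<eta>. f t = 0"
    using integral_nonneg_eq_0_iff_AE[OF f nn] by simp
  with AE have "AE t in pvm_measure E \<eta>. False"
    by eventually_elim (use pos in fastforce)
  then have "measure (pvm_measure E \<eta>) UNIV = 0"
    by (simp add: eventually_False ae_filter_eq_bot_iff measure_def)
  then show ?thesis by (simp add: measure_UNIV)
qed

text \<open>Only the values on the support \<open>K\<close> of \<open>E\<close> matter for the spectral integral.\<close>

locale bpvm = pvm E
  for E :: "'a::euclidean_space set \<Rightarrow> 'h::{real_inner,banach} \<Rightarrow>\<^sub>L 'h" +
  fixes K :: "'a set"
  assumes K_borel [measurable]: "K \<in> sets borel" and E_K: "E K = id_blinfun"
begin

text \<open>Only the cut-off product has to be measurable, because the functions to be integrated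
  are continuous on \<open>K\<close> and arbitrary elsewhere.\<close>

definition good :: "('a \<Rightarrow> real) \<Rightarrow> bool" where
  "good g \<longleftrightarrow> (\<lambda>t. indicat_real K t * g t) \<in> borel_measurable borel \<and> (\<exists>C. \<forall>t\<in>K. \<bar>g t\<bar> \<le> C)"

definition quad :: "('a \<Rightarrow> real) \<Rightarrow> 'h \<Rightarrow> real" where
  "quad g \<xi> = (\<integral>t. indicat_real K t * g t \<partial>pvm_measure E \<xi>)"

text \<open>The bounded Borel calculus for real functions. Uniqueness is \<open>symm_op_eqI\<close>;
  existence for \<open>good\<close> functions is \<open>J_exists\<close>.\<close>

definition J :: "('a \<Rightarrow> real) \<Rightarrow> 'h \<Rightarrow>\<^sub>L 'h" where
  "J g = (THE T. symm_op T \<and> (\<forall>\<xi>. T \<xi> \<bullet> \<xi> = quad g \<xi>))"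

lemma quad_cong: "(\<And>t. t \<in> K \<Longrightarrow> f t = g t) \<Longrightarrow> quad f \<xi> = quad g \<xi>"
  unfolding quad_def by (rule Bochner_Integration.integral_cong) (auto simp: indicator_def)

lemma J_cong: "(\<And>t. t \<in> K \<Longrightarrow> f t = g t) \<Longrightarrow> J f = J g"
  unfolding J_def by (simp cong: quad_cong)

lemma goodI: "g \<in> borel_measurable borel \<Longrightarrow> (\<And>t. t \<in> K \<Longrightarrow> \<bar>g t\<bar> \<le> C) \<Longrightarrow> good g"
  unfolding good_def by auto

lemma good_const: "good (\<lambda>_. c)"
  by (rule goodI[where C = "\<bar>c\<bar>"]) auto

lemma good_indicator: "S \<in> sets borel \<Longrightarrow> good (indicator S)"
  by (rule goodI[where C = 1]) auto

lemma good_add: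
  assumes "good f" "good g"
  shows "good (\<lambda>t. f t + g t)"
proof -
  obtain C D where CD: "\<And>t. t \<in> K \<Longrightarrow> \<bar>f t\<bar> \<le> C" "\<And>t. t \<in> K \<Longrightarrow> \<bar>g t\<bar> \<le> D"
    using assms unfolding good_def by blast
  have "\<forall>t\<in>K. \<bar>f t + g t\<bar> \<le> C + D"
    using CD by (meson abs_triangle_ineq add_mono order_trans)
  then show ?thesis
    using assms unfolding good_def by (auto simp: distrib_left)
qed

lemma good_mult:
  assumes "good f" "good g"
  shows "good (\<lambda>t. f t * g t)"
proof -
  obtain C D where CD: "\<And>t. t \<in> K \<Longrightarrow> \<bar>f t\<bar> \<le> C" "\<And>t. t \<in> K \<Longrightarrow> \<bar>g t\<bar> \<le> D"
    using assms unfolding good_def by blast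
  have "\<forall>t\<in>K. \<bar>f t * g t\<bar> \<le> C * D"
    using CD by (auto simp: abs_mult intro!: mult_mono order_trans[OF abs_ge_zero])
  moreover have "(\<lambda>t. indicat_real K t * (f t * g t)) = (\<lambda>t. (indicat_real K t * f t) * (indicat_real K t * g t))"
    by (auto simp: indicator_def)
  ultimately show ?thesis
    using assms unfolding good_def by auto
qed

lemma good_scale: "good f \<Longrightarrow> good (\<lambda>t. c * f t)"
  by (rule good_mult[OF good_const])

lemma good_diff: "good f \<Longrightarrow> good g \<Longrightarrow> good (\<lambda>t. f t - g t)"
  using good_add[OF _ good_scale[of g "-1"], of f] by simp

lemma good_sum: "(\<And>i. i \<in> A \<Longrightarrow> good (f i)) \<Longrightarrow> good (\<lambda>t. \<Sum>i\<in>A. f i t)"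
  by (induction A rule: infinite_finite_induct) (auto intro: good_add good_const)

lemma good_continuous:
  assumes "compact K" "continuous_on K g"
  shows "good g"
proof -
  obtain C where "\<forall>t\<in>K. \<bar>g t\<bar> \<le> C"
    using compact_imp_bounded[OF compact_continuous_image[OF assms(2,1)]] by (force simp: bounded_iff)
  moreover have "(\<lambda>t. indicat_real K t * g t) \<in> borel_measurable borel"
    using borel_measurable_continuous_on_indicator[OF _ assms(2)] by simp
  ultimately show ?thesis unfolding good_def by blast
qed

lemma good_measurable: "good g \<Longrightarrow> (\<lambda>t. indicat_real K t * g t) \<in> borel_measurable (pvm_measure E \<xi>)"
  unfolding good_def by (subst measurable_cong_sets[OF sets_measure refl]) simp

lemma integrable_good: "good g \<Longrightarrow> integrable (pvm_measure E \<xi>) (\<lambda>t. indicat_real K t * g t)"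
proof -
  assume g: "good g"
  then obtain C where C: "\<And>t. t \<in> K \<Longrightarrow> \<bar>g t\<bar> \<le> C" unfolding good_def by blast
  interpret finite_measure "pvm_measure E \<xi>" by (rule finite_measure)
  show ?thesis
  proof (rule integrable_const_bound[of _ "\<bar>C\<bar>"])
    show "AE t in pvm_measure E \<xi>. norm (indicat_real K t * g t) \<le> \<bar>C\<bar>"
      by (rule AE_I2) (use C in \<open>force simp: indicator_def\<close>)
  qed (rule good_measurable[OF g])
qed

lemma quad_add: "good f \<Longrightarrow> good g \<Longrightarrow> quad (\<lambda>t. f t + g t) \<xi> = quad f \<xi> + quad g \<xi>"
  unfolding quad_def by (simp add: distrib_left integrable_good)

lemma quad_scale: "quad (\<lambda>t. c * f t) \<xi> = c * quad f \<xi>"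
  unfolding quad_def by (simp add: mult.left_commute[of _ c])

lemma quad_indicator: "S \<in> sets borel \<Longrightarrow> quad (indicator S) \<xi> = E S \<xi> \<bullet> \<xi>"
  using Int[of K S] by (simp add: quad_def E_K measure_measure flip: indicator_inter_arith)

lemma quad_mono:
  assumes "good f" "good g" "\<And>t. t \<in> K \<Longrightarrow> f t \<le> g t"
  shows "quad f \<xi> \<le> quad g \<xi>"
  unfolding quad_def by (intro integral_mono integrable_good assms) (use assms(3) in \<open>auto simp: indicator_def\<close>)

lemma quad_const: "quad (\<lambda>_. c) \<xi> = c * (norm \<xi>)\<^sup>2"
  using quad_scale[of c "indicator UNIV" \<xi>] quad_indicator[of UNIV \<xi>]
  by (simp add: UNIV power2_norm_eq_inner)

lemma quad_tendsto:
  assumes F: "\<And>n. good (F n)" and f: "good f" and C: "\<And>n t. t \<in> K \<Longrightarrow> \<bar>F n t\<bar> \<le> C"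
    and lim: "\<And>t. t \<in> K \<Longrightarrow> (\<lambda>n. F n t) \<longlonglongrightarrow> f t"
  shows "(\<lambda>n. quad (F n) \<xi>) \<longlonglongrightarrow> quad f \<xi>"
  unfolding quad_def
proof (rule integral_dominated_convergence[where w = "\<lambda>_. \<bar>C\<bar>"])
  interpret finite_measure "pvm_measure E \<xi>" by (rule finite_measure)
  show "integrable (pvm_measure E \<xi>) (\<lambda>_. \<bar>C\<bar>)" by simp
  show "AE t in pvm_measure E \<xi>. (\<lambda>n. indicat_real K t * F n t) \<longlonglongrightarrow> indicat_real K t * f t"
    by (rule AE_I2) (use lim in \<open>auto simp: indicator_def\<close>)
  show "AE t in pvm_measure E \<xi>. norm (indicat_real K t * F n t) \<le> \<bar>C\<bar>" for n
    by (rule AE_I2) (use C[of _ n] in \<open>fastforce simp: indicator_def\<close>)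
qed (use F f good_measurable in auto)

text \<open>Limits are increasing and bounded, so that Vigier's theorem and dominated convergence
  are both at hand in each use. Negative parts enter through \<open>scale\<close> with the factor
  \<open>-1\<close>.\<close>

lemma good_induct [consumes 1, case_names cong indicator add scale lim]:
  assumes "good g"
    and cong: "\<And>f g. (\<And>t. t \<in> K \<Longrightarrow> f t = g t) \<Longrightarrow> Q f \<Longrightarrow> Q g"
    and indicator: "\<And>S. S \<in> sets borel \<Longrightarrow> Q (indicator S)"
    and add: "\<And>f g. good f \<Longrightarrow> good g \<Longrightarrow> Q f \<Longrightarrow> Q g \<Longrightarrow> Q (\<lambda>t. f t + g t)"
    and scale: "\<And>c f. good f \<Longrightarrow> Q f \<Longrightarrow> Q (\<lambda>t. c * f t)"
    and lim: "\<And>F f C. (\<And>n. good (F n)) \<Longrightarrow> good f \<Longrightarrow> (\<And>n. Q (F n)) \<Longrightarrow>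
        (\<And>m n t. t \<in> K \<Longrightarrow> m \<le> n \<Longrightarrow> F m t \<le> F n t) \<Longrightarrow> (\<And>n t. t \<in> K \<Longrightarrow> \<bar>F n t\<bar> \<le> C) \<Longrightarrow>
        (\<And>t. t \<in> K \<Longrightarrow> (\<lambda>n. F n t) \<longlonglongrightarrow> f t) \<Longrightarrow> Q f"
  shows "Q g"
proof -
  have pos: "Q u" if u: "u \<in> borel_measurable borel" "\<And>t. 0 \<le> u t" "\<And>t. u t \<le> C" for u :: "'a \<Rightarrow> real" and C
  proof -
    have "(\<exists>C. \<forall>t. u t \<le> C) \<longrightarrow> Q u"
      using u(1,2)
    proof (induction rule: borel_measurable_induct_real)
      case (set A)
      then show ?case using indicator by simp
    next
      case (mult u c)
      show ?case
      proof
        assume "\<exists>C. \<forall>t. c * u t \<le> C"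
        then obtain C where C: "\<And>t. c * u t \<le> C" by blast
        show "Q (\<lambda>t. c * u t)"
        proof (cases "c = 0")
          case True
          then show ?thesis using scale[OF good_indicator indicator, of "{}" 0] by simp
        next
          case False
          then have b: "u t \<le> C / c" for t using C[of t] mult(1) by (simp add: field_simps)
          then have "good u" by (intro goodI[where C = "C / c"]) (use mult in auto)
          then show ?thesis using b mult.IH by (intro scale) blast+
        qed
      qed
    next
      case (add u v)
      show ?case
      proof
        assume "\<exists>C. \<forall>t. v t + u t \<le> C"
        then obtain C where C: "\<And>t. v t + u t \<le> C" by blast
        have b: "u t \<le> C" "v t \<le> C" for t
          using C[of t] add(2)[of t] add(4)[of t] by linarith+
        then have "good u" "good v" by (auto intro!: goodI[where C = C] simp: add abs_of_nonneg)
        then show "Q (\<lambda>t. v t + u t)" using b add.IH by (intro assms(4)) blast+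
      qed
    next
      case (seq U)
      show ?case
      proof
        assume "\<exists>C. \<forall>t. u t \<le> C"
        then obtain C where C: "\<And>t. u t \<le> C" by blast
        have b: "U i t \<le> u t" for i t
          using seq(3,4) by (intro incseq_le) (auto simp: incseq_def le_fun_def)
        have b': "U i t \<le> C" for i t using b C order_trans by blast
        have nn: "0 \<le> u t" for t using order_trans[OF seq(2) b] .
        show "Q u"
        proof (rule lim)
          show "good (U i)" for i by (intro goodI[where C = C]) (use seq b' in auto)
          show "good u"
          proof (rule goodI)
            show "u \<in> borel_measurable borel"
              by (rule borel_measurable_LIMSEQ_real[of _ U]) (use seq in auto)
            show "\<bar>u t\<bar> \<le> C" for t using nn[of t] C[of t] by simp
          qed
          show "Q (U i)" for i using seq.IH b' by blast
          show "U m t \<le> U n t" if "m \<le> n" for m n t using seq(3) that by (auto simp: incseq_def le_fun_def)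
          show "\<bar>U n t\<bar> \<le> C" for n t using seq(2)[of n t] b'[of n t] by simp
        qed (use seq in simp)
      qed
    qed
    then show ?thesis using u(3) by blast
  qed
  define h where "h t = indicat_real K t * g t" for t
  have hm [measurable]: "h \<in> borel_measurable borel" using assms(1) by (simp add: good_def h_def[abs_def])
  obtain C where C: "\<And>t. t \<in> K \<Longrightarrow> \<bar>g t\<bar> \<le> C" using assms(1) unfolding good_def by blast
  have hC: "\<bar>h t\<bar> \<le> \<bar>C\<bar>" for t using C[of t] by (auto simp: h_def indicator_def)
  have Q1: "Q (\<lambda>t. max (h t) 0)" "Q (\<lambda>t. max (- h t) 0)"
    by (rule pos[where C = "\<bar>C\<bar>"]; use hC in \<open>auto simp: abs_le_iff\<close>)+
  have g1: "good (\<lambda>t. max (h t) 0)" "good (\<lambda>t. max (- h t) 0)"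
    by (rule goodI[where C = "\<bar>C\<bar>"]; use hC in \<open>auto simp: abs_le_iff\<close>)+
  have "Q (\<lambda>t. max (h t) 0 + (-1) * max (- h t) 0)"
    by (intro add scale good_scale Q1 g1)
  then show ?thesis by (rule cong[rotated]) (auto simp: h_def)
qed

lemma J_exists: "good g \<Longrightarrow> \<exists>T. symm_op T \<and> (\<forall>\<xi>. T \<xi> \<bullet> \<xi> = quad g \<xi>)"
proof (induction rule: good_induct)
  case (cong f g)
  then show ?case using quad_cong[OF cong(1)] by simp
next
  case (indicator S)
  then show ?case using quad_indicator symm by metis
next
  case (add f g)
  then obtain T U where "symm_op T" "\<forall>\<xi>. T \<xi> \<bullet> \<xi> = quad f \<xi>" "symm_op U" "\<forall>\<xi>. U \<xi> \<bullet> \<xi> = quad g \<xi>" by blast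
  then show ?case
    using add(1,2) by (intro exI[of _ "T + U"]) (simp add: symm_op_add quad_add blinfun.add_left inner_add_left)
next
  case (scale c f)
  then obtain T where "symm_op T" "\<forall>\<xi>. T \<xi> \<bullet> \<xi> = quad f \<xi>" by blast
  then show ?case
    by (intro exI[of _ "c *\<^sub>R T"]) (simp add: symm_op_scaleR quad_scale blinfun.scaleR_left)
next
  case (lim F f C)
  then obtain T where T: "\<And>n. symm_op (T n)" "\<And>n \<xi>. T n \<xi> \<bullet> \<xi> = quad (F n) \<xi>" by metis
  obtain U where U: "symm_op U" "\<And>\<xi>. (\<lambda>n. T n \<xi>) \<longlonglongrightarrow> U \<xi>"
  proof (rule incseq_op_convergent[OF T(1)])
    show "T m \<xi> \<bullet> \<xi> \<le> T n \<xi> \<bullet> \<xi>" if "m \<le> n" for m n \<xi>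
      unfolding T by (rule quad_mono) (use lim that in auto)
    show "T n \<xi> \<bullet> \<xi> \<le> C * (norm \<xi>)\<^sup>2" for n \<xi>
      unfolding T quad_const[symmetric] by (rule quad_mono) (use lim good_const in \<open>auto simp: abs_le_iff\<close>)
  qed (rule that)
  have "U \<xi> \<bullet> \<xi> = quad f \<xi>" for \<xi>
    using quad_tendsto[OF lim(1,2,4,5), of \<xi>] tendsto_inner[OF U(2)[of \<xi>] tendsto_const, of \<xi>]
    by (simp add: T LIMSEQ_unique)
  with U show ?case by blast
qed

lemma J_eqI: "symm_op T \<Longrightarrow> (\<And>\<xi>. T \<xi> \<bullet> \<xi> = quad g \<xi>) \<Longrightarrow> J g = T"
  unfolding J_def by (rule the_equality) (auto intro: symm_op_eqI)

lemma
  assumes "good g"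
  shows J_symm: "symm_op (J g)" and J_quad: "J g \<xi> \<bullet> \<xi> = quad g \<xi>"
  using J_exists[OF assms] J_eqI by metis+

lemma J_add: "good f \<Longrightarrow> good g \<Longrightarrow> J (\<lambda>t. f t + g t) = J f + J g"
  by (rule J_eqI) (simp_all add: symm_op_add J_symm J_quad quad_add blinfun.add_left inner_add_left)

lemma J_scale: "good f \<Longrightarrow> J (\<lambda>t. c * f t) = c *\<^sub>R J f"
  by (rule J_eqI) (simp_all add: symm_op_scaleR J_symm J_quad quad_scale blinfun.scaleR_left)

lemma J_diff: "good f \<Longrightarrow> good g \<Longrightarrow> J (\<lambda>t. f t - g t) = J f - J g"
  using J_add[of f "\<lambda>t. (-1) * g t"] J_scale[of g "-1"] good_scale[of g "-1"] by simp

lemma J_indicator: "S \<in> sets borel \<Longrightarrow> J (indicator S) = E S"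
  by (rule J_eqI) (simp_all add: symm quad_indicator)

lemma J_const: "J (\<lambda>_. c) = c *\<^sub>R id_blinfun"
  by (rule J_eqI) (simp_all add: symm_op_scaleR quad_const blinfun.scaleR_left power2_norm_eq_inner)

lemma J_sum: "(\<And>i. i \<in> A \<Longrightarrow> good (f i)) \<Longrightarrow> J (\<lambda>t. \<Sum>i\<in>A. f i t) = (\<Sum>i\<in>A. J (f i))"
  by (induction A rule: infinite_finite_induct) (simp_all add: J_const J_add good_sum)

lemma J_mono: "good f \<Longrightarrow> good g \<Longrightarrow> (\<And>t. t \<in> K \<Longrightarrow> f t \<le> g t) \<Longrightarrow> pos_op (J g - J f)"
  by (simp add: pos_op_def symm_op_diff J_symm J_quad quad_mono blinfun.diff_left inner_diff_left)

lemma J_pos: "good g \<Longrightarrow> (\<And>t. t \<in> K \<Longrightarrow> 0 \<le> g t) \<Longrightarrow> pos_op (J g)"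
  using J_mono[OF good_const[of 0], of g] by (simp add: J_const)

lemma J_strong_limit:
  assumes F: "\<And>n. good (F n)" and f: "good f" and mono: "\<And>m n t. t \<in> K \<Longrightarrow> m \<le> n \<Longrightarrow> F m t \<le> F n t"
    and C: "\<And>n t. t \<in> K \<Longrightarrow> \<bar>F n t\<bar> \<le> C" and lim: "\<And>t. t \<in> K \<Longrightarrow> (\<lambda>n. F n t) \<longlonglongrightarrow> f t"
  shows "(\<lambda>n. J (F n) \<xi>) \<longlonglongrightarrow> J f \<xi>"
proof -
  obtain U where U: "symm_op U" "\<And>\<xi>. (\<lambda>n. J (F n) \<xi>) \<longlonglongrightarrow> U \<xi>"
  proof (rule incseq_op_convergent[OF J_symm[OF F]])
    show "J (F m) \<xi> \<bullet> \<xi> \<le> J (F n) \<xi> \<bullet> \<xi>" if "m \<le> n" for m n \<xi>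
      unfolding J_quad[OF F] by (rule quad_mono) (use F mono that in auto)
    show "J (F n) \<xi> \<bullet> \<xi> \<le> C * (norm \<xi>)\<^sup>2" for n \<xi>
      unfolding J_quad[OF F] quad_const[symmetric]
      by (rule quad_mono) (use F C good_const in \<open>auto simp: abs_le_iff\<close>)
  qed (rule that)
  have "U \<xi> \<bullet> \<xi> = quad f \<xi>" for \<xi>
    using quad_tendsto[OF F f C lim, of \<xi>] tendsto_inner[OF U(2)[of \<xi>] tendsto_const, of \<xi>]
    by (simp add: J_quad[OF F] LIMSEQ_unique)
  then have "J f = U" using U(1) by (intro J_eqI)
  with U show ?thesis by simp
qed

text \<open>Multiplicativity spreads over the second factor once it is known for indicators there.
  \<open>J_mult\<close> runs this twice: with an indicator as \<open>u\<close>, then, after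
  exchanging the factors, with arbitrary \<open>u\<close>.\<close>

lemma J_mult_aux:
  assumes u: "good u" and ind: "\<And>S. S \<in> sets borel \<Longrightarrow> J u o\<^sub>L E S = J (\<lambda>t. u t * indicator S t)" and v: "good v"
  shows "J u o\<^sub>L J v = J (\<lambda>t. u t * v t)"
  using v
proof (induction rule: good_induct)
  case (cong f g)
  have "J f = J g" "J (\<lambda>t. u t * f t) = J (\<lambda>t. u t * g t)" using cong(1) by (auto intro!: J_cong)
  then show ?case using cong(2) by simp
next
  case (indicator S)
  then show ?case using ind by (simp add: J_indicator)
next
  case (add f g)
  then show ?case by (simp add: J_add distrib_left blinfun_compose_simps good_mult u)
next
  case (scale c f)
  then show ?case by (simp add: J_scale mult.left_commute[of _ c] blinfun_compose_simps good_mult u)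
next
  case (lim F f C)
  have lim': "(\<lambda>n. J u (J (F n) \<xi>)) \<longlonglongrightarrow> J u (J f \<xi>)" for \<xi>
    by (intro blinfun.tendsto tendsto_const J_strong_limit[of F f C]) (use lim in auto)
  obtain D where D: "\<And>t. t \<in> K \<Longrightarrow> \<bar>u t\<bar> \<le> D" using u unfolding good_def by blast
  have q: "(\<lambda>n. quad (\<lambda>t. u t * F n t) \<xi>) \<longlonglongrightarrow> quad (\<lambda>t. u t * f t) \<xi>" for \<xi>
    by (rule quad_tendsto[where C = "D * C"])
      (use lim u D in \<open>auto intro!: good_mult tendsto_intros mult_mono order_trans[OF abs_ge_zero] simp: abs_mult\<close>)
  have eq: "J u (J (F n) \<xi>) = J (\<lambda>t. u t * F n t) \<xi>" for n \<xi>
    using lim(6)[of n] by (metis blinfun_apply_blinfun_compose)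
  have sy: "J u (J (F n) \<xi>) \<bullet> \<eta> = \<xi> \<bullet> J u (J (F n) \<eta>)" for n \<xi> \<eta>
    unfolding eq by (rule symm_opD) (use lim u in \<open>auto intro: J_symm good_mult\<close>)
  show ?case
  proof (rule J_eqI[symmetric])
    have "J u (J f \<xi>) \<bullet> \<eta> = \<xi> \<bullet> J u (J f \<eta>)" for \<xi> \<eta>
      using tendsto_inner[OF lim'[of \<xi>] tendsto_const, of \<eta>] tendsto_inner[OF tendsto_const lim'[of \<eta>], of \<xi>]
      by (simp add: sy LIMSEQ_unique)
    then show "symm_op (J u o\<^sub>L J f)" by (simp add: symm_op_def)
    show "(J u o\<^sub>L J f) \<xi> \<bullet> \<xi> = quad (\<lambda>t. u t * f t) \<xi>" for \<xi>
      using tendsto_inner[OF lim'[of \<xi>] tendsto_const, of \<xi>] q[of \<xi>] lim(1) u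
      by (simp add: eq J_quad good_mult LIMSEQ_unique)
  qed
qed

lemma J_mult:
  assumes "good u" "good v"
  shows "J (\<lambda>t. u t * v t) = J u o\<^sub>L J v"
proof -
  have EE: "J (indicator S) o\<^sub>L E T = J (\<lambda>t. indicator S t * indicator T t)"
    if "S \<in> sets borel" "T \<in> sets borel" for S T
    using that J_indicator[of "S \<inter> T"] by (simp add: J_indicator Int indicator_inter_arith[abs_def])
  have "J u o\<^sub>L E S = J (\<lambda>t. u t * indicator S t)" if S: "S \<in> sets borel" for S
  proof -
    have eq: "J (indicator S) o\<^sub>L J u = J (\<lambda>t. indicator S t * u t)"
      by (rule J_mult_aux) (use S EE assms good_indicator in auto)
    \<comment> \<open>The product is \<open>J\<close> of a function and therefore symmetric, which
      forces its two factors to commute.\<close>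
    have "E S o\<^sub>L J u = J u o\<^sub>L E S"
      by (rule symm_op_comp_commute)
        (use S assms eq in \<open>auto simp: symm J_symm J_indicator good_mult good_indicator\<close>)
    then show ?thesis using eq S by (simp add: J_indicator mult.commute)
  qed
  then show ?thesis using J_mult_aux[OF assms(1) _ assms(2)] by simp
qed

lemma J_commute: "good u \<Longrightarrow> good v \<Longrightarrow> J u o\<^sub>L J v = J v o\<^sub>L J u"
  using J_mult[of u v] J_mult[of v u] by (simp add: mult.commute)

text \<open>The squared norm of \<open>J g \<xi>\<close> is the quadratic form of
  \<open>g * g\<close> at \<open>\<xi>\<close>.\<close>

lemma J_norm_le:
  assumes "good g" "\<And>t. t \<in> K \<Longrightarrow> \<bar>g t\<bar> \<le> C" "0 \<le> C"
  shows "norm (J g) \<le> C"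
proof (rule norm_blinfun_bound[OF assms(3)])
  fix \<xi>
  have "(norm (J g \<xi>))\<^sup>2 = J g (J g \<xi>) \<bullet> \<xi>"
    using symm_opD[OF J_symm[OF assms(1)], of "J g \<xi>" \<xi>] by (simp add: power2_norm_eq_inner)
  also have "\<dots> = quad (\<lambda>t. g t * g t) \<xi>"
    using J_mult[OF assms(1,1)] J_quad[OF good_mult[OF assms(1,1)]] by simp
  also have "\<dots> \<le> quad (\<lambda>t. C\<^sup>2) \<xi>"
  proof (rule quad_mono)
    show "g t * g t \<le> C\<^sup>2" if "t \<in> K" for t
      using assms(2)[OF that] assms(3) abs_le_square_iff[of "g t" C] by (simp add: power2_eq_square)
  qed (rule good_mult assms good_const)+
  also have "\<dots> = (C * norm \<xi>)\<^sup>2" by (simp add: quad_const power_mult_distrib)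
  finally show "norm (J g \<xi>) \<le> C * norm \<xi>" by (rule power2_le_imp_le) (use assms in simp)
qed

lemma J_commutes_with:
  assumes "\<And>B. B \<in> sets borel \<Longrightarrow> S o\<^sub>L E B = E B o\<^sub>L S" "good g"
  shows "S o\<^sub>L J g = J g o\<^sub>L S"
  using assms(2)
proof (induction rule: good_induct)
  case (cong f g)
  have "J f = J g" using cong(1) by (rule J_cong)
  then show ?case using cong(2) by simp
next
  case (lim F f C)
  have L: "(\<lambda>n. J (F n) \<xi>) \<longlonglongrightarrow> J f \<xi>" for \<xi> by (rule J_strong_limit[of F f C]) (use lim in auto)
  have eq: "S (J (F n) \<xi>) = J (F n) (S \<xi>)" for n \<xi>
    using lim(6)[of n] by (metis blinfun_apply_blinfun_compose)
  show ?case
  proof (rule blinfun_eqI)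
    show "(S o\<^sub>L J f) \<xi> = (J f o\<^sub>L S) \<xi>" for \<xi>
      using blinfun.tendsto[OF tendsto_const L[of \<xi>], of S] L[of "S \<xi>"] by (simp add: eq LIMSEQ_unique)
  qed
qed (simp_all add: assms(1) J_indicator J_add J_scale blinfun_compose_simps)

end

text \<open>Rescaling to the unit interval; the spectral measure is transported back by
  \<open>\<phi>\<close>. The summand \<open>1\<close> in \<open>r\<close> keeps the interval
  nondegenerate when \<open>x = 0\<close>.\<close>

theorem spectral_theorem:
  fixes x :: "'h::{real_inner,banach} \<Rightarrow>\<^sub>L 'h"
  assumes x: "symm_op x"
  obtains E r where "bpvm E {-r..r}" "bpvm.J E {-r..r} (\<lambda>t. t) = x"
proof -
  define r where "r = norm x + 1"
  define c where "c = 1 / (2 * r)"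
  have r: "0 < r" by (simp add: r_def add_nonneg_pos)
  define x' where "x' = c *\<^sub>R (x + r *\<^sub>R id_blinfun)"
  have "pos_op (r *\<^sub>R id_blinfun - (- x))" "pos_op (r *\<^sub>R id_blinfun - x)"
    by (rule pos_op_norm_minus; use x in \<open>simp add: symm_op_uminus r_def\<close>)+
  then have p: "pos_op (x + r *\<^sub>R id_blinfun)" "pos_op (c *\<^sub>R (r *\<^sub>R id_blinfun - x))"
    using r by (auto simp: add.commute c_def intro: pos_op_scaleR)
  have "id_blinfun - x' = c *\<^sub>R (r *\<^sub>R id_blinfun - x)"
  proof (rule blinfun_eqI)
    fix \<xi> :: 'h
    have "(c * r + c * r) *\<^sub>R \<xi> = \<xi>"
      using r by (simp add: c_def)
    then have "\<xi> = (c * r) *\<^sub>R \<xi> + (c * r) *\<^sub>R \<xi>"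
      by (simp only: scaleR_add_left)
    then show "(id_blinfun - x') \<xi> = (c *\<^sub>R (r *\<^sub>R id_blinfun - x)) \<xi>"
      by (simp add: x'_def blinfun.bilinear_simps scaleR_add_right scaleR_diff_right)
        (metis add_diff_cancel_right')
  qed
  then have "pos_op x'" "pos_op (id_blinfun - x')"
    using p r by (auto simp: x'_def c_def intro: pos_op_scaleR)
  then obtain F where F: "pvm F" "F {0..1} = id_blinfun" "\<And>\<xi>. (\<integral>t. t \<partial>pvm_measure F \<xi>) = x' \<xi> \<bullet> \<xi>"
    by (rule spectral_theorem_unit) (rule that)
  interpret F: pvm F by (rule F)
  define \<phi> where "\<phi> t = 2 * r * t - r" for t :: real
  have \<phi> [measurable]: "\<phi> \<in> borel_measurable borel" by (simp add: \<phi>_def[abs_def])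
  have v: "\<phi> -` {-r..r} = {0..1}" using r by (auto simp: \<phi>_def zero_le_mult_iff)
  interpret E: bpvm "\<lambda>S. F (\<phi> -` S)" "{-r..r}"
    unfolding bpvm_def bpvm_axioms_def using F(2) v by (auto intro: pvm_vimage F(1))
  have "E.J (\<lambda>t. t) = x"
  proof (rule E.J_eqI[OF x])
    fix \<xi>
    interpret finite_measure "pvm_measure F \<xi>" by (rule F.finite_measure)
    have AE: "AE t in pvm_measure F \<xi>. t \<in> {0..1}" by (rule F.AE_measure) (use F in auto)
    have int: "integrable (pvm_measure F \<xi>) (\<lambda>t. t)"
      by (rule integrable_const_bound[of _ 1], rule eventually_mono[OF AE]) auto
    have "E.quad (\<lambda>t. t) \<xi> = (\<integral>t. indicat_real {-r..r} (\<phi> t) * \<phi> t \<partial>pvm_measure F \<xi>)"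
      unfolding E.quad_def by (simp add: pvm_measure_vimage[OF F(1) \<phi>] integral_distr)
    also have "\<dots> = (\<integral>t. 2 * r * t - r \<partial>pvm_measure F \<xi>)"
      by (rule integral_cong_AE, measurable, rule eventually_mono[OF AE])
        (use v in \<open>auto simp: indicator_def \<phi>_def set_eq_iff\<close>)
    also have "\<dots> = 2 * r * (x' \<xi> \<bullet> \<xi>) - r * (norm \<xi>)\<^sup>2"
      using int F.measure_UNIV[of \<xi>] by (simp add: F(3))
    also have "\<dots> = x \<xi> \<bullet> \<xi>"
      using r by (simp add: x'_def c_def blinfun.bilinear_simps inner_add_left power2_norm_eq_inner field_simps)
    finally show "x \<xi> \<bullet> \<xi> = E.quad (\<lambda>t. t) \<xi>" ..
  qed
  then show ?thesis using that E.bpvm_axioms by blast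
qed

text \<open>Stone-Weierstrass. Without a unit, \<open>\<T>\<close> is only known to contain the
  operators of \<open>p - p 0\<close> for polynomials \<open>p\<close>; this suffices, since the
  constants \<open>p n 0\<close> tend to \<open>g 0 = 0\<close>, which is where
  \<open>0 \<in> K\<close> enters. A closed set stable under real operations can be a C*-algebra as
  well as a commutant.\<close>

lemma (in bpvm) J_continuous_mem:
  assumes K: "compact K" and g: "continuous_on K g" and \<T>: "closed \<T>"
    and add: "\<And>a b. a \<in> \<T> \<Longrightarrow> b \<in> \<T> \<Longrightarrow> a + b \<in> \<T>"
    and scale: "\<And>r a. a \<in> \<T> \<Longrightarrow> r *\<^sub>R a \<in> \<T>"
    and comp: "\<And>a b. a \<in> \<T> \<Longrightarrow> b \<in> \<T> \<Longrightarrow> a o\<^sub>L b \<in> \<T>"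
    and coord: "\<And>b. b \<in> Basis \<Longrightarrow> J (\<lambda>t. t \<bullet> b) \<in> \<T>"
    and unit: "id_blinfun \<in> \<T> \<or> 0 \<in> K \<and> g 0 = 0"
  shows "J g \<in> \<T>"
proof -
  have cont: "good h" if "continuous_on UNIV h" for h
    using good_continuous[OF K continuous_on_subset[OF that]] by simp
  obtain b0 :: 'a where b0: "b0 \<in> Basis" using nonempty_Basis by blast
  have zero: "0 \<in> \<T>" using scale[OF coord[OF b0], of 0] by simp
  have sum: "(\<Sum>i\<in>A. T i) \<in> \<T>" if "\<And>i. i \<in> A \<Longrightarrow> T i \<in> \<T>" for A :: "'a set" and T
    using that by (induction A rule: infinite_finite_induct) (auto intro: add zero)
  have poly: "J p - p 0 *\<^sub>R id_blinfun \<in> \<T> \<and> good p" if "real_polynomial_function p" for p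
    using that
  proof induction
    case (linear f)
    then interpret f: bounded_linear f .
    have g1: "good (\<lambda>t. f b * (t \<bullet> b))" for b
      by (rule cont) (intro continuous_intros)
    have "J f = J (\<lambda>t. \<Sum>b\<in>Basis. f b * (t \<bullet> b))"
    proof (rule J_cong)
      fix t
      have "f t = f (\<Sum>b\<in>Basis. (t \<bullet> b) *\<^sub>R b)" by (simp add: euclidean_representation)
      then show "f t = (\<Sum>b\<in>Basis. f b * (t \<bullet> b))" by (simp add: f.sum f.scaleR mult.commute)
    qed
    also have "\<dots> = (\<Sum>b\<in>Basis. f b *\<^sub>R J (\<lambda>t. t \<bullet> b))"
      using g1 by (simp add: J_sum J_scale cont continuous_intros)
    also have "\<dots> \<in> \<T>" by (intro sum scale coord)
    finally show ?case using cont[OF linear_continuous_on[OF linear]] by (simp add: f.zero)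
  next
    case (const c)
    then show ?case using zero by (simp add: J_const good_const)
  next
    case (add f g)
    then have "(J f - f 0 *\<^sub>R id_blinfun) + (J g - g 0 *\<^sub>R id_blinfun) \<in> \<T>" by (intro assms(4)) auto
    with add show ?case by (simp add: J_add good_add scaleR_add_left algebra_simps)
  next
    case (mult f g)
    define F G where "F = J f - f 0 *\<^sub>R id_blinfun" and "G = J g - g 0 *\<^sub>R id_blinfun"
    have "(F o\<^sub>L G) + (g 0 *\<^sub>R F + f 0 *\<^sub>R G) \<in> \<T>"
      using mult by (intro add scale comp) (auto simp: F_def G_def)
    also have "(F o\<^sub>L G) + (g 0 *\<^sub>R F + f 0 *\<^sub>R G) = J (\<lambda>t. f t * g t) - (f 0 * g 0) *\<^sub>R id_blinfun"
      using mult J_mult[of f g] by (simp add: F_def G_def blinfun_compose_simps algebra_simps)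
    finally show ?case using mult by (simp add: good_mult)
  qed
  have "\<exists>p. real_polynomial_function p \<and> (\<forall>t\<in>K. \<bar>g t - p t\<bar> < inverse (real (Suc n)))" for n
    by (rule Stone_Weierstrass_real_polynomial_function[OF K g, of "inverse (real (Suc n))"]) auto
  then obtain p where p: "\<And>n. real_polynomial_function (p n)"
    "\<And>n t. t \<in> K \<Longrightarrow> \<bar>g t - p n t\<bar> < inverse (real (Suc n))" by metis
  have gg: "good g" by (rule good_continuous[OF K g])
  have gp: "good (p n)" for n using poly[OF p(1)] by simp
  have "norm (J (p n) - J g) \<le> inverse (real (Suc n))" for n
    unfolding J_diff[OF gp gg, symmetric]
  proof (rule J_norm_le[OF good_diff[OF gp gg]])
    show "\<bar>p n t - g t\<bar> \<le> inverse (real (Suc n))" if "t \<in> K" for t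
      using p(2)[OF that, of n] by linarith
  qed simp
  then have lim: "(\<lambda>n. J (p n)) \<longlonglongrightarrow> J g"
    by (intro LIM_zero_cancel[OF Lim_null_comparison[OF always_eventually LIMSEQ_inverse_real_of_nat]] allI)
  show ?thesis
  proof (cases "id_blinfun \<in> \<T>")
    case True
    have "J (p n) \<in> \<T>" for n
      using add[OF conjunct1[OF poly[OF p(1)]] scale[OF True]] by (metis diff_add_cancel)
    then show ?thesis using closed_sequentially[OF \<T> _ lim] by blast
  next
    case False
    with unit have 0: "0 \<in> K" "g 0 = 0" by auto
    have "(\<lambda>n. p n 0) \<longlonglongrightarrow> 0"
    proof (rule Lim_null_comparison[OF always_eventually LIMSEQ_inverse_real_of_nat], rule allI)
      show "norm (p n 0) \<le> inverse (real (Suc n))" for n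
        using p(2)[OF 0(1), of n] 0(2) by simp
    qed
    then have "(\<lambda>n. J (p n) - p n 0 *\<^sub>R id_blinfun) \<longlonglongrightarrow> J g - 0 *\<^sub>R id_blinfun"
      by (intro tendsto_intros lim)
    then show ?thesis using closed_sequentially[OF \<T> _, of "\<lambda>n. J (p n) - p n 0 *\<^sub>R id_blinfun"] poly[OF p(1)] by simp
  qed
qed

section \<open>Uniqueness, null vectors and commutants\<close>

lemma pvm_measure_eqI:
  fixes S :: "real set" and E :: "real set \<Rightarrow> 'h::{real_inner,banach} \<Rightarrow>\<^sub>L 'h"
  assumes "pvm E" "pvm F" "\<And>a. E {a<..} = F {a<..}" "S \<in> sets borel"
  shows "E S = F S"
proof (rule symm_op_eqI)
  interpret E: pvm E by fact
  interpret F: pvm F by fact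
  show "symm_op (E S)" "symm_op (F S)" using assms by (auto simp: E.symm F.symm)
  fix \<xi>
  have "pvm_measure E \<xi> = pvm_measure F \<xi>"
    by (rule measure_eqI_lessThan) (auto simp: E.emeasure_measure F.emeasure_measure assms(3))
  then show "E S \<xi> \<bullet> \<xi> = F S \<xi> \<bullet> \<xi>"
    using assms(4) by (simp flip: E.measure_measure F.measure_measure)
qed

lemma (in pvm) E_UN_eq_0:
  assumes "range F \<subseteq> sets borel" "\<And>n. E (F n) \<eta> = 0"
  shows "E (\<Union>n::nat. F n) \<eta> = 0"
proof -
  have "emeasure (pvm_measure E \<eta>) (\<Union>n. F n) = 0"
    by (rule emeasure_UN_eq_0) (use assms in \<open>auto simp: emeasure_measure\<close>)
  moreover have "(\<Union>n. F n) \<in> sets borel" using assms by auto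
  ultimately show ?thesis using inner_eq_norm by (simp add: emeasure_measure)
qed

text \<open>The kernel conditions give \<open>F = F o\<^sub>L G\<close> and
  \<open>G = G o\<^sub>L F\<close>, and the second has the adjoint \<open>G = F o\<^sub>L G\<close>.
  Comparing kernels suits countable unions, because a vector annihilated by the projections of all
  members is annihilated by that of the union (\<open>E_UN_eq_0\<close>).\<close>

lemma proj_eqI:
  fixes F G :: "'h::real_inner \<Rightarrow>\<^sub>L 'h"
  assumes "symm_op F" "symm_op G" "\<And>\<xi>. F (F \<xi>) = F \<xi>" "\<And>\<xi>. G (G \<xi>) = G \<xi>"
    and GF: "\<And>\<eta>. G \<eta> = 0 \<Longrightarrow> F \<eta> = 0" and FG: "\<And>\<eta>. F \<eta> = 0 \<Longrightarrow> G \<eta> = 0"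
  shows "F = G"
proof (rule symm_op_eqI)
  fix \<xi>
  have "F (\<xi> - G \<xi>) = 0" "G (\<xi> - F \<xi>) = 0"
    by (rule GF FG, simp add: blinfun.diff_right assms)+
  then have "F \<xi> = F (G \<xi>)" "G \<xi> = G (F \<xi>)" by (simp_all add: blinfun.diff_right)
  then show "F \<xi> \<bullet> \<xi> = G \<xi> \<bullet> \<xi>"
    using symm_opD[OF assms(1), of "G \<xi>" \<xi>] symm_opD[OF assms(2), of \<xi> "F \<xi>"]
    by (metis assms(1,2) inner_commute symm_opD)
qed fact+

text \<open>From coordinates to continuous functions, then to closed sets and by Dynkin's lemma to
  Borel sets. This fact later provides commuting spectral measures as well as complex linearity of
  spectral projections.\<close>

lemma (in bpvm) E_commutes_with:
  fixes S :: "'h \<Rightarrow>\<^sub>L 'h"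
  assumes K: "compact K" and S: "\<And>b. b \<in> Basis \<Longrightarrow> S o\<^sub>L J (\<lambda>t. t \<bullet> b) = J (\<lambda>t. t \<bullet> b) o\<^sub>L S"
    and B: "B \<in> sets borel"
  shows "S o\<^sub>L E B = E B o\<^sub>L S"
proof -
  have cont: "S o\<^sub>L J g = J g o\<^sub>L S" if g: "continuous_on K g" for g
  proof -
    have "J g \<in> {T. S o\<^sub>L T = T o\<^sub>L S}"
    proof (rule J_continuous_mem[OF K g])
      show "closed {T. S o\<^sub>L T = T o\<^sub>L S}"
        by (intro closed_Collect_eq bounded_linear.continuous_on[OF bounded_bilinear.bounded_linear_left[OF bounded_bilinear_blinfun_compose]]
            bounded_linear.continuous_on[OF bounded_bilinear.bounded_linear_right[OF bounded_bilinear_blinfun_compose]] continuous_on_id)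
      show "a o\<^sub>L b \<in> {T. S o\<^sub>L T = T o\<^sub>L S}" if "a \<in> {T. S o\<^sub>L T = T o\<^sub>L S}" "b \<in> {T. S o\<^sub>L T = T o\<^sub>L S}" for a b
        using that by (simp add: blinfun_compose_assoc) (metis blinfun_compose_assoc)
    qed (use S in \<open>auto simp: blinfun_compose_simps\<close>)
    then show ?thesis by simp
  qed
  have cl: "S o\<^sub>L E C = E C o\<^sub>L S" if C: "closed C" for C
  proof (cases "C = {}")
    case True
    then show ?thesis by (simp add: empty)
  next
    case False
    \<comment> \<open>These functions increase to the indicator of the complement of
      \<open>C\<close>, as \<open>J_strong_limit\<close> requires; approximating \<open>C\<close>
      itself from outside would give a decreasing sequence.\<close>
    define F where "F n t = min 1 (real n * infdist t C)" for n t
    have lim: "(\<lambda>n. J (F n) \<xi>) \<longlonglongrightarrow> J (\<lambda>t. 1 - indicator C t) \<xi>" for \<xi>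
    proof (rule J_strong_limit[where C = 1])
      show "good (F n)" for n
        unfolding F_def by (intro good_continuous[OF K] continuous_intros)
      show "good (\<lambda>t. 1 - indicator C t)" using C by (intro good_diff good_indicator good_const) auto
      show "\<bar>F n t\<bar> \<le> 1" for n t by (auto simp: F_def infdist_nonneg)
      show "(\<lambda>n. F n t) \<longlonglongrightarrow> 1 - indicator C t" for t
      proof (cases "t \<in> C")
        case True
        then show ?thesis by (simp add: F_def)
      next
        case out: False
        then have d: "0 < infdist t C" using C False by (simp add: infdist_pos_not_in_closed)
        have "\<forall>\<^sub>F n in sequentially. 1 / infdist t C \<le> real n"
          using filterlim_real_sequentially by (simp add: filterlim_at_top)
        then have "\<forall>\<^sub>F n in sequentially. F n t = 1 - indicator C t"
          by eventually_elim (use d out in \<open>auto simp: F_def field_simps\<close>)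
        then show ?thesis by (rule tendsto_eventually)
      qed
    next
      fix m n :: nat and t assume mn: "m \<le> n"
      have "real m * infdist t C \<le> real n * infdist t C"
        using mn by (intro mult_right_mono) (auto simp: infdist_nonneg)
      then show "F m t \<le> F n t" unfolding F_def by linarith
    qed
    have "S o\<^sub>L J (F n) = J (F n) o\<^sub>L S" for n
      unfolding F_def by (intro cont continuous_intros)
    then have eq: "S (J (F n) \<xi>) = J (F n) (S \<xi>)" for n \<xi>
      by (metis blinfun_apply_blinfun_compose)
    have "S (J (\<lambda>t. 1 - indicator C t) \<xi>) = J (\<lambda>t. 1 - indicator C t) (S \<xi>)" for \<xi>
      using blinfun.tendsto[OF tendsto_const lim[of \<xi>], of S] lim[of "S \<xi>"] by (simp add: eq LIMSEQ_unique)
    moreover have "J (\<lambda>t. 1 - indicator C t) = id_blinfun - E C"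
      using C by (simp add: J_diff good_indicator good_const J_indicator J_const)
    ultimately show ?thesis
      by (intro blinfun_eqI) (simp add: blinfun.diff_left blinfun.diff_right)
  qed
  have stable: "Int_stable (Collect closed :: 'a set set)" by (auto simp: Int_stable_def)
  have sub: "Collect closed \<subseteq> Pow (UNIV :: 'a set)" by simp
  have "B \<in> sigma_sets UNIV (Collect closed)" using B by (simp add: borel_eq_closed)
  with stable sub show ?thesis
  proof (induction rule: sigma_sets_induct_disjoint)
    case (basic A)
    then show ?case using cl by simp
  next
    case empty
    have "E {} = 0" by (rule pvm.empty[OF pvm_axioms])
    then show ?case by simp
  next
    case (compl A)
    then have "A \<in> sets borel" by (simp add: borel_eq_closed)
    then show ?case using compl by (simp add: Compl blinfun_compose_simps flip: Compl_eq_Diff_UNIV)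
  next
    case (union A)
    then have A: "range A \<subseteq> sets borel" by (simp add: borel_eq_closed)
    show ?case
    proof (rule blinfun_eqI)
      fix \<xi>
      have "(\<lambda>k. S (E (A k) \<xi>)) sums S (E (\<Union>k. A k) \<xi>)"
        by (intro bounded_linear.sums[OF blinfun.bounded_linear_right] sums A union)
      moreover have "S (E (A k) \<xi>) = E (A k) (S \<xi>)" for k
        using union(3)[of k] by (metis blinfun_apply_blinfun_compose)
      ultimately show "(S o\<^sub>L E (\<Union>k. A k)) \<xi> = (E (\<Union>k. A k) o\<^sub>L S) \<xi>"
        using sums[OF A union(1), of "S \<xi>"] by (simp add: sums_unique2)
    qed
  qed
qed

section \<open>Products of commuting projection-valued measures\<close>

text \<open>A nonzero vector \<open>\<eta>\<close> in the range of \<open>E {..<a}\<close> would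
  have a quadratic form below \<open>a * (norm \<eta>)\<^sup>2\<close>; similarly above
  \<open>b\<close>.\<close>

lemma pvm_support_Icc:
  fixes E :: "real set \<Rightarrow> 'h::{real_inner,banach} \<Rightarrow>\<^sub>L 'h"
  assumes "pvm E" and int: "\<And>\<xi>. integrable (pvm_measure E \<xi>) (\<lambda>t. t)"
    and x: "\<And>\<xi>. (\<integral>t. t \<partial>pvm_measure E \<xi>) = x \<xi> \<bullet> \<xi>"
    and a: "\<And>\<xi>. a * (norm \<xi>)\<^sup>2 \<le> x \<xi> \<bullet> \<xi>" and b: "\<And>\<xi>. x \<xi> \<bullet> \<xi> \<le> b * (norm \<xi>)\<^sup>2"
  shows "E {a..b} = id_blinfun"
proof -
  interpret pvm E by fact
  have 1: "E {..<a} = 0"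
  proof (rule blinfun_eqI)
    fix \<xi>
    let ?\<eta> = "E {..<a} \<xi>"
    interpret finite_measure "pvm_measure E ?\<eta>" by (rule finite_measure)
    have "?\<eta> = 0"
    proof (rule eq_0_of_integral_le_0[where S = "{..<a}" and f = "\<lambda>t. a - t"])
      show "(\<integral>t. a - t \<partial>pvm_measure E ?\<eta>) \<le> 0"
        using a[of ?\<eta>] int measure_UNIV[of ?\<eta>] by (simp add: x mult.commute)
    qed (use int in \<open>auto simp: idem\<close>)
    then show "?\<eta> = blinfun_apply 0 \<xi>" by simp
  qed
  have 2: "E {b<..} = 0"
  proof (rule blinfun_eqI)
    fix \<xi>
    let ?\<eta> = "E {b<..} \<xi>"
    interpret finite_measure "pvm_measure E ?\<eta>" by (rule finite_measure)
    have "?\<eta> = 0"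
    proof (rule eq_0_of_integral_le_0[where S = "{b<..}" and f = "\<lambda>t. t - b"])
      show "(\<integral>t. t - b \<partial>pvm_measure E ?\<eta>) \<le> 0"
        using b[of ?\<eta>] int measure_UNIV[of ?\<eta>] by (simp add: x mult.commute)
    qed (use int in \<open>auto simp: idem\<close>)
    then show "?\<eta> = blinfun_apply 0 \<xi>" by simp
  qed
  have "{a..b} = - {..<a} \<inter> - {b<..}" by auto
  moreover have "E (- {..<a}) = id_blinfun" "E (- {b<..}) = id_blinfun"
    by (subst Compl; simp add: 1 2)+
  moreover have "E (- {..<a} \<inter> - {b<..}) = E (- {..<a}) o\<^sub>L E (- {b<..})" by (rule Int) auto
  ultimately show ?thesis by (simp only: blinfun_compose_id)
qed

lemma proj_norm_le:
  fixes p :: "'h::real_inner \<Rightarrow>\<^sub>L 'h"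
  assumes "symm_op p" "p o\<^sub>L p = p"
  shows "p \<xi> \<bullet> \<xi> = (norm (p \<xi>))\<^sup>2" and "norm (p \<xi>) \<le> norm \<xi>"
proof -
  have "p (p \<xi>) = p \<xi>" using assms(2) by (metis blinfun_apply_blinfun_compose)
  then show *: "p \<xi> \<bullet> \<xi> = (norm (p \<xi>))\<^sup>2"
    using symm_opD[OF assms(1), of "p \<xi>" \<xi>] by (simp add: power2_norm_eq_inner)
  show "norm (p \<xi>) \<le> norm \<xi>"
  proof (cases "p \<xi> = 0")
    case False
    have "norm (p \<xi>) * norm (p \<xi>) \<le> norm (p \<xi>) * norm \<xi>"
      using norm_cauchy_schwarz[of "p \<xi>" \<xi>] * by (simp add: power2_eq_square)
    with False show ?thesis by simp
  qed simp
qed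

text \<open>Countably many commuting projections are encoded in one operator, \<open>\<Sum>\<^sub>k 3\<^sup>-\<^sup>k p\<^sub>k\<close>, from which
  they are recovered digit by digit.\<close>

lemma commuting_projections:
  fixes p :: "nat \<Rightarrow> 'h::{real_inner,banach} \<Rightarrow>\<^sub>L 'h"
  assumes p_symm: "\<And>k. symm_op (p k)" and p_idem: "\<And>k. p k o\<^sub>L p k = p k"
    and comm: "\<And>j k. p j o\<^sub>L p k = p k o\<^sub>L p j"
  obtains E :: "real set \<Rightarrow> 'h \<Rightarrow>\<^sub>L 'h" and D
    where "pvm E" "\<And>k. D k \<in> sets borel" "\<And>k. E (D k) = p k"
proof -
  have np: "norm (p k) \<le> 1" for k
    by (rule norm_blinfun_bound) (use proj_norm_le[OF p_symm p_idem] in auto)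
  \<comment> \<open>The tails satisfy \<open>y k = p k + (1/3) *\<^sub>R y (Suc k)\<close>, where
    the form of \<open>y (Suc k)\<close> lies between \<open>0\<close> and \<open>3/2\<close>. Hence
    \<open>y k\<close> is at most \<open>1/2\<close> on the kernel of \<open>p k\<close> and at
    least \<open>1\<close> on its range. Base 3 leaves this gap, which base 2 would close.\<close>
  define y where "y k = (\<Sum>j. (1/3::real) ^ j *\<^sub>R p (k + j))" for k
  have summ: "summable (\<lambda>j. (1/3::real) ^ j *\<^sub>R p (k + j))" for k
    by (rule summable_comparison_test'[of "\<lambda>j. (1/3) ^ j" 0])
      (use np in \<open>auto intro: summable_geometric simp: mult_left_le\<close>)
  have y_sums: "(\<lambda>j. (1/3::real) ^ j *\<^sub>R p (k + j)) sums y k" for k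
    unfolding y_def by (rule summable_sums[OF summ])
  have y_rec: "y k = p k + (1/3) *\<^sub>R y (Suc k)" for k
  proof -
    have "y k = p k + (\<Sum>j. (1/3::real) ^ Suc j *\<^sub>R p (k + Suc j))"
      using suminf_split_head[OF summ, of k] by (simp add: y_def)
    also have "(\<Sum>j. (1/3::real) ^ Suc j *\<^sub>R p (k + Suc j)) = (\<Sum>j. (1/3::real) *\<^sub>R ((1/3) ^ j *\<^sub>R p (Suc k + j)))"
      by simp
    also have "\<dots> = (1/3) *\<^sub>R y (Suc k)"
      unfolding y_def by (rule suminf_scaleR_right[OF summ, symmetric])
    finally show ?thesis .
  qed
  have y_inner: "(\<lambda>j. (1/3) ^ j * (p (k + j) \<xi> \<bullet> \<eta>)) sums (y k \<xi> \<bullet> \<eta>)" for k \<xi> \<eta>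
    using bounded_linear.sums[OF bounded_linear_inner_left bounded_linear.sums[OF blinfun.bounded_linear_left y_sums[of k]], of \<xi> \<eta>]
    by (simp add: blinfun.scaleR_left)
  have y_symm: "symm_op (y k)" for k
  proof -
    have "y k \<xi> \<bullet> \<eta> = y k \<eta> \<bullet> \<xi>" for \<xi> \<eta>
    proof (rule sums_unique2[OF y_inner[of k \<xi> \<eta>]])
      show "(\<lambda>j. (1/3) ^ j * (p (k + j) \<xi> \<bullet> \<eta>)) sums (y k \<eta> \<bullet> \<xi>)"
      proof -
        have "p j \<xi> \<bullet> \<eta> = p j \<eta> \<bullet> \<xi>" for j
          using symm_opD[OF p_symm, of j \<xi> \<eta>] by (simp only: inner_commute)
        then show ?thesis using y_inner[of k \<eta> \<xi>] by (simp only:)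
      qed
    qed
    then show ?thesis by (simp add: symm_op_def inner_commute)
  qed
  have y_nonneg: "0 \<le> y k \<xi> \<bullet> \<xi>" for k \<xi>
    by (rule sums_le[OF _ sums_zero y_inner]) (simp add: proj_norm_le(1)[OF p_symm p_idem])
  have y_le: "y k \<xi> \<bullet> \<xi> \<le> 3/2 * (norm \<xi>)\<^sup>2" for k \<xi>
  proof (rule sums_le[OF _ y_inner])
    show "(\<lambda>j. (1/3) ^ j * (norm \<xi>)\<^sup>2) sums (3/2 * (norm \<xi>)\<^sup>2)"
      using sums_mult2[OF geometric_sums[of "1/3::real"], of "(norm \<xi>)\<^sup>2"] by simp
    show "(1/3) ^ j * (p (k + j) \<xi> \<bullet> \<xi>) \<le> (1/3) ^ j * (norm \<xi>)\<^sup>2" for j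
      by (rule mult_left_mono) (auto simp: proj_norm_le[OF p_symm p_idem])
  qed
  have py: "p i o\<^sub>L y k = y k o\<^sub>L p i" for i k
  proof (rule sums_unique2)
    show "(\<lambda>j. (1/3::real) ^ j *\<^sub>R (p i o\<^sub>L p (k + j))) sums (p i o\<^sub>L y k)"
      using bounded_linear.sums[OF bounded_bilinear.bounded_linear_right[OF bounded_bilinear_blinfun_compose] y_sums[of k], of "p i"]
      by (simp add: blinfun_compose_simps)
    show "(\<lambda>j. (1/3::real) ^ j *\<^sub>R (p i o\<^sub>L p (k + j))) sums (y k o\<^sub>L p i)"
      using bounded_linear.sums[OF bounded_bilinear.bounded_linear_left[OF bounded_bilinear_blinfun_compose] y_sums[of k], of "p i"]
      by (simp add: blinfun_compose_simps comm[of i])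
  qed
  obtain E r where E: "bpvm E {-r..r}" and J0: "bpvm.J E {-r..r} (\<lambda>t. t) = y 0"
    by (rule spectral_theorem[OF y_symm])
  interpret bpvm E "{-r..r}" by (rule E)
  have pE: "p i o\<^sub>L E S = E S o\<^sub>L p i" if "S \<in> sets borel" for i S
    by (rule E_commutes_with) (use that J0 py in auto)
  \<comment> \<open>\<open>g k\<close> is to be the function of the spectral variable that
    represents \<open>y k\<close>: the leading digit, \<open>1\<close> from the threshold
    \<open>3/4\<close> inside the gap onwards, is subtracted and the rest is multiplied by
    3.\<close>
  define g where "g = rec_nat (\<lambda>t. t) (\<lambda>_ h t. 3 * (h t - indicat_real {s. 3/4 \<le> h s} t))"
  have g_simps: "g 0 = (\<lambda>t. t)" "g (Suc k) = (\<lambda>t. 3 * (g k t - indicat_real {s. 3/4 \<le> g k s} t))" for k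
    by (simp_all add: g_def)
  define D where "D k = {s. 3/4 \<le> g k s}" for k
  have g_borel [measurable]: "g k \<in> borel_measurable borel" for k
    by (induction k) (simp_all add: g_simps)
  have D: "D k \<in> sets borel" for k unfolding D_def by measurable
  have g_good: "good (g k)" for k
  proof (induction k)
    case (Suc k)
    have "good (indicator (D k))" by (rule good_indicator[OF D])
    with Suc show ?case unfolding g_simps D_def by (intro good_scale good_diff)
  qed (simp add: g_simps good_continuous)
  \<comment> \<open>Since the two projections commute, it suffices that the range of either meets
    the kernel of the other trivially. A nonzero common vector of norm one would give
    \<open>y k\<close> a form both above \<open>1/2\<close> and at most \<open>1/2\<close>, or both
    below \<open>3/4\<close> and at least \<open>1\<close>.\<close>
  have ED: "E (D k) = p k" if J: "J (g k) = y k" for k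
  proof (rule proj_eqI)
    have null: "\<eta> = 0" if "E (D k) \<eta> = \<eta>" "p k \<eta> = 0" for \<eta>
    proof (rule eq_0_of_integral_le_0[where S = "{-r..r} \<inter> D k" and f = "\<lambda>t. indicat_real {-r..r} t * (g k t - 1/2)"])
      show "E ({-r..r} \<inter> D k) \<eta> = \<eta>" using that D by (simp add: Int E_K)
      show "0 < indicat_real {-r..r} t * (g k t - 1/2)" if "t \<in> {-r..r} \<inter> D k" for t
        using that by (simp add: D_def)
      have "(\<integral>t. indicat_real {-r..r} t * (g k t - 1/2) \<partial>pvm_measure E \<eta>) = quad (g k) \<eta> - quad (\<lambda>_. 1/2) \<eta>"
        using quad_add[OF g_good good_const[of "-1/2"], of k \<eta>] by (simp add: quad_const quad_def[symmetric])
      also have "\<dots> = y k \<eta> \<bullet> \<eta> - 1/2 * (norm \<eta>)\<^sup>2"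
        using J_quad[OF g_good, of k \<eta>] by (simp add: J quad_const)
      also have "\<dots> \<le> 0" using y_le[of "Suc k" \<eta>] that(2)
        by (simp add: y_rec[of k] blinfun.add_left blinfun.scaleR_left inner_add_left)
      finally show "(\<integral>t. indicat_real {-r..r} t * (g k t - 1/2) \<partial>pvm_measure E \<eta>) \<le> 0" .
      show "integrable (pvm_measure E \<eta>) (\<lambda>t. indicat_real {-r..r} t * (g k t - 1/2))"
        by (intro integrable_good good_diff g_good good_const)
    qed (use D in auto)
    have null': "\<eta> = 0" if "E (D k) \<eta> = 0" "p k \<eta> = \<eta>" for \<eta>
    proof (rule eq_0_of_integral_le_0[where S = "{-r..r} \<inter> - D k" and f = "\<lambda>t. indicat_real {-r..r} t * (3/4 - g k t)"])
      show "E ({-r..r} \<inter> - D k) \<eta> = \<eta>" using that D Int[of "{-r..r}" "- D k"]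
        by (simp add: E_K Compl blinfun.diff_left)
      show "0 < indicat_real {-r..r} t * (3/4 - g k t)" if "t \<in> {-r..r} \<inter> - D k" for t
        using that by (simp add: D_def)
      have "(\<integral>t. indicat_real {-r..r} t * (3/4 - g k t) \<partial>pvm_measure E \<eta>) = quad (\<lambda>_. 3/4) \<eta> - quad (g k) \<eta>"
        using quad_add[OF good_const[of "3/4"] good_scale[OF g_good, of "-1"], of k \<eta>]
          quad_scale[of "-1" "g k" \<eta>] by (simp add: quad_const quad_def[symmetric])
      also have "\<dots> = 3/4 * (norm \<eta>)\<^sup>2 - y k \<eta> \<bullet> \<eta>"
        using J_quad[OF g_good, of k \<eta>] by (simp add: J quad_const)
      also have "\<dots> \<le> 0" using y_nonneg[of "Suc k" \<eta>] that(2)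
        by (simp add: y_rec[of k] blinfun.add_left blinfun.scaleR_left inner_add_left power2_norm_eq_inner)
          (insert inner_ge_zero[of \<eta>], linarith)
      finally show "(\<integral>t. indicat_real {-r..r} t * (3/4 - g k t) \<partial>pvm_measure E \<eta>) \<le> 0" .
      show "integrable (pvm_measure E \<eta>) (\<lambda>t. indicat_real {-r..r} t * (3/4 - g k t))"
        by (intro integrable_good good_diff g_good good_const)
    qed (use D in auto)
    have pE': "p k (E (D k) \<eta>) = E (D k) (p k \<eta>)" for \<eta>
      using pE[OF D[of k], of k] by (metis blinfun_apply_blinfun_compose)
    show pp: "p k (p k \<xi>) = p k \<xi>" for \<xi> using p_idem[of k] by (metis blinfun_apply_blinfun_compose)
    show EE: "E (D k) (E (D k) \<xi>) = E (D k) \<xi>" for \<xi> using D by (rule pvm.idem[OF pvm_axioms])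
    show "E (D k) \<eta> = 0" if "p k \<eta> = 0" for \<eta>
      by (rule null[OF EE]) (simp only: pE' that blinfun.zero_right)
    show "p k \<eta> = 0" if "E (D k) \<eta> = 0" for \<eta>
      by (rule null'[OF _ pp]) (simp only: pE'[symmetric] that blinfun.zero_right)
    show "symm_op (E (D k))" using D by (rule pvm.symm[OF pvm_axioms])
  qed (rule p_symm)
  have "J (g k) = y k" for k
  proof (induction k)
    case (Suc k)
    have "J (g (Suc k)) = 3 *\<^sub>R (J (g k) - E (D k))"
      using D[of k] unfolding g_simps D_def[symmetric]
      by (simp only: J_scale[OF good_diff[OF g_good good_indicator[OF D]]]
          J_diff[OF g_good good_indicator[OF D]] J_indicator[OF D])
    also have "\<dots> = y (Suc k)" using ED[OF Suc] Suc y_rec[of k] by simp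
    finally show ?case .
  qed (simp add: g_simps J0)
  then show ?thesis using that[of E D] ED D pvm_axioms by blast
qed

text \<open>The projections \<open>E i {q<..}\<close> with rational \<open>q\<close> all become
  values of one spectral measure \<open>F\<close> on the line. From the corresponding sets,
  measurable functions \<open>\<phi> i\<close> are rebuilt that map \<open>F\<close> to
  \<open>E i\<close>, and the product measure is the image of \<open>F\<close> under the vector of
  these functions.\<close>

theorem product_pvm:
  fixes E :: "'n::finite \<Rightarrow> real set \<Rightarrow> 'h::{real_inner,banach} \<Rightarrow>\<^sub>L 'h"
  assumes E: "\<And>i. pvm (E i)" and supp: "\<And>i. E i {-r i..r i} = id_blinfun"
    and comm: "\<And>i j S T. S \<in> sets borel \<Longrightarrow> T \<in> sets borel \<Longrightarrow> E i S o\<^sub>L E j T = E j T o\<^sub>L E i S"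
  obtains P :: "(real^'n) set \<Rightarrow> 'h \<Rightarrow>\<^sub>L 'h"
    where "pvm P" "\<And>i S. S \<in> sets borel \<Longrightarrow> P {v. v $ i \<in> S} = E i S"
proof -
  define p where "p k = (case from_nat k of (i, q) \<Rightarrow> E i {real_of_rat q<..})" for k
  have p: "p (to_nat (i, q)) = E i {real_of_rat q<..}" for i q by (simp add: p_def)
  obtain F :: "real set \<Rightarrow> 'h \<Rightarrow>\<^sub>L 'h" and D where F: "pvm F" and D: "\<And>k. D k \<in> sets borel" and FD: "\<And>k. F (D k) = p k"
  proof (rule commuting_projections[of p])
    show "symm_op (p k)" for k by (auto simp: p_def split: prod.split intro: pvm.symm[OF E])
    show "p k o\<^sub>L p k = p k" for k
      by (auto simp: p_def split: prod.split simp flip: pvm.Int[OF E])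
    show "p j o\<^sub>L p k = p k o\<^sub>L p j" for j k
      by (auto simp: p_def split: prod.split intro: comm)
  qed (rule that)
  interpret F: pvm F by (rule F)
  \<comment> \<open>Forcing the sets to be empty for \<open>q \<ge> r i\<close> and full for
    \<open>q < - r i\<close> changes no projection and makes the supremum that defines
    \<open>\<phi>\<close> one of a nonempty bounded set at every point.\<close>
  define C where "C i q = (if r i \<le> real_of_rat q then {} else if real_of_rat q < - r i then UNIV else D (to_nat (i, q)))" for i q
  have C: "C i q \<in> sets borel" for i q by (simp add: C_def D)
  have FC: "F (C i q) = E i {real_of_rat q<..}" for i q
  proof -
    interpret E: pvm "E i" by (rule E)
    have "E i {real_of_rat q<..} = E i ({real_of_rat q<..} \<inter> {-r i..r i})"
      by (simp add: E.Int supp)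
    moreover have "{real_of_rat q<..} \<inter> {-r i..r i} = {}" if "r i \<le> real_of_rat q" using that by auto
    moreover have "{real_of_rat q<..} \<inter> {-r i..r i} = {-r i..r i}" if "real_of_rat q < - r i" using that by auto
    ultimately show ?thesis
      by (auto simp: C_def E.empty F.empty F.UNIV supp FD p)
  qed
  \<comment> \<open>The coordinate as the supremum of the rationals it exceeds. The sets
    \<open>C i q\<close> need not decrease in \<open>q\<close> pointwise, but the level sets of
    \<open>\<phi> i\<close> are countable unions of them, and these have the right
    projections.\<close>
  define \<phi> where "\<phi> i t = Sup {real_of_rat q |q. t \<in> C i q}" for i t
  have \<phi>_greater: "s < \<phi> i t \<longleftrightarrow> (\<exists>q. s < real_of_rat q \<and> t \<in> C i q)" for s i t
  proof -
    obtain q where "real_of_rat q < min (- r i) (r i)"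
      using of_rat_dense[of "min (- r i) (r i) - 1" "min (- r i) (r i)"]
      by (metis diff_less_eq less_add_one)
    then have "{real_of_rat q |q. t \<in> C i q} \<noteq> {}" by (auto simp: C_def intro!: exI[of _ q])
    moreover have "bdd_above {real_of_rat q |q. t \<in> C i q}"
      by (rule bdd_aboveI[of _ "r i"]) (auto simp: C_def split: if_splits)
    ultimately show ?thesis unfolding \<phi>_def by (subst less_cSup_iff) auto
  qed
  have level: "\<phi> i -` {s<..} = (\<Union>q\<in>{q. s < real_of_rat q}. C i q)" for i s
    by (auto simp: \<phi>_greater)
  have \<phi> [measurable]: "\<phi> i \<in> borel_measurable borel" for i
    unfolding borel_measurable_iff_greater
  proof
    fix s
    have "(\<Union>q\<in>{q. s < real_of_rat q}. C i q) \<in> sets borel"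
      by (rule sets.countable_UN'') (auto simp: C)
    then show "{t \<in> space borel. s < \<phi> i t} \<in> sets borel"
      using level[where i = i and s = s] by (simp add: vimage_def)
  qed
  have F\<phi>: "F (\<phi> i -` S) = E i S" if S: "S \<in> sets borel" for i S
  proof (rule pvm_measure_eqI[OF pvm_vimage[OF F \<phi>] E _ S])
    fix s
    interpret E: pvm "E i" by (rule E)
    obtain e :: "nat \<Rightarrow> rat" where e: "range e = {q. s < real_of_rat q}"
    proof -
      have "{q. s < real_of_rat q} \<noteq> {}" using of_rat_dense[of s "s + 1"] by auto
      then show ?thesis by (rule that[OF range_from_nat_into[OF _ countableI_type]])
    qed
    have en: "s < real_of_rat (e n)" for n using e by (metis (mono_tags) mem_Collect_eq rangeI)
    have 1: "\<phi> i -` {s<..} = (\<Union>n. C i (e n))" unfolding level e[symmetric] by auto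
    have 2: "{s<..} = (\<Union>n. {real_of_rat (e n)<..})"
    proof -
      have "{s<..} = (\<Union>q\<in>range e. {real_of_rat q<..})"
        unfolding e using of_rat_dense by (auto intro: less_trans)
      then show ?thesis by auto
    qed
    have sub: "A \<subseteq> B \<Longrightarrow> A \<in> sets borel \<Longrightarrow> B \<in> sets borel \<Longrightarrow> pvm G \<Longrightarrow> G B \<eta> = 0 \<Longrightarrow> G A \<eta> = 0"
      for A B :: "real set" and G :: "real set \<Rightarrow> 'h \<Rightarrow>\<^sub>L 'h" and \<eta>
      using pvm.Int[of G A B] by (metis Int_absorb2 blinfun.zero_right blinfun_apply_blinfun_compose)
    have m: "\<phi> i -` {s<..} \<in> sets borel" using measurable_sets[OF \<phi>, of "{s<..}" i] by simp
    show "F (\<phi> i -` {s<..}) = E i {s<..}"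
    proof (rule proj_eqI)
      show "F (\<phi> i -` {s<..}) \<eta> = 0" if "E i {s<..} \<eta> = 0" for \<eta>
        unfolding 1
      proof (rule F.E_UN_eq_0)
        show "F (C i (e n)) \<eta> = 0" for n
          unfolding FC by (rule sub[OF _ _ _ E that]) (use less_imp_le[OF en] in auto)
      qed (auto simp: C)
      show "E i {s<..} \<eta> = 0" if "F (\<phi> i -` {s<..}) \<eta> = 0" for \<eta>
        unfolding 2
      proof (rule E.E_UN_eq_0)
        show "E i {real_of_rat (e n)<..} \<eta> = 0" for n
          unfolding FC[symmetric] by (rule sub[OF _ _ m F that]) (auto simp: C 1)
      qed auto
    qed (use m in \<open>auto intro: F.symm E.symm F.idem E.idem\<close>)
  qed
  define \<Phi> where "\<Phi> t = (\<chi> i. \<phi> i t)" for t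
  have \<Phi>: "\<Phi> \<in> borel_measurable borel"
    by (subst borel_measurable_euclidean_space) (auto simp: \<Phi>_def Basis_vec_def inner_axis)
  have "pvm (\<lambda>S. F (\<Phi> -` S))" by (rule pvm_vimage[OF F \<Phi>])
  moreover have "F (\<Phi> -` {v. v $ i \<in> S}) = E i S" if "S \<in> sets borel" for i S
    using F\<phi>[OF that, of i] by (simp add: \<Phi>_def vimage_def)
  ultimately show ?thesis using that by blast
qed

section \<open>The spectral theorem in terms of integrals over the line\<close>

lemma (in pvm) indicator_support:
  fixes f :: "'a \<Rightarrow> real"
  assumes K: "K \<in> sets borel" "E K = id_blinfun" and f: "f \<in> borel_measurable borel"
  shows "integrable (pvm_measure E \<xi>) (\<lambda>t. indicat_real K t * f t) \<longleftrightarrow> integrable (pvm_measure E \<xi>) f"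
    and "(\<integral>t. indicat_real K t * f t \<partial>pvm_measure E \<xi>) = (\<integral>t. f t \<partial>pvm_measure E \<xi>)"
proof -
  have AE: "AE t in pvm_measure E \<xi>. indicat_real K t * f t = f t"
    using AE_measure[OF K] by eventually_elim simp
  have [measurable]: "f \<in> borel_measurable (pvm_measure E \<xi>)" "K \<in> sets (pvm_measure E \<xi>)"
    using f K by (auto simp: measurable_cong_sets[OF sets_measure refl])
  have m: "(\<lambda>t. indicat_real K t * f t) \<in> borel_measurable (pvm_measure E \<xi>)" by measurable
  show "integrable (pvm_measure E \<xi>) (\<lambda>t. indicat_real K t * f t) \<longleftrightarrow> integrable (pvm_measure E \<xi>) f"
    by (rule integrable_cong_AE[OF m _ AE]) measurable
  show "(\<integral>t. indicat_real K t * f t \<partial>pvm_measure E \<xi>) = (\<integral>t. f t \<partial>pvm_measure E \<xi>)"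
    by (rule integral_cong_AE[OF m _ AE]) measurable
qed

lemma bpvm_Icc:
  fixes x :: "'h::{real_inner,banach} \<Rightarrow>\<^sub>L 'h"
  assumes E: "pvm E" and x: "symm_op x"
    and int: "\<And>\<xi>. integrable (pvm_measure E \<xi>) (\<lambda>t. t)"
    and quad: "\<And>\<xi>. (\<integral>t. t \<partial>pvm_measure E \<xi>) = x \<xi> \<bullet> \<xi>"
    and a: "\<And>\<xi>. a * (norm \<xi>)\<^sup>2 \<le> x \<xi> \<bullet> \<xi>" and b: "\<And>\<xi>. x \<xi> \<bullet> \<xi> \<le> b * (norm \<xi>)\<^sup>2"
  shows "bpvm E {a..b}" "bpvm.J E {a..b} (\<lambda>t. t) = x"
proof -
  have id: "E {a..b} = id_blinfun" by (rule pvm_support_Icc) fact+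
  then show "bpvm E {a..b}" using E by (simp add: bpvm_def bpvm_axioms_def)
  then interpret bpvm E "{a..b}" .
  show "J (\<lambda>t. t) = x"
    by (rule J_eqI[OF x]) (simp add: quad_def indicator_support(2)[OF _ id] quad)
qed

text \<open>Free of a chosen interval, as in \<open>is_spectral_integral\<close>. The commutation
  clause yields complex linearity of the projections when \<open>S\<close> is multiplication by a
  complex scalar.\<close>

lemma spectral_theorem_integrals:
  fixes x :: "'h::{real_inner,banach} \<Rightarrow>\<^sub>L 'h"
  assumes "symm_op x"
  obtains E where "pvm E" "\<And>\<xi>. integrable (pvm_measure E \<xi>) (\<lambda>t. t)"
    "\<And>\<xi>. (\<integral>t. t \<partial>pvm_measure E \<xi>) = x \<xi> \<bullet> \<xi>"
    "\<And>S B. S o\<^sub>L x = x o\<^sub>L S \<Longrightarrow> B \<in> sets borel \<Longrightarrow> S o\<^sub>L E B = E B o\<^sub>L S"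
proof -
  obtain E r where E: "bpvm E {-r..r}" and J: "bpvm.J E {-r..r} (\<lambda>t. t) = x"
    by (rule spectral_theorem[OF assms])
  interpret bpvm E "{-r..r}" by (rule E)
  have g: "good (\<lambda>t. t)" by (rule good_continuous) (auto intro: continuous_intros)
  show ?thesis
  proof (rule that[OF pvm_axioms])
    show "integrable (pvm_measure E \<xi>) (\<lambda>t. t)" for \<xi>
      using integrable_good[OF g, of \<xi>] by (subst (asm) indicator_support(1)[OF K_borel E_K]) simp_all
    show "(\<integral>t. t \<partial>pvm_measure E \<xi>) = x \<xi> \<bullet> \<xi>" for \<xi>
    proof -
      have "(\<integral>t. t \<partial>pvm_measure E \<xi>) = quad (\<lambda>t. t) \<xi>"
        unfolding quad_def by (rule indicator_support(2)[OF K_borel E_K, symmetric]) simp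
      also have "\<dots> = x \<xi> \<bullet> \<xi>" using J_quad[OF g, of \<xi>] by (simp only: J)
      finally show ?thesis .
    qed
    show "S o\<^sub>L E B = E B o\<^sub>L S" if "S o\<^sub>L x = x o\<^sub>L S" "B \<in> sets borel" for S B
    proof (rule E_commutes_with)
      show "S o\<^sub>L J (\<lambda>t. t \<bullet> b) = J (\<lambda>t. t \<bullet> b) o\<^sub>L S" if "b \<in> Basis" for b :: real
        using that \<open>S o\<^sub>L x = _\<close> by (simp add: J)
    qed (use that in auto)
  qed
qed

lemma spectral_theorem_Icc:
  fixes x :: "'h::{real_inner,banach} \<Rightarrow>\<^sub>L 'h"
  assumes x: "symm_op x"
    and a: "\<And>\<xi>. a * (norm \<xi>)\<^sup>2 \<le> x \<xi> \<bullet> \<xi>" and b: "\<And>\<xi>. x \<xi> \<bullet> \<xi> \<le> b * (norm \<xi>)\<^sup>2"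
  obtains E where "bpvm E {a..b}" "bpvm.J E {a..b} (\<lambda>t. t) = x"
proof -
  obtain E where E: "pvm E" "\<And>\<xi>. integrable (pvm_measure E \<xi>) (\<lambda>t. t)"
    "\<And>\<xi>. (\<integral>t. t \<partial>pvm_measure E \<xi>) = x \<xi> \<bullet> \<xi>"
    by (rule spectral_theorem_integrals[OF x]) (rule that)
  show ?thesis by (rule that[OF bpvm_Icc[OF E(1) x E(2,3) a b]])
qed

section \<open>Complex structure\<close>

lemma cinner_eq_Complex: "cinner x y = Complex (x \<bullet> y) (- ((\<i> *\<^sub>C x) \<bullet> y))"
  for x y :: "'h::complex_hilbert_space"
proof -
  have "(\<i> *\<^sub>C x) \<bullet> y = - Im (cinner x y)"
    by (simp add: cinner_cscale_left flip: Re_cinner)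
  then show ?thesis by (simp add: complex_eq_iff Re_cinner)
qed

lemma is_adjoint_iff:
  assumes "T \<in> bounded_ops"
  shows "is_adjoint T S \<longleftrightarrow> (\<forall>\<xi> \<eta>. T \<xi> \<bullet> \<eta> = \<xi> \<bullet> S \<eta>)"
proof
  assume "is_adjoint T S"
  then show "\<forall>\<xi> \<eta>. T \<xi> \<bullet> \<eta> = \<xi> \<bullet> S \<eta>" by (simp add: is_adjoint_def flip: Re_cinner)
next
  assume *: "\<forall>\<xi> \<eta>. T \<xi> \<bullet> \<eta> = \<xi> \<bullet> S \<eta>"
  have "\<i> *\<^sub>C T \<xi> = T (\<i> *\<^sub>C \<xi>)" for \<xi> using assms by (simp add: bounded_ops_def)
  with * show "is_adjoint T S" by (simp add: is_adjoint_def cinner_eq_Complex)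
qed

lemma is_adjoint_self_iff: "T \<in> bounded_ops \<Longrightarrow> is_adjoint T T \<longleftrightarrow> symm_op T"
  using is_adjoint_iff[of T T] by (simp only: symm_op_def)

lemma cinner_symm:
  assumes "T \<in> bounded_ops" "symm_op T"
  shows "cinner (T \<xi>) \<xi> = of_real (T \<xi> \<bullet> \<xi>)"
proof -
  have "cinner (T \<xi>) \<xi> = cnj (cinner (T \<xi>) \<xi>)"
    using assms is_adjoint_self_iff[OF assms(1)] by (metis cinner_commute is_adjoint_def)
  then have "Im (cinner (T \<xi>) \<xi>) = 0" by (simp add: complex_eq_iff)
  then show ?thesis by (simp add: complex_eq_iff Re_cinner)
qed

text \<open>The hypothesis says that the real quadratic form of \<open>J\<close> after
  \<open>T\<close> vanishes, where \<open>J\<close> is multiplication by the imaginary unit.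
  Polarisation with second vector \<open>J \<eta>\<close> gives symmetry, as \<open>J\<close> is
  isometric and commutes with \<open>T\<close>.\<close>

lemma symm_of_real_cinner:
  assumes T: "T \<in> bounded_ops" and real: "\<And>\<xi>. Im (cinner (T \<xi>) \<xi>) = 0"
  shows "symm_op T"
proof -
  define J where "J \<xi> = \<i> *\<^sub>C \<xi>" for \<xi> :: 'a
  have Jlin: "J (\<xi> + \<eta>) = J \<xi> + J \<eta>" for \<xi> \<eta> by (simp add: J_def cscale_add_right)
  have JJ: "J (J \<xi>) = - \<xi>" for \<xi>
    by (simp add: J_def cscale_cscale) (metis cscale_of_real of_real_1 of_real_minus scaleR_minus1_left)
  have TJ: "T (J \<xi>) = J (T \<xi>)" for \<xi> using T by (simp add: J_def bounded_ops_def)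
  have q: "J (T \<xi>) \<bullet> \<xi> = 0" for \<xi> using real[of \<xi>] by (simp add: cinner_eq_Complex J_def)
  have "J (T \<xi>) \<bullet> \<eta> + J (T \<eta>) \<bullet> \<xi> = 0" for \<xi> \<eta>
    using q[of "\<xi> + \<eta>"] q[of \<xi>] q[of \<eta>]
    by (simp add: blinfun.add_right Jlin inner_add_left inner_add_right)
  from this[of _ "J _"] have "J (T \<xi>) \<bullet> J \<eta> = T \<eta> \<bullet> \<xi>" for \<xi> \<eta>
    by (simp add: TJ JJ add_eq_0_iff)
  moreover have "J \<xi> \<bullet> J \<eta> = \<xi> \<bullet> \<eta>" for \<xi> \<eta>
  proof -
    have "cinner (J \<xi>) (J \<eta>) = \<i> * cnj \<i> * cinner \<xi> \<eta>"
      unfolding J_def by (metis cinner_commute cinner_cscale_left complex_cnj_mult mult.assoc mult.commute)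
    then show ?thesis by (simp flip: Re_cinner)
  qed
  ultimately show ?thesis by (simp add: symm_op_def inner_commute)
qed

lemma op_cscale_apply [simp]: "op_cscale c T \<xi> = c *\<^sub>C T \<xi>"
  by transfer simp

text \<open>In this form complex linearity passes, through the commutation lemmas, to everything
  built from an operator by the calculus.\<close>

lemma bounded_ops_iff_commute: "T \<in> bounded_ops \<longleftrightarrow> (\<forall>c. op_cscale c id_blinfun o\<^sub>L T = T o\<^sub>L op_cscale c id_blinfun)"
proof -
  have "op_cscale c id_blinfun o\<^sub>L T = T o\<^sub>L op_cscale c id_blinfun \<longleftrightarrow> (\<forall>\<xi>. c *\<^sub>C T \<xi> = T (c *\<^sub>C \<xi>))" for c
    unfolding blinfun_apply_inject[symmetric] fun_eq_iff by simp
  then show ?thesis unfolding bounded_ops_def mem_Collect_eq by metis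
qed

lemma spectral_measure_iff:
  "spectral_measure (borel :: 'a::topological_space measure) E \<longleftrightarrow>
    pvm E \<and> (\<forall>S\<in>sets borel. E S \<in> bounded_ops)"
proof
  assume "spectral_measure (borel :: 'a measure) E"
  then show "pvm E \<and> (\<forall>S\<in>sets borel. E S \<in> bounded_ops)"
    unfolding spectral_measure_def by (auto intro!: pvm.intro simp: is_adjoint_self_iff)
next
  assume "pvm E \<and> (\<forall>S\<in>sets borel. E S \<in> bounded_ops)"
  then interpret pvm E by simp
  show "spectral_measure borel E"
    using \<open>pvm E \<and> _\<close> Int[of S S for S] sums unfolding spectral_measure_def
    by (auto simp: is_adjoint_self_iff symm UNIV Int simp flip: Int)
qed

lemma scalar_measure_eq: "scalar_measure borel E = pvm_measure E"
  by (simp add: fun_eq_iff scalar_measure_def pvm_measure_def Re_cinner)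

text \<open>A quadratic form with real values forces the operator to be symmetric, so the complex
  condition reduces to the real calculus.\<close>

lemma is_spectral_integral_iff:
  "is_spectral_integral borel E g T \<longleftrightarrow> T \<in> bounded_ops \<and> symm_op T \<and>
    (\<forall>\<xi>. integrable (pvm_measure E \<xi>) g \<and> T \<xi> \<bullet> \<xi> = (\<integral>t. g t \<partial>pvm_measure E \<xi>))"
proof
  assume *: "is_spectral_integral borel E g T"
  then have T: "T \<in> bounded_ops" and q: "cinner (T \<xi>) \<xi> = of_real (\<integral>t. g t \<partial>pvm_measure E \<xi>)" for \<xi>
    by (auto simp: is_spectral_integral_def scalar_measure_eq)
  have "symm_op T" by (rule symm_of_real_cinner[OF T]) (simp add: q)
  with * T q show "T \<in> bounded_ops \<and> symm_op T \<and>
    (\<forall>\<xi>. integrable (pvm_measure E \<xi>) g \<and> T \<xi> \<bullet> \<xi> = (\<integral>t. g t \<partial>pvm_measure E \<xi>))"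
    by (auto simp: is_spectral_integral_def scalar_measure_eq simp flip: Re_cinner)
next
  assume "T \<in> bounded_ops \<and> symm_op T \<and>
    (\<forall>\<xi>. integrable (pvm_measure E \<xi>) g \<and> T \<xi> \<bullet> \<xi> = (\<integral>t. g t \<partial>pvm_measure E \<xi>))"
  then show "is_spectral_integral borel E g T"
    by (auto simp: is_spectral_integral_def scalar_measure_eq cinner_symm)
qed

text \<open>The spectral theorem supplies the witness that \<open>SOME\<close> calls for; complex
  linearity of its projections is commutation with the scalars.\<close>

lemma spectral_measure_of:
  assumes x: "x \<in> bounded_ops" "symm_op x"
  shows "pvm (spectral_measure_of x)" and "S \<in> sets borel \<Longrightarrow> spectral_measure_of x S \<in> bounded_ops"
    and "integrable (pvm_measure (spectral_measure_of x) \<xi>) (\<lambda>t. t)"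
    and "(\<integral>t. t \<partial>pvm_measure (spectral_measure_of x) \<xi>) = x \<xi> \<bullet> \<xi>"
proof -
  obtain E where E: "pvm E" "\<And>\<xi>. integrable (pvm_measure E \<xi>) (\<lambda>t. t)"
    "\<And>\<xi>. (\<integral>t. t \<partial>pvm_measure E \<xi>) = x \<xi> \<bullet> \<xi>"
    "\<And>S B. S o\<^sub>L x = x o\<^sub>L S \<Longrightarrow> B \<in> sets borel \<Longrightarrow> S o\<^sub>L E B = E B o\<^sub>L S"
    by (rule spectral_theorem_integrals[OF x(2)]) (rule that)
  have "E B \<in> bounded_ops" if "B \<in> sets borel" for B
    unfolding bounded_ops_iff_commute using E(4)[OF _ that] x(1) by (simp add: bounded_ops_iff_commute)
  then have "spectral_measure borel E \<and> is_spectral_integral borel E (\<lambda>t. t) x"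
    using E x by (simp add: spectral_measure_iff is_spectral_integral_iff)
  then have "spectral_measure borel (spectral_measure_of x) \<and>
      is_spectral_integral borel (spectral_measure_of x) (\<lambda>t. t) x"
    unfolding spectral_measure_of_def
    by (rule someI[of "\<lambda>E. spectral_measure borel E \<and> is_spectral_integral borel E (\<lambda>t. t) x"])
  then show "pvm (spectral_measure_of x)" "S \<in> sets borel \<Longrightarrow> spectral_measure_of x S \<in> bounded_ops"
    "integrable (pvm_measure (spectral_measure_of x) \<xi>) (\<lambda>t. t)"
    "(\<integral>t. t \<partial>pvm_measure (spectral_measure_of x) \<xi>) = x \<xi> \<bullet> \<xi>"
    by (auto simp: spectral_measure_iff is_spectral_integral_iff)
qed

text \<open>The box is a finite intersection of coordinate slabs, each with the identity as
  projection; a coordinate integral is an integral over an image measure.\<close>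

lemma pvm_marginal:
  fixes P :: "(real^'n) set \<Rightarrow> 'h::{real_inner,banach} \<Rightarrow>\<^sub>L 'h"
  assumes P: "pvm P" and marg: "\<And>i S. S \<in> sets borel \<Longrightarrow> P {v. v $ i \<in> S} = E i S"
    and E: "\<And>i. bpvm (E i) {a $ i..b $ i}" and J: "\<And>i. bpvm.J (E i) {a $ i..b $ i} (\<lambda>t. t) = x i"
  shows "bpvm P (cbox a b)" and "bpvm.J P (cbox a b) (\<lambda>v. v $ i) = x i"
proof -
  interpret P: pvm P by (rule P)
  have m: "{v. v $ i \<in> S} \<in> sets borel" if "S \<in> sets borel" for i and S :: "real set"
    using measurable_sets[OF borel_measurable_nth[of i], of S] that by (simp add: vimage_def)
  have "(\<Inter>i\<in>A. {v. v $ i \<in> {a $ i..b $ i}}) \<in> sets borel \<and> P (\<Inter>i\<in>A. {v. v $ i \<in> {a $ i..b $ i}}) = id_blinfun"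
    if "finite A" for A :: "'n set"
    using that
  proof induction
    case (insert i A)
    have "P {v. v $ i \<in> {a $ i..b $ i}} = id_blinfun"
      using bpvm.E_K[OF E] by (subst marg) auto
    moreover have "{v. v $ i \<in> {a $ i..b $ i}} \<in> sets borel" by (rule m) simp
    ultimately show ?case
      using insert P.Int[of "{v. v $ i \<in> {a $ i..b $ i}}" "\<Inter>i\<in>A. {v. v $ i \<in> {a $ i..b $ i}}"]
      by (simp add: sets.Int)
  qed (simp add: P.UNIV)
  from this[of UNIV] have "P (\<Inter>i. {v. v $ i \<in> {a $ i..b $ i}}) = id_blinfun" by simp
  moreover have "(\<Inter>i. {v. v $ i \<in> {a $ i..b $ i}}) = cbox a b" by (auto simp: mem_box_cart)
  ultimately have K: "P (cbox a b) = id_blinfun" by simp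
  then show "bpvm P (cbox a b)" using P by (simp add: bpvm_def bpvm_axioms_def)
  then interpret B: bpvm P "cbox a b" .
  interpret Ei: bpvm "E i" "{a $ i..b $ i}" by (rule E)
  have gi: "Ei.good (\<lambda>t. t)" by (rule Ei.good_continuous) (auto intro: continuous_intros)
  have "pvm_measure (E i) \<xi> = distr (pvm_measure P \<xi>) borel (\<lambda>v. v $ i)" for \<xi>
  proof (rule measure_eqI)
    show "emeasure (pvm_measure (E i) \<xi>) S = emeasure (distr (pvm_measure P \<xi>) borel (\<lambda>v. v $ i)) S"
      if "S \<in> sets (pvm_measure (E i) \<xi>)" for S
      using that marg[of S i] m[of S i]
      by (simp add: Ei.emeasure_measure P.emeasure_measure emeasure_distr vimage_def)
  qed simp
  note distr = this
  show "B.J (\<lambda>v. v $ i) = x i"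
  proof (rule B.J_eqI)
    show "symm_op (x i)" using Ei.J_symm[OF gi] J by simp
    fix \<xi>
    have "x i \<xi> \<bullet> \<xi> = (\<integral>t. t \<partial>pvm_measure (E i) \<xi>)"
      using Ei.J_quad[OF gi, of \<xi>] by (simp add: J Ei.quad_def Ei.indicator_support(2)[OF Ei.K_borel Ei.E_K])
    also have "\<dots> = (\<integral>v. v $ i \<partial>pvm_measure P \<xi>)"
      unfolding distr by (rule integral_distr) simp_all
    finally show "x i \<xi> \<bullet> \<xi> = B.quad (\<lambda>v. v $ i) \<xi>"
      by (simp add: B.quad_def P.indicator_support(2)[OF B.K_borel B.E_K])
  qed
qed

lemma cube_borel: "(\<And>i. is_interval (I i)) \<Longrightarrow> cube I \<in> sets (borel :: (real^'n::finite) measure)"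
proof -
  assume I: "\<And>i. is_interval (I i)"
  have "{v :: real^'n. v $ i \<in> I i} \<in> sets borel" for i
    using measurable_sets[OF borel_measurable_nth[of i] real_interval_borel_measurable[OF I[of i]]]
    by (simp add: vimage_def)
  then have "(\<Inter>i. {v :: real^'n. v $ i \<in> I i}) \<in> sets borel" by (intro sets.finite_INT) auto
  moreover have "(\<Inter>i. {v :: real^'n. v $ i \<in> I i}) = cube I" by (auto simp: cube_def)
  ultimately show ?thesis by simp
qed

text \<open>The bridge between the choice operators of the definitions and \<open>J\<close>.
  Whatever product measure \<open>SOME\<close> selects has the marginals \<open>E i\<close>, as is
  seen by taking the other factors to be the whole line. It is therefore supported by the box, which
  is compact even if the cube is not, so that \<open>f\<close> is bounded there.\<close>

lemma tuple_calculus: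
  fixes x :: "('h::complex_hilbert_space \<Rightarrow>\<^sub>L 'h)^'n::finite"
  assumes bo: "\<And>i. x $ i \<in> bounded_ops" and sy: "\<And>i. symm_op (x $ i)"
    and comm: "\<And>i j. x $ i o\<^sub>L x $ j = x $ j o\<^sub>L x $ i"
    and a: "\<And>i \<xi>. a $ i * (norm \<xi>)\<^sup>2 \<le> (x $ i) \<xi> \<bullet> \<xi>" and b: "\<And>i \<xi>. (x $ i) \<xi> \<bullet> \<xi> \<le> b $ i * (norm \<xi>)\<^sup>2"
  obtains P where "bpvm P (cbox a b)" "\<And>i. bpvm.J P (cbox a b) (\<lambda>v. v $ i) = x $ i"
    "\<And>f I. (\<And>i. is_interval (I i)) \<Longrightarrow> cbox a b \<subseteq> cube I \<Longrightarrow> continuous_on (cube I) f \<Longrightarrow>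
      fun_calc I f x = bpvm.J P (cbox a b) f"
proof -
  define E where "E i = spectral_measure_of (x $ i)" for i
  note sm = spectral_measure_of[OF bo sy, folded E_def]
  have EB: "bpvm (E i) {a $ i..b $ i}" and EJ: "bpvm.J (E i) {a $ i..b $ i} (\<lambda>t. t) = x $ i" for i
    using bpvm_Icc[OF sm(1) sy sm(3,4) a b] by auto
  have Ecomm: "S o\<^sub>L E i B = E i B o\<^sub>L S" if "S o\<^sub>L x $ i = x $ i o\<^sub>L S" "B \<in> sets borel" for S i B
    by (rule bpvm.E_commutes_with[OF EB]) (use that EJ in auto)
  have EE: "E i S o\<^sub>L E j T = E j T o\<^sub>L E i S" if "S \<in> sets borel" "T \<in> sets borel" for i j S T
    by (intro Ecomm that Ecomm[symmetric] comm)
  define Q where "Q P \<longleftrightarrow> spectral_measure borel P \<and> (\<forall>S. (\<forall>i. S i \<in> sets borel) \<longrightarrow>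
      (\<forall>is. distinct is \<and> set is = UNIV \<longrightarrow>
         P {v. \<forall>i. v $ i \<in> S i} = foldr (\<lambda>i T. E i (S i) o\<^sub>L T) is id_blinfun))" for P :: "(real^'n) set \<Rightarrow> 'h \<Rightarrow>\<^sub>L 'h"
  define r where "r i = \<bar>a $ i\<bar> + \<bar>b $ i\<bar>" for i
  have bounded: "P S \<in> bounded_ops" if "bpvm P (cbox a b)" "\<And>i. bpvm.J P (cbox a b) (\<lambda>v. v $ i) = x $ i" "S \<in> sets borel"
    for P S
    unfolding bounded_ops_iff_commute
  proof
    fix c
    interpret bpvm P "cbox a b" by fact
    show "op_cscale c id_blinfun o\<^sub>L P S = P S o\<^sub>L op_cscale c id_blinfun"
      by (rule E_commutes_with)
        (use that bo in \<open>auto simp: Basis_vec_def inner_axis bounded_ops_iff_commute\<close>)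
  qed
  have supp: "E i {- r i..r i} = id_blinfun" for i
  proof -
    interpret bpvm "E i" "{a $ i..b $ i}" by (rule EB)
    have "{a $ i..b $ i} \<inter> {- r i..r i} = {a $ i..b $ i}" by (auto simp: r_def)
    moreover have "E i ({a $ i..b $ i} \<inter> {- r i..r i}) = E i {a $ i..b $ i} o\<^sub>L E i {- r i..r i}"
      by (rule Int) auto
    ultimately show ?thesis by (simp only: E_K blinfun_compose_id)
  qed
  have "\<exists>P. Q P"
  proof (rule product_pvm[of E r])
    fix P :: "(real^'n) set \<Rightarrow> 'h \<Rightarrow>\<^sub>L 'h"
    assume P: "pvm P" and marg: "\<And>i S. S \<in> sets borel \<Longrightarrow> P {v. v $ i \<in> S} = E i S"
    interpret pvm P by (rule P)
    have m: "{v. v $ i \<in> S} \<in> sets borel" if "S \<in> sets borel" for i and S :: "real set"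
      using measurable_sets[OF borel_measurable_nth[of i], of S] that by (simp add: vimage_def)
    have sP: "spectral_measure borel P"
      unfolding spectral_measure_iff using P bounded[OF pvm_marginal[OF P marg EB EJ]] by blast
    have fold: "P {v. \<forall>i\<in>set is. v $ i \<in> S i} = foldr (\<lambda>i T. E i (S i) o\<^sub>L T) is id_blinfun \<and>
        {v. \<forall>i\<in>set is. v $ i \<in> S i} \<in> sets borel" if "\<And>i. S i \<in> sets borel" for S "is"
    proof (induction "is")
      case (Cons i js)
      have "{v. \<forall>i\<in>set (i # js). v $ i \<in> S i} = {v. v $ i \<in> S i} \<inter> {v. \<forall>i\<in>set js. v $ i \<in> S i}" by auto
      then show ?case using Cons m[OF that[of i], of i] marg[OF that[of i], of i]
        by (simp add: Int sets.Int)
    qed (simp add: UNIV)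
    have "P {v. \<forall>i. v $ i \<in> S i} = foldr (\<lambda>i T. E i (S i) o\<^sub>L T) is id_blinfun"
      if "\<forall>i. S i \<in> sets borel" "distinct is \<and> set is = UNIV" for S "is"
      using fold[of S "is"] that by simp
    with sP have "Q P" unfolding Q_def by blast
    then show "\<exists>P. Q P" by blast
  qed (use sm(1) supp EE in auto)
  then have "Q (product_spectral_measure E)"
    unfolding product_spectral_measure_def Q_def by (rule someI_ex)
  then obtain P where P: "Q P" "P = product_spectral_measure E" by blast
  have pP: "pvm P" and bP: "\<And>S. S \<in> sets borel \<Longrightarrow> P S \<in> bounded_ops"
    using P(1) by (auto simp: Q_def spectral_measure_iff)
  have marg: "P {v. v $ i \<in> S} = E i S" if S: "S \<in> sets borel" for i S
  proof -
    obtain js where js: "set js = UNIV - {i}" "distinct js" using finite_distinct_list[of "UNIV - {i}"] by auto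
    define S' where "S' j = (if j = i then S else UNIV)" for j
    have "foldr (\<lambda>i T. E i (S' i) o\<^sub>L T) ks id_blinfun = id_blinfun" if "i \<notin> set ks" for ks
      using that by (induction ks) (auto simp: S'_def pvm.UNIV[OF sm(1)])
    moreover have "P {v. \<forall>i. v $ i \<in> S' i} = foldr (\<lambda>i T. E i (S' i) o\<^sub>L T) (i # js) id_blinfun"
      by (rule P(1)[unfolded Q_def, THEN conjunct2, rule_format]) (use js S in \<open>auto simp: S'_def\<close>)
    moreover have "{v :: real^'n. \<forall>i. v $ i \<in> S' i} = {v. v $ i \<in> S}" by (auto simp: S'_def)
    ultimately show ?thesis using js by (simp add: S'_def)
  qed
  note B = pvm_marginal[OF pP marg EB EJ]
  interpret bpvm P "cbox a b" by (rule B(1))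
  have "fun_calc I f x = J f"
    if I: "\<And>i. is_interval (I i)" and sub: "cbox a b \<subseteq> cube I" and f: "continuous_on (cube I) f" for I f
  proof -
    have g: "good f" by (rule good_continuous) (use continuous_on_subset[OF f sub] in auto)
    have m: "(\<lambda>v. indicat_real (cube I) v * f v) \<in> borel_measurable borel"
      using borel_measurable_continuous_on_indicator[OF cube_borel[OF I] f] by simp
    have eq: "indicat_real (cbox a b) v * (indicat_real (cube I) v * f v) = indicat_real (cbox a b) v * f v" for v
      using sub by (auto simp: indicator_def)
    have int: "integrable (pvm_measure P \<xi>) (\<lambda>v. indicat_real (cube I) v * f v)"
      and q: "(\<integral>v. indicat_real (cube I) v * f v \<partial>pvm_measure P \<xi>) = quad f \<xi>" for \<xi>
      using indicator_support[OF K_borel E_K m, of \<xi>] integrable_good[OF g, of \<xi>] by (simp_all add: eq quad_def)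
    have "J f \<in> bounded_ops"
      unfolding bounded_ops_iff_commute
    proof
      show "op_cscale c id_blinfun o\<^sub>L J f = J f o\<^sub>L op_cscale c id_blinfun" for c
        by (rule J_commutes_with[OF _ g]) (use bP in \<open>simp add: bounded_ops_iff_commute\<close>)
    qed
    then show ?thesis
      unfolding fun_calc_def E_def[symmetric, abs_def] P(2)[symmetric]
      by (intro the_equality) (auto simp: is_spectral_integral_iff J_symm[OF g] J_quad[OF g] int q intro: J_eqI[symmetric])
  qed
  with B that show ?thesis by blast
qed

section \<open>Spectra and bounds of quadratic forms\<close>

lemma bounded_ops_id [simp]: "id_blinfun \<in> bounded_ops"
  by (simp add: bounded_ops_def)

lemma bounded_ops_add: "S \<in> bounded_ops \<Longrightarrow> T \<in> bounded_ops \<Longrightarrow> S + T \<in> bounded_ops"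
  and bounded_ops_comp: "S \<in> bounded_ops \<Longrightarrow> T \<in> bounded_ops \<Longrightarrow> S o\<^sub>L T \<in> bounded_ops"
  by (simp_all add: bounded_ops_def blinfun.add_left cscale_add_right)

lemma op_cscale_of_real: "op_cscale (of_real r) T = r *\<^sub>R T"
  by (rule blinfun_eqI) (simp add: cscale_of_real blinfun.scaleR_left)

lemma bounded_ops_op_cscale: "T \<in> bounded_ops \<Longrightarrow> op_cscale c T \<in> bounded_ops"
  by (simp add: bounded_ops_def cscale_cscale mult.commute)

lemma (in bpvm) J_commutes_with_generator:
  fixes S :: "'h \<Rightarrow>\<^sub>L 'h"
  assumes K: "compact K" and S: "\<And>b. b \<in> Basis \<Longrightarrow> S o\<^sub>L J (\<lambda>t. t \<bullet> b) = J (\<lambda>t. t \<bullet> b) o\<^sub>L S" and g: "good g"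
  shows "S o\<^sub>L J g = J g o\<^sub>L S"
  by (rule J_commutes_with[OF E_commutes_with[OF K S] g])

text \<open>For \<open>c\<close> outside the interval the inverse of \<open>T - c\<close> is written
  down: \<open>1 / (t - c)\<close> has real part \<open>g1\<close> and imaginary part
  \<open>g2\<close>. They are integrated separately, because \<open>J\<close> takes real functions,
  and recombined with the operator \<open>\<ii>\<close>.\<close>

lemma spectrum_subset_Icc:
  fixes T :: "'h::complex_hilbert_space \<Rightarrow>\<^sub>L 'h"
  assumes T: "T \<in> bounded_ops" "symm_op T"
    and a: "\<And>\<xi>. a * (norm \<xi>)\<^sup>2 \<le> T \<xi> \<bullet> \<xi>" and b: "\<And>\<xi>. T \<xi> \<bullet> \<xi> \<le> b * (norm \<xi>)\<^sup>2"
  shows "spectrum T \<subseteq> of_real ` {a..b}"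
proof
  fix c assume c: "c \<in> spectrum T"
  show "c \<in> of_real ` {a..b}"
  proof (rule ccontr)
    assume "c \<notin> of_real ` {a..b}"
    then have out: "Im c \<noteq> 0 \<or> Re c \<notin> {a..b}"
      by (metis complex_is_Real_iff image_eqI of_real_Re)
    obtain E where "bpvm E {a..b}" and JT: "bpvm.J E {a..b} (\<lambda>t. t) = T"
      by (rule spectral_theorem_Icc[OF T(2) a b])
    then interpret bpvm E "{a..b}" by simp
    define \<ii> where "\<ii> = op_cscale \<i> (id_blinfun :: 'h \<Rightarrow>\<^sub>L 'h)"
    define d where "d t = (t - Re c)\<^sup>2 + (Im c)\<^sup>2" for t
    have d: "d t \<noteq> 0" if "t \<in> {a..b}" for t
      using out that by (auto simp: d_def sum_power2_eq_zero_iff)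
    define h g1 g2 where "h t = t - Re c" and "g1 t = (t - Re c) / d t" and "g2 t = Im c / d t" for t
    have dc: "continuous_on {a..b} d" unfolding d_def by (intro continuous_intros)
    have good: "good h" "good g1" "good g2" "good (\<lambda>t. t)"
      unfolding h_def g1_def g2_def
      by (rule good_continuous[OF compact_Icc], (intro continuous_intros dc ballI d | assumption)+)+
    have ii: "\<ii> o\<^sub>L \<ii> = - id_blinfun"
      by (rule blinfun_eqI)
        (simp add: \<ii>_def cscale_cscale blinfun.minus_left, metis cscale_of_real of_real_1 of_real_minus scaleR_minus1_left)
    have JB: "op_cscale z id_blinfun o\<^sub>L J g = J g o\<^sub>L op_cscale z id_blinfun" if "good g" for g z
      by (rule J_commutes_with_generator) (use that JT T in \<open>auto simp: bounded_ops_iff_commute\<close>)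
    then have bo: "J g \<in> bounded_ops" if "good g" for g using that by (simp add: bounded_ops_iff_commute)
    have comm: "J g o\<^sub>L \<ii> = \<ii> o\<^sub>L J g" if "good g" for g using JB[OF that, of \<i>] by (simp add: \<ii>_def)
    define S where "S = J g1 + (\<ii> o\<^sub>L J g2)"
    have "T - op_cscale c id_blinfun = J h - Im c *\<^sub>R \<ii>"
    proof (rule blinfun_eqI)
      fix \<xi> :: 'h
      have "c *\<^sub>C \<xi> = (of_real (Re c) + of_real (Im c) * \<i>) *\<^sub>C \<xi>"
        by (metis complex_eq mult.commute)
      also have "\<dots> = Re c *\<^sub>R \<xi> + Im c *\<^sub>R \<i> *\<^sub>C \<xi>"
        by (simp add: cscale_add_left cscale_of_real flip: cscale_cscale)
      finally have "c *\<^sub>C \<xi> = Re c *\<^sub>R \<xi> + Im c *\<^sub>R \<i> *\<^sub>C \<xi>" .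
      moreover have "J h = T - Re c *\<^sub>R id_blinfun"
        unfolding h_def using good by (simp add: J_diff good_const J_const JT)
      ultimately show "(T - op_cscale c id_blinfun) \<xi> = (J h - Im c *\<^sub>R \<ii>) \<xi>"
        by (simp add: \<ii>_def blinfun.diff_left blinfun.scaleR_left)
    qed
    note W = this
    have mult: "J (\<lambda>t. g1 t * h t + Im c * g2 t) = (J g1 o\<^sub>L J h) + Im c *\<^sub>R J g2"
      "J (\<lambda>t. g2 t * h t - Im c * g1 t) = (J g2 o\<^sub>L J h) - Im c *\<^sub>R J g1"
      using good by (simp_all add: J_add J_diff J_scale J_mult good_mult good_scale)
    have "J (\<lambda>t. g1 t * h t + Im c * g2 t) = J (\<lambda>_. 1)"
    proof (rule J_cong)
      fix t assume "t \<in> {a..b}"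
      then have "d t \<noteq> 0" by (rule d)
      then show "g1 t * h t + Im c * g2 t = 1"
        by (simp add: g1_def g2_def h_def flip: add_divide_distrib) (simp add: d_def power2_eq_square)
    qed
    moreover have "J (\<lambda>t. g2 t * h t - Im c * g1 t) = J (\<lambda>_. 0)"
      by (rule J_cong) (simp add: g1_def g2_def h_def)
    ultimately have r: "(J g1 o\<^sub>L J h) + Im c *\<^sub>R J g2 = id_blinfun" "(J g2 o\<^sub>L J h) = Im c *\<^sub>R J g1"
      unfolding mult by (simp_all add: J_const)
    have gg: "J h o\<^sub>L J g1 = J g1 o\<^sub>L J h" "J h o\<^sub>L J g2 = J g2 o\<^sub>L J h"
      using good by (simp_all add: J_commute)
    have "S o\<^sub>L (J h - Im c *\<^sub>R \<ii>)
        = (J g1 o\<^sub>L J h) - Im c *\<^sub>R (J g1 o\<^sub>L \<ii>) + (\<ii> o\<^sub>L (J g2 o\<^sub>L J h)) - Im c *\<^sub>R (\<ii> o\<^sub>L (J g2 o\<^sub>L \<ii>))"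
      by (simp add: S_def blinfun_compose_simps blinfun_compose_assoc algebra_simps)
    also have "\<ii> o\<^sub>L (J g2 o\<^sub>L \<ii>) = - J g2"
      unfolding comm[OF good(3)] by (simp add: ii blinfun_compose_simps flip: blinfun_compose_assoc)
    also have "(J g1 o\<^sub>L J h) - Im c *\<^sub>R (J g1 o\<^sub>L \<ii>) + (\<ii> o\<^sub>L (J g2 o\<^sub>L J h)) - Im c *\<^sub>R (- J g2) = id_blinfun"
      using r(1) by (simp add: r(2) comm good blinfun_compose_simps)
    finally have 1: "S o\<^sub>L (J h - Im c *\<^sub>R \<ii>) = id_blinfun" .
    have "\<ii> o\<^sub>L J h = J h o\<^sub>L \<ii>" using comm[OF good(1)] by simp
    then have "(\<ii> o\<^sub>L J g2) o\<^sub>L J h = J h o\<^sub>L (\<ii> o\<^sub>L J g2)"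
      by (metis blinfun_compose_assoc gg(2))
    then have "S o\<^sub>L J h = J h o\<^sub>L S"
      by (simp only: S_def blinfun_compose_simps gg)
    moreover have "S o\<^sub>L \<ii> = \<ii> o\<^sub>L S"
      using comm good by (simp add: S_def blinfun_compose_simps blinfun_compose_assoc)
    ultimately have 2: "(J h - Im c *\<^sub>R \<ii>) o\<^sub>L S = id_blinfun"
      using 1 by (simp add: blinfun_compose_simps)
    have "S \<in> bounded_ops"
      using good by (auto simp: S_def \<ii>_def intro!: bounded_ops_add bounded_ops_comp bo bounded_ops_op_cscale)
    with 1 2 c show False by (auto simp: spectrum_def W)
  qed
qed

text \<open>A small quadratic form means a small image under a positive operator
  (\<open>pos_op_norm_le\<close>), which a left inverse forbids for unit vectors.\<close>

lemma not_left_invertible: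
  fixes W :: "'h::real_inner \<Rightarrow>\<^sub>L 'h"
  assumes W: "pos_op W" and small: "\<And>e. 0 < e \<Longrightarrow> \<exists>\<xi>. norm \<xi> = 1 \<and> W \<xi> \<bullet> \<xi> < e"
  shows "S o\<^sub>L W \<noteq> id_blinfun"
proof
  assume SW: "S o\<^sub>L W = id_blinfun"
  define C where "C = (norm S)\<^sup>2 * norm W + 1"
  have C: "0 < C" by (simp add: C_def add_nonneg_pos)
  obtain \<xi> where \<xi>: "norm \<xi> = 1" "W \<xi> \<bullet> \<xi> < 1 / C" using small[of "1 / C"] C by auto
  have "W \<eta> \<bullet> \<eta> \<le> norm W * (norm \<eta>)\<^sup>2" for \<eta> using inner_op_le[of W \<eta>] by linarith
  then have le: "(norm (W \<xi>))\<^sup>2 \<le> norm W * (W \<xi> \<bullet> \<xi>)" by (rule pos_op_norm_le[OF W])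
  have "\<xi> = S (W \<xi>)" using SW by (metis blinfun_apply_blinfun_compose blinfun_apply_id_blinfun id_apply)
  then have "1 \<le> norm S * norm (W \<xi>)" using norm_blinfun[of S "W \<xi>"] \<xi>(1) by simp
  then have "1 \<le> (norm S * norm (W \<xi>))\<^sup>2" by simp
  also have "\<dots> \<le> (norm S)\<^sup>2 * (norm W * (W \<xi> \<bullet> \<xi>))"
    unfolding power_mult_distrib by (intro mult_left_mono le) simp
  also have "\<dots> \<le> C * (W \<xi> \<bullet> \<xi>)" using pos_opD[OF W, of \<xi>] by (simp add: C_def algebra_simps)
  also have "\<dots> < C * (1 / C)" by (intro mult_strict_left_mono \<xi> C)
  finally show False using C by simp
qed

text \<open>The infimum and supremum of the quadratic form on the unit sphere belong to the
  spectrum, so they lie in \<open>I\<close> itself even if \<open>I\<close> is not closed. The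
  nonzero vector keeps the sphere nonempty; on the zero space the spectrum is empty.\<close>

lemma spectrum_bounds:
  fixes T :: "'h::complex_hilbert_space \<Rightarrow>\<^sub>L 'h"
  assumes T: "symm_op T" and sp: "spectrum T \<subseteq> of_real ` I" and nt: "(\<zeta>::'h) \<noteq> 0"
  obtains a b where "a \<in> I" "b \<in> I" "\<And>\<xi>. a * (norm \<xi>)\<^sup>2 \<le> T \<xi> \<bullet> \<xi>" "\<And>\<xi>. T \<xi> \<bullet> \<xi> \<le> b * (norm \<xi>)\<^sup>2"
proof -
  define Q where "Q = {T \<xi> \<bullet> \<xi> | \<xi>. norm \<xi> = 1}"
  have bd: "\<bar>q\<bar> \<le> norm T" if "q \<in> Q" for q
  proof -
    obtain \<xi> where "q = T \<xi> \<bullet> \<xi>" "norm \<xi> = 1" using \<open>q \<in> Q\<close> by (auto simp: Q_def)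
    then show ?thesis using inner_op_le[of T \<xi>] by simp
  qed
  have ne: "Q \<noteq> {}" using nt by (auto simp: Q_def intro!: exI[of _ "\<zeta> /\<^sub>R norm \<zeta>"])
  have bb: "bdd_below Q" "bdd_above Q"
    using bd by (auto intro!: bdd_belowI[of _ "- norm T"] bdd_aboveI[of _ "norm T"] simp: abs_le_iff) fastforce
  have scale: "T \<xi> \<bullet> \<xi> / (norm \<xi>)\<^sup>2 \<in> Q" if "\<xi> \<noteq> 0" for \<xi>
    unfolding Q_def using that
    by (intro CollectI exI[of _ "\<xi> /\<^sub>R norm \<xi>"])
      (simp add: blinfun.scaleR_right power2_eq_square field_simps)
  define a b where "a = Inf Q" and "b = Sup Q"
  have a: "a * (norm \<xi>)\<^sup>2 \<le> T \<xi> \<bullet> \<xi>" for \<xi>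
  proof (cases "\<xi> = 0")
    case False
    then have "a \<le> T \<xi> \<bullet> \<xi> / (norm \<xi>)\<^sup>2" unfolding a_def by (intro cInf_lower scale bb)
    with False show ?thesis by (simp add: field_simps)
  qed simp
  have b: "T \<xi> \<bullet> \<xi> \<le> b * (norm \<xi>)\<^sup>2" for \<xi>
  proof (cases "\<xi> = 0")
    case False
    then have "T \<xi> \<bullet> \<xi> / (norm \<xi>)\<^sup>2 \<le> b" unfolding b_def by (intro cSup_upper scale bb)
    with False show ?thesis by (simp add: field_simps)
  qed simp
  have "of_real a \<in> spectrum T"
  proof -
    have "pos_op (T - a *\<^sub>R id_blinfun)"
      using a T by (simp add: pos_op_def symm_op_diff symm_op_scaleR blinfun.diff_left blinfun.scaleR_left inner_diff_left power2_norm_eq_inner)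
    moreover have "\<exists>\<xi>. norm \<xi> = 1 \<and> (T - a *\<^sub>R id_blinfun) \<xi> \<bullet> \<xi> < e" if e: "0 < e" for e
    proof -
      obtain q where "q \<in> Q" "q < a + e" using cInf_lessD[OF ne, of "a + e"] e by (auto simp: a_def)
      then show ?thesis
        by (auto simp: Q_def blinfun.diff_left blinfun.scaleR_left inner_diff_left norm_eq_1)
    qed
    ultimately have "S o\<^sub>L (T - a *\<^sub>R id_blinfun) \<noteq> id_blinfun" for S by (rule not_left_invertible)
    then show ?thesis by (simp add: spectrum_def op_cscale_of_real)
  qed
  then have "a \<in> I" using sp by auto
  have "of_real b \<in> spectrum T"
  proof -
    have "pos_op (b *\<^sub>R id_blinfun - T)"
      using b T by (simp add: pos_op_def symm_op_diff symm_op_scaleR blinfun.diff_left blinfun.scaleR_left inner_diff_left power2_norm_eq_inner)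
    moreover have "\<exists>\<xi>. norm \<xi> = 1 \<and> (b *\<^sub>R id_blinfun - T) \<xi> \<bullet> \<xi> < e" if e: "0 < e" for e
    proof -
      obtain q where "q \<in> Q" "b - e < q" using less_cSupD[OF ne, of "b - e"] e by (auto simp: b_def)
      then show ?thesis
        by (auto simp: Q_def blinfun.diff_left blinfun.scaleR_left inner_diff_left norm_eq_1)
    qed
    ultimately have inv: "S o\<^sub>L (b *\<^sub>R id_blinfun - T) \<noteq> id_blinfun" for S by (rule not_left_invertible)
    have "S o\<^sub>L (T - b *\<^sub>R id_blinfun) \<noteq> id_blinfun" for S
      using inv[of "- S"] by (simp add: blinfun_compose_simps)
    then show ?thesis by (simp add: spectrum_def op_cscale_of_real)
  qed
  then have "b \<in> I" using sp by auto
  with \<open>a \<in> I\<close> show ?thesis using that a b by blast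
qed

text \<open>Replaces the spectral condition by bounds that visibly pass to convex
  combinations.\<close>

lemma sa_part_iff:
  fixes T :: "'h::complex_hilbert_space \<Rightarrow>\<^sub>L 'h"
  assumes A: "A \<subseteq> bounded_ops" and I: "is_interval I" and nt: "(\<zeta>::'h) \<noteq> 0"
  shows "T \<in> sa_part A I \<longleftrightarrow> T \<in> A \<and> symm_op T \<and>
    (\<exists>a\<in>I. \<exists>b\<in>I. \<forall>\<xi>. a * (norm \<xi>)\<^sup>2 \<le> T \<xi> \<bullet> \<xi> \<and> T \<xi> \<bullet> \<xi> \<le> b * (norm \<xi>)\<^sup>2)"
proof
  assume T: "T \<in> sa_part A I"
  then have T': "symm_op T" "T \<in> A" "spectrum T \<subseteq> of_real ` I"
    using A is_adjoint_self_iff[of T] by (auto simp: sa_part_def)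
  obtain a b where "a \<in> I" "b \<in> I"
    "\<And>\<xi>. a * (norm \<xi>)\<^sup>2 \<le> T \<xi> \<bullet> \<xi>" "\<And>\<xi>. T \<xi> \<bullet> \<xi> \<le> b * (norm \<xi>)\<^sup>2"
    by (rule spectrum_bounds[OF T'(1,3) nt]) (rule that)
  then show "T \<in> A \<and> symm_op T \<and>
    (\<exists>a\<in>I. \<exists>b\<in>I. \<forall>\<xi>. a * (norm \<xi>)\<^sup>2 \<le> T \<xi> \<bullet> \<xi> \<and> T \<xi> \<bullet> \<xi> \<le> b * (norm \<xi>)\<^sup>2)"
    using T' by (intro conjI bexI[of _ a] bexI[of _ b] allI) simp_all
next
  assume T: "T \<in> A \<and> symm_op T \<and>
    (\<exists>a\<in>I. \<exists>b\<in>I. \<forall>\<xi>. a * (norm \<xi>)\<^sup>2 \<le> T \<xi> \<bullet> \<xi> \<and> T \<xi> \<bullet> \<xi> \<le> b * (norm \<xi>)\<^sup>2)"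
  then obtain a b where ab: "a \<in> I" "b \<in> I"
    "\<forall>\<xi>. a * (norm \<xi>)\<^sup>2 \<le> T \<xi> \<bullet> \<xi> \<and> T \<xi> \<bullet> \<xi> \<le> b * (norm \<xi>)\<^sup>2" by (elim conjE bexE)
  have "spectrum T \<subseteq> of_real ` {a..b}"
    by (rule spectrum_subset_Icc) (use T A ab in auto)
  moreover have "{a..b} \<subseteq> I" by (auto intro: mem_is_interval_1_I[OF I ab(1,2)])
  ultimately have "spectrum T \<subseteq> of_real ` I" by blast
  then show "T \<in> sa_part A I" using T A is_adjoint_self_iff[of T] by (auto simp: sa_part_def)
qed

section \<open>Affine minorants of convex functions\<close>

lemma affine_minorant:
  fixes f :: "'a::euclidean_space \<Rightarrow> real"
  assumes L: "compact L" and f: "convex_on L f" "continuous_on L f" and t: "t \<in> L" and e: "0 < e"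
  obtains c w where "\<And>s. s \<in> L \<Longrightarrow> c + w \<bullet> s \<le> f s" "f t - e < c + w \<bullet> t"
proof -
  have "closed ((L \<times> UNIV) \<inter> (\<lambda>z. snd z - f (fst z)) -` {0..})"
    by (intro continuous_closed_preimage continuous_intros continuous_on_compose2[OF f(2)] closed_Times
        compact_imp_closed[OF L]) auto
  also have "(L \<times> UNIV) \<inter> (\<lambda>z. snd z - f (fst z)) -` {0..} = epigraph L f"
    by (auto simp: epigraph_def)
  finally have "closed (epigraph L f)" .
  moreover have "convex (epigraph L f)" using f(1) by (simp add: convex_epigraph convex_on_imp_convex)
  moreover have "(t, f t - e) \<notin> epigraph L f" using e by (simp add: epigraph_def)
  ultimately obtain p \<beta> where p: "p \<bullet> (t, f t - e) < \<beta>" "\<forall>z\<in>epigraph L f. \<beta> < p \<bullet> z"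
    using separating_hyperplane_closed_point by blast
  obtain w \<alpha> where [simp]: "p = (w, \<alpha>)" by (cases p)
  have sep: "\<beta> < w \<bullet> s + \<alpha> * f s" if "s \<in> L" for s
    using p(2) that by (auto simp: epigraph_def)
  have "\<alpha> * (f t - e) < \<alpha> * f t" using p(1) sep[OF t] by simp
  then have \<alpha>: "0 < \<alpha>" using e by (simp add: algebra_simps zero_less_mult_iff)
  show ?thesis
  proof (rule that)
    show "\<beta> / \<alpha> + (- (1 / \<alpha>) *\<^sub>R w) \<bullet> s \<le> f s" if "s \<in> L" for s
      using sep[OF that] \<alpha> by (simp add: field_simps)
    show "f t - e < \<beta> / \<alpha> + (- (1 / \<alpha>) *\<^sub>R w) \<bullet> t"
      using p(1) \<alpha> by (simp add: field_simps)
  qed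
qed

text \<open>Each minorant is within \<open>e\<close> of \<open>f\<close> on a relatively open set;
  compactness leaves finitely many.\<close>

lemma finite_affine_minorants:
  fixes f :: "'a::euclidean_space \<Rightarrow> real"
  assumes L: "compact L" and f: "convex_on L f" "continuous_on L f" and e: "0 < e"
  obtains \<Lambda> :: "(real \<times> 'a) set" where "finite \<Lambda>"
    "\<And>c w s. (c, w) \<in> \<Lambda> \<Longrightarrow> s \<in> L \<Longrightarrow> c + w \<bullet> s \<le> f s"
    "\<And>t. t \<in> L \<Longrightarrow> \<exists>(c, w)\<in>\<Lambda>. f t - e < c + w \<bullet> t"
proof -
  define M where "M = {(c, w). \<forall>s\<in>L. c + w \<bullet> s \<le> f s}"
  define U where "U \<mu> = {t \<in> L. f t - e < fst \<mu> + snd \<mu> \<bullet> t}" for \<mu> :: "real \<times> 'a"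
  have "openin (top_of_set L) (U \<mu>)" for \<mu>
  proof -
    have "openin (top_of_set L) (L \<inter> (\<lambda>t. fst \<mu> + snd \<mu> \<bullet> t - f t) -` {- e<..})"
      by (intro continuous_openin_preimage_gen continuous_intros f)
    moreover have "L \<inter> (\<lambda>t. fst \<mu> + snd \<mu> \<bullet> t - f t) -` {- e<..} = U \<mu>"
      by (auto simp: U_def)
    ultimately show ?thesis by simp
  qed
  then have "\<forall>\<mu>. \<exists>V. open V \<and> U \<mu> = L \<inter> V" by (simp add: openin_open)
  then obtain V where V: "\<And>\<mu>. open (V \<mu>)" "\<And>\<mu>. U \<mu> = L \<inter> V \<mu>" by metis
  have "L \<subseteq> (\<Union>\<mu>\<in>M. V \<mu>)"
  proof
    fix t assume t: "t \<in> L"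
    obtain c w where "\<And>s. s \<in> L \<Longrightarrow> c + w \<bullet> s \<le> f s" "f t - e < c + w \<bullet> t"
      by (rule affine_minorant[OF L f t e]) (rule that)
    then have "(c, w) \<in> M" "t \<in> U (c, w)" using t by (auto simp: M_def U_def)
    then show "t \<in> (\<Union>\<mu>\<in>M. V \<mu>)" using V(2) by blast
  qed
  then obtain \<Lambda> where \<Lambda>: "\<Lambda> \<subseteq> M" "finite \<Lambda>" "L \<subseteq> (\<Union>\<mu>\<in>\<Lambda>. V \<mu>)"
    using compactE_image[OF L, of M V] V(1) by metis
  show ?thesis
  proof (rule that[OF \<Lambda>(2)])
    show "c + w \<bullet> s \<le> f s" if "(c, w) \<in> \<Lambda>" "s \<in> L" for c w s using \<Lambda>(1) that by (auto simp: M_def)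
    show "\<exists>(c, w)\<in>\<Lambda>. f t - e < c + w \<bullet> t" if t: "t \<in> L" for t
    proof -
      obtain \<mu> where "\<mu> \<in> \<Lambda>" "t \<in> V \<mu>" using \<Lambda>(3) t by blast
      then have "t \<in> U \<mu>" using V(2) t by blast
      with \<open>\<mu> \<in> \<Lambda>\<close> show ?thesis by (intro bexI[of _ \<mu>]) (auto simp: U_def split_beta)
    qed
  qed
qed

section \<open>Traces\<close>

locale cstar =
  fixes A :: "('h::complex_hilbert_space \<Rightarrow>\<^sub>L 'h) set"
  assumes cstar: "cstar_algebra A"
begin

lemma A_bounded_ops: "A \<subseteq> bounded_ops" and A_closed: "closed A" and A_zero: "0 \<in> A"
  and A_add: "a \<in> A \<Longrightarrow> b \<in> A \<Longrightarrow> a + b \<in> A"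
  and A_comp: "a \<in> A \<Longrightarrow> b \<in> A \<Longrightarrow> a o\<^sub>L b \<in> A"
  using cstar by (auto simp: cstar_algebra_def)

lemma A_scaleR: "a \<in> A \<Longrightarrow> r *\<^sub>R a \<in> A"
  using cstar by (auto simp: cstar_algebra_def simp flip: op_cscale_of_real)

lemma A_diff: "a \<in> A \<Longrightarrow> b \<in> A \<Longrightarrow> a - b \<in> A"
  using A_add[OF _ A_scaleR[of b "-1"], of a] by simp

lemma A_sum: "(\<And>i. i \<in> S \<Longrightarrow> a i \<in> A) \<Longrightarrow> (\<Sum>i\<in>S. a i) \<in> A"
  by (induction S rule: infinite_finite_induct) (auto intro: A_zero A_add)

lemma pos_part_iff: "a \<in> pos_part A \<longleftrightarrow> a \<in> A \<and> pos_op a"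
  using A_bounded_ops is_adjoint_self_iff[of a] by (auto simp: pos_part_def pos_op_def Re_cinner)

lemma J_mem:
  fixes P :: "'a::euclidean_space set \<Rightarrow> 'h \<Rightarrow>\<^sub>L 'h"
  assumes "bpvm P K" "compact K" "continuous_on K g" "\<And>b. b \<in> Basis \<Longrightarrow> bpvm.J P K (\<lambda>t. t \<bullet> b) \<in> A"
    "id_blinfun \<in> A \<or> 0 \<in> K \<and> g 0 = 0"
  shows "bpvm.J P K g \<in> A"
  by (rule bpvm.J_continuous_mem[OF assms(1-3) A_closed]) (use assms A_add A_scaleR A_comp in auto)

lemma real_calculus:
  assumes a: "a \<in> A" "symm_op a"
  obtains E where "bpvm E {- norm a..norm a}" "bpvm.J E {- norm a..norm a} (\<lambda>t. t) = a"
    "\<And>g. continuous_on UNIV g \<Longrightarrow> g 0 = 0 \<Longrightarrow> bpvm.J E {- norm a..norm a} g \<in> A"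
proof -
  have b: "- norm a * (norm \<xi>)\<^sup>2 \<le> a \<xi> \<bullet> \<xi>" "a \<xi> \<bullet> \<xi> \<le> norm a * (norm \<xi>)\<^sup>2" for \<xi>
    using inner_op_le[of a \<xi>] by auto
  obtain E where E: "bpvm E {- norm a..norm a}" "bpvm.J E {- norm a..norm a} (\<lambda>t. t) = a"
    by (rule spectral_theorem_Icc[OF a(2) b]) (rule that)
  have "bpvm.J E {- norm a..norm a} g \<in> A" if "continuous_on UNIV g" "g 0 = 0" for g
    by (rule J_mem[OF E(1)]) (use E(2) a that continuous_on_subset in auto)
  with E that show ?thesis by blast
qed

text \<open>The norm bounds will make finite traces Lipschitz on positive elements.\<close>

lemma pos_neg_parts:
  assumes a: "a \<in> A" "symm_op a"
  obtains p q where "p \<in> pos_part A" "q \<in> pos_part A" "a = p - q" "norm p \<le> norm a" "norm q \<le> norm a"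
proof -
  obtain E where E: "bpvm E {- norm a..norm a}" "bpvm.J E {- norm a..norm a} (\<lambda>t. t) = a"
    "\<And>g. continuous_on UNIV g \<Longrightarrow> g 0 = 0 \<Longrightarrow> bpvm.J E {- norm a..norm a} g \<in> A"
    by (rule real_calculus[OF a]) (rule that)
  interpret bpvm E "{- norm a..norm a}" by (rule E)
  have c: "continuous_on UNIV (\<lambda>t::real. max 0 t)" "continuous_on UNIV (\<lambda>t::real. max 0 (- t))"
    by (intro continuous_intros)+
  have g: "good (\<lambda>t. max 0 t)" "good (\<lambda>t. max 0 (- t))"
    by (intro good_continuous continuous_on_subset[OF c(1)] continuous_on_subset[OF c(2)]; simp)+
  have "J (\<lambda>t. t) = J (\<lambda>t. max 0 t - max 0 (- t))"
    by (rule J_cong) auto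
  also have "\<dots> = J (\<lambda>t. max 0 t) - J (\<lambda>t. max 0 (- t))" by (rule J_diff[OF g])
  finally have "a = J (\<lambda>t. max 0 t) - J (\<lambda>t. max 0 (- t))" by (simp only: E(2))
  note eq = this
  have "J (\<lambda>t. max 0 t) \<in> pos_part A" "J (\<lambda>t. max 0 (- t)) \<in> pos_part A"
    unfolding pos_part_iff using c by (auto intro!: E(3) J_pos g)
  moreover note eq
  moreover have "norm (J (\<lambda>t. max 0 t)) \<le> norm a" "norm (J (\<lambda>t. max 0 (- t))) \<le> norm a"
    by (auto intro!: J_norm_le g)
  ultimately show ?thesis by (rule that)
qed

text \<open>The square root function vanishes at \<open>0\<close>, so the root stays in
  \<open>A\<close> even without a unit.\<close>

lemma pos_sqrt:
  assumes a: "a \<in> A" "pos_op a"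
  obtains b where "b \<in> A" "symm_op b" "b o\<^sub>L b = a"
proof -
  have b: "0 * (norm \<xi>)\<^sup>2 \<le> a \<xi> \<bullet> \<xi>" "a \<xi> \<bullet> \<xi> \<le> norm a * (norm \<xi>)\<^sup>2" for \<xi>
    using inner_op_le[of a \<xi>] pos_opD[OF a(2), of \<xi>] by auto
  obtain E where E: "bpvm E {0..norm a}" "bpvm.J E {0..norm a} (\<lambda>t. t) = a"
    by (rule spectral_theorem_Icc[OF pos_op_symm[OF a(2)] b]) (rule that)
  interpret bpvm E "{0..norm a}" by (rule E)
  have c: "continuous_on {0..norm a} sqrt" by (intro continuous_intros)
  have g: "good sqrt" by (rule good_continuous) (use c in auto)
  have "J sqrt \<in> A" by (rule J_mem[OF E(1)]) (use c E(2) a in auto)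
  moreover have "J sqrt o\<^sub>L J sqrt = a"
  proof -
    have "J (\<lambda>t. sqrt t * sqrt t) = J (\<lambda>t. t)" by (rule J_cong) simp
    then show ?thesis by (simp only: J_mult[OF g g] E(2))
  qed
  ultimately show ?thesis using that J_symm[OF g] by blast
qed

end

locale traced = cstar A for A :: "('h::complex_hilbert_space \<Rightarrow>\<^sub>L 'h) set" +
  fixes \<tau> :: "('h \<Rightarrow>\<^sub>L 'h) \<Rightarrow> ennreal"
  assumes trace: "is_trace A \<tau>"
begin

lemma trace_add: "a \<in> A \<Longrightarrow> pos_op a \<Longrightarrow> b \<in> A \<Longrightarrow> pos_op b \<Longrightarrow> \<tau> (a + b) = \<tau> a + \<tau> b"
  using trace by (simp add: is_trace_def pos_part_iff)

lemma trace_scaleR: "a \<in> A \<Longrightarrow> pos_op a \<Longrightarrow> 0 \<le> r \<Longrightarrow> \<tau> (r *\<^sub>R a) = ennreal r * \<tau> a"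
  using trace by (simp add: is_trace_def pos_part_iff)

lemma trace_zero: "\<tau> 0 = 0"
  using trace_scaleR[of 0 0] A_zero by simp

lemma trace_sum:
  "(\<And>i. i \<in> S \<Longrightarrow> a i \<in> A) \<Longrightarrow> (\<And>i. i \<in> S \<Longrightarrow> pos_op (a i)) \<Longrightarrow> \<tau> (\<Sum>i\<in>S. a i) = (\<Sum>i\<in>S. \<tau> (a i))"
  by (induction S rule: infinite_finite_induct) (simp_all add: trace_zero trace_add A_sum pos_op_sum)

lemma trace_mono:
  assumes "a \<in> A" "b \<in> A" "pos_op a" "pos_op (b - a)"
  shows "\<tau> a \<le> \<tau> b"
  using trace_add[OF assms(1,3) A_diff[OF assms(2,1)] assms(4)] by simp

text \<open>With \<open>c = a\<^sup>1\<^sup>/\<^sup>2 s\<close>, the trace property turns \<open>\<tau>(s a s) = \<tau>(c\<^sup>* c)\<close> into \<open>\<tau>(a\<^sup>1\<^sup>/\<^sup>2 s\<^sup>2 a\<^sup>1\<^sup>/\<^sup>2)\<close>,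
  and the latter can be summed over \<open>s\<close>.\<close>

lemma trace_sandwich_sum:
  assumes "finite S" and s: "\<And>k. k \<in> S \<Longrightarrow> s k \<in> A" "\<And>k. k \<in> S \<Longrightarrow> symm_op (s k)"
    and le: "pos_op (id_blinfun - (\<Sum>k\<in>S. s k o\<^sub>L s k))" and a: "a \<in> A" "pos_op a"
  shows "(\<Sum>k\<in>S. \<tau> (s k o\<^sub>L a o\<^sub>L s k)) \<le> \<tau> a"
proof -
  obtain b where b: "b \<in> A" "symm_op b" "b o\<^sub>L b = a" by (rule pos_sqrt[OF a])
  have "\<tau> (s k o\<^sub>L a o\<^sub>L s k) = \<tau> (b o\<^sub>L (s k o\<^sub>L s k) o\<^sub>L b)" if k: "k \<in> S" for k
  proof -
    have "is_adjoint (b o\<^sub>L s k) (s k o\<^sub>L b)"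
      using A_bounded_ops b(1,2) s[OF k] A_comp by (subst is_adjoint_iff) (auto simp: symm_opD)
    then have "\<tau> ((s k o\<^sub>L b) o\<^sub>L (b o\<^sub>L s k)) = \<tau> ((b o\<^sub>L s k) o\<^sub>L (s k o\<^sub>L b))"
      using trace A_comp[OF b(1) s(1)[OF k]] A_comp[OF s(1)[OF k] b(1)] by (auto simp: is_trace_def)
    then show ?thesis by (simp add: b(3)[symmetric] blinfun_compose_assoc)
  qed
  then have "(\<Sum>k\<in>S. \<tau> (s k o\<^sub>L a o\<^sub>L s k)) = (\<Sum>k\<in>S. \<tau> (b o\<^sub>L (s k o\<^sub>L s k) o\<^sub>L b))" by simp
  also have "\<dots> = \<tau> (\<Sum>k\<in>S. b o\<^sub>L (s k o\<^sub>L s k) o\<^sub>L b)"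
    by (rule trace_sum[symmetric]) (use b s in \<open>auto intro: A_comp pos_op_sandwich pos_op_square\<close>)
  also have "(\<Sum>k\<in>S. b o\<^sub>L (s k o\<^sub>L s k) o\<^sub>L b) = b o\<^sub>L (\<Sum>k\<in>S. s k o\<^sub>L s k) o\<^sub>L b"
    by (simp add: bounded_bilinear.sum_left[OF bounded_bilinear_blinfun_compose]
        bounded_bilinear.sum_right[OF bounded_bilinear_blinfun_compose])
  also have "\<tau> \<dots> \<le> \<tau> a"
  proof (rule trace_mono)
    have "a - (b o\<^sub>L (\<Sum>k\<in>S. s k o\<^sub>L s k) o\<^sub>L b) = b o\<^sub>L (id_blinfun - (\<Sum>k\<in>S. s k o\<^sub>L s k)) o\<^sub>L b"
      by (simp add: blinfun_compose_simps b(3))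
    then show "pos_op (a - (b o\<^sub>L (\<Sum>k\<in>S. s k o\<^sub>L s k) o\<^sub>L b))"
      using pos_op_sandwich[OF b(2) le] by simp
    show "pos_op (b o\<^sub>L (\<Sum>k\<in>S. s k o\<^sub>L s k) o\<^sub>L b)"
      by (intro pos_op_sandwich b pos_op_sum pos_op_square s)
    show "b o\<^sub>L (\<Sum>k\<in>S. s k o\<^sub>L s k) o\<^sub>L b \<in> A" by (intro A_comp b A_sum s)
  qed (rule a)
  finally show ?thesis .
qed

end

section \<open>The trace inequality\<close>

text \<open>Here \<open>X.J\<close>, \<open>Y.J\<close> and \<open>Z.J\<close> are the functional calculi of three commuting tuples \<open>x\<close>, \<open>y\<close> and
  \<open>z = u x + v y\<close>, all supported by the same compact convex set \<open>L\<close>.\<close>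

locale convex_triple = traced A \<tau> + X: bpvm PX L + Y: bpvm PY L + Z: bpvm PZ L
  for A :: "('h::complex_hilbert_space \<Rightarrow>\<^sub>L 'h) set" and \<tau>
    and PX PY PZ :: "'a::euclidean_space set \<Rightarrow> 'h \<Rightarrow>\<^sub>L 'h" and L +
  fixes u v :: real
  assumes L: "compact L" and uv: "0 \<le> u" "0 \<le> v" "u + v = 1"
    and X_lin: "\<And>w. X.J (\<lambda>t. w \<bullet> t) \<in> A" and Y_lin: "\<And>w. Y.J (\<lambda>t. w \<bullet> t) \<in> A"
    and Z_lin: "\<And>w. Z.J (\<lambda>t. w \<bullet> t) = u *\<^sub>R X.J (\<lambda>t. w \<bullet> t) + v *\<^sub>R Y.J (\<lambda>t. w \<bullet> t)"
    and unit: "id_blinfun \<in> A \<or> 0 \<in> L"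
begin

lemma Z_lin_mem: "Z.J (\<lambda>t. w \<bullet> t) \<in> A"
  unfolding Z_lin by (intro A_add A_scaleR X_lin Y_lin)

lemma J_in_A:
  assumes "continuous_on L g" "id_blinfun \<in> A \<or> g 0 = 0"
  shows "X.J g \<in> A" "Y.J g \<in> A" "Z.J g \<in> A"
proof -
  have unit': "id_blinfun \<in> A \<or> 0 \<in> L \<and> g 0 = 0" using assms(2) unit by blast
  have eq: "(\<lambda>t. t \<bullet> b) = (\<lambda>t. b \<bullet> t)" for b :: 'a by (rule ext) (rule inner_commute)
  show "X.J g \<in> A" "Y.J g \<in> A" "Z.J g \<in> A"
    using J_mem[OF X.bpvm_axioms L assms(1) _ unit'] J_mem[OF Y.bpvm_axioms L assms(1) _ unit']
      J_mem[OF Z.bpvm_axioms L assms(1) _ unit'] X_lin Y_lin Z_lin_mem unfolding eq by blast+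
qed

lemma Z_affine:
  "Z.J (\<lambda>t. c + w \<bullet> t) = u *\<^sub>R X.J (\<lambda>t. c + w \<bullet> t) + v *\<^sub>R Y.J (\<lambda>t. c + w \<bullet> t)"
proof -
  have c: "continuous_on L (\<lambda>t. w \<bullet> t)" by (intro continuous_intros)
  note g = X.good_continuous[OF L c] Y.good_continuous[OF L c] Z.good_continuous[OF L c]
  have eq: "c *\<^sub>R id_blinfun = u *\<^sub>R c *\<^sub>R id_blinfun + v *\<^sub>R c *\<^sub>R (id_blinfun :: 'h \<Rightarrow>\<^sub>L 'h)"
    using uv(3) by (metis scaleR_add_left scaleR_one)
  have "Z.J (\<lambda>t. c + w \<bullet> t) = c *\<^sub>R id_blinfun + (u *\<^sub>R X.J (\<lambda>t. w \<bullet> t) + v *\<^sub>R Y.J (\<lambda>t. w \<bullet> t))"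
    using g by (simp add: Z.J_add Z.good_const Z.J_const Z_lin)
  also have "\<dots> = u *\<^sub>R (c *\<^sub>R id_blinfun + X.J (\<lambda>t. w \<bullet> t)) + v *\<^sub>R (c *\<^sub>R id_blinfun + Y.J (\<lambda>t. w \<bullet> t))"
    by (subst eq) (simp only: scaleR_add_right ac_simps)
  finally show ?thesis
    using g by (simp add: X.J_add Y.J_add X.good_const Y.good_const X.J_const Y.J_const)
qed

text \<open>For each \<open>d\<close> an element \<open>G\<close> of \<open>A\<close> is built
  within \<open>3 * d\<close> of \<open>Z.J f\<close> and with trace at most the right-hand side.
  The minorants account for an error \<open>d\<close>, the cut-off where \<open>f\<close> is small
  for \<open>2 * d\<close>.\<close>

theorem trace_convex_nonneg:
  assumes f: "continuous_on L f" "convex_on L f" and nonneg: "\<And>t. t \<in> L \<Longrightarrow> 0 \<le> f t"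
    and f0: "id_blinfun \<in> A \<or> f 0 = 0"
    and dense: "pos_part A \<subseteq> closure {a\<in>pos_part A. \<tau> a < \<infinity>}"
    and lsc: "lower_semicontinuous_on (pos_part A) \<tau>"
  shows "\<tau> (Z.J f) \<le> ennreal u * \<tau> (X.J f) + ennreal v * \<tau> (Y.J f)"
proof -
  define R where "R = ennreal u * \<tau> (X.J f) + ennreal v * \<tau> (Y.J f)"
  have sq: "0 \<le> r * h * r" if "r = 0 \<or> 0 \<le> h" for r h :: real
  proof -
    have "r * h * r = h * (r * r)" by simp
    moreover have "0 \<le> h * (r * r)"
    proof (cases "r = 0")
      case False
      with that show ?thesis by (intro mult_nonneg_nonneg[OF _ zero_le_square]) auto
    qed simp
    ultimately show ?thesis by (simp only:)
  qed
  note gX = X.good_continuous[OF L] and gY = Y.good_continuous[OF L] and gZ = Z.good_continuous[OF L]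
  have fX: "X.J f \<in> A" "pos_op (X.J f)" and fY: "Y.J f \<in> A" "pos_op (Y.J f)"
    and fZ: "Z.J f \<in> A" "pos_op (Z.J f)"
    using J_in_A[OF f(1) f0] nonneg by (auto intro!: X.J_pos Y.J_pos Z.J_pos gX gY gZ f)
  have half: "d *\<^sub>R id_blinfun = (d / 2) *\<^sub>R id_blinfun + (d / 2) *\<^sub>R (id_blinfun :: 'h \<Rightarrow>\<^sub>L 'h)" for d :: real
    by (simp flip: scaleR_add_left)
  have approx: "\<exists>G. G \<in> pos_part A \<and> norm (G - Z.J f) \<le> 3 * d \<and> \<tau> G \<le> R" if d: "0 < d" for d
  proof -

    \<comment> \<open>Minorants and cut-off functions\<close>
    obtain \<Lambda> :: "(real \<times> 'a) set" where \<Lambda>: "finite \<Lambda>"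
      and minor: "\<And>c w s. (c, w) \<in> \<Lambda> \<Longrightarrow> s \<in> L \<Longrightarrow> c + w \<bullet> s \<le> f s"
      and close: "\<And>t. t \<in> L \<Longrightarrow> \<exists>(c, w)\<in>\<Lambda>. f t - d < c + w \<bullet> t"
      by (rule finite_affine_minorants[OF L f(2,1) d]) (rule that)
    define l where "l k t = fst k + snd k \<bullet> t" for k :: "real \<times> 'a" and t
    have l_le: "l k t \<le> f t" if "k \<in> \<Lambda>" "t \<in> L" for k t
      using minor[of "fst k" "snd k" t] that by (simp add: l_def)
    have l_close: "\<exists>k\<in>\<Lambda>. f t - d < l k t" if "t \<in> L" for t
      using close[OF that] by (force simp: l_def)
    \<comment> \<open>Positive exactly where \<open>l k\<close> exceeds \<open>f - d\<close>. The
      choice of \<open>\<Lambda>\<close> makes the sum \<open>WW\<close> positive on all of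
      \<open>L\<close>, so division by it gives a partition of unity.\<close>
    define W where "W k t = max 0 (l k t - f t + d)" for k t
    define WW where "WW t = (\<Sum>k\<in>\<Lambda>. W k t)" for t
    \<comment> \<open>Rises from \<open>0\<close> at \<open>f = d\<close> to \<open>1\<close> at
      \<open>f = 2 * d\<close>. Vanishing for \<open>f \<le> d\<close> serves two purposes: the
      squares \<open>S k o\<^sub>L S k\<close> get finite trace, and \<open>s k 0 = 0\<close> if
      \<open>f 0 = 0\<close>, which keeps \<open>S k\<close> in \<open>A\<close>.\<close>
    define g where "g t = max 0 (min 1 (f t / d - 1))" for t
    define s where "s k t = sqrt (W k t / WW t * g t)" for k t
    have W0: "0 \<le> W k t" for k t by (simp add: W_def)
    have WW: "0 < WW t" if t: "t \<in> L" for t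
    proof -
      obtain k where k: "k \<in> \<Lambda>" "f t - d < l k t" using l_close[OF t] by blast
      then have "0 < W k t" by (simp add: W_def)
      also have "\<dots> \<le> WW t" unfolding WW_def by (rule member_le_sum) (use k \<Lambda> W0 in auto)
      finally show ?thesis .
    qed
    have g01: "0 \<le> g t" "g t \<le> 1" for t by (auto simp: g_def)
    have g_zero: "g t = 0" if "f t \<le> d" for t
      using that d by (simp add: g_def max_def min_def field_simps)
    have g_one: "g t = 1" if "2 * d \<le> f t" for t
      using that d by (simp add: g_def max_def min_def field_simps)
    have lc: "continuous_on L (l k)" for k unfolding l_def by (intro continuous_intros)
    have Wc: "continuous_on L (W k)" for k unfolding W_def by (intro continuous_intros lc f)
    have WWc: "continuous_on L WW" unfolding WW_def by (intro continuous_intros Wc)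
    have gc: "continuous_on L g" unfolding g_def using d by (intro continuous_intros f) auto
    have sc: "continuous_on L (s k)" for k
      unfolding s_def using WW by (intro continuous_intros Wc WWc gc) fastforce
    have s_sq: "s k t * s k t = W k t / WW t * g t" if "t \<in> L" for k t
      using W0[of k t] WW[OF that] g01[of t] by (simp add: s_def)
    have s_sum: "(\<Sum>k\<in>\<Lambda>. s k t * s k t) = g t" if "t \<in> L" for t
      using WW[OF that] by (simp add: s_sq[OF that] WW_def flip: sum_distrib_right sum_divide_distrib)
    have s_supp: "s k t = 0 \<or> (d < f t \<and> f t - d < l k t)" if "t \<in> L" for k t
      using g_zero[of t] by (cases "f t \<le> d") (auto simp: s_def W_def max_def)

    \<comment> \<open>Compressions by functions of \<open>z\<close>\<close>
    define S where "S k = Z.J (s k)" for k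
    have S_A: "S k \<in> A" for k
      unfolding S_def using f0 g_zero[of 0] d by (intro J_in_A sc) (auto simp: s_def)
    have S_symm: "symm_op (S k)" for k unfolding S_def by (rule Z.J_symm[OF gZ[OF sc]])
    have SJS: "S k o\<^sub>L Z.J h o\<^sub>L S k = Z.J (\<lambda>t. s k t * h t * s k t)" if "continuous_on L h" for k h
      unfolding S_def using gZ[OF sc] gZ[OF that] by (simp add: Z.J_mult Z.good_mult)
    have SS: "S k o\<^sub>L S k = Z.J (\<lambda>t. s k t * s k t)" for k
      unfolding S_def using gZ[OF sc] by (simp add: Z.J_mult)
    have S_le: "pos_op (id_blinfun - (\<Sum>k\<in>\<Lambda>. S k o\<^sub>L S k))"
    proof -
      have "(\<Sum>k\<in>\<Lambda>. S k o\<^sub>L S k) = Z.J (\<lambda>t. \<Sum>k\<in>\<Lambda>. s k t * s k t)"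
        unfolding SS by (rule Z.J_sum[symmetric]) (intro Z.good_mult gZ sc)
      also have "\<dots> = Z.J g" by (rule Z.J_cong) (rule s_sum)
      finally have "(\<Sum>k\<in>\<Lambda>. S k o\<^sub>L S k) = Z.J g" .
      moreover have "pos_op (Z.J (\<lambda>_. 1) - Z.J g)"
        by (rule Z.J_mono) (auto intro: gZ gc Z.good_const g01)
      ultimately show ?thesis by (simp add: Z.J_const)
    qed
    have S_le1: "pos_op (id_blinfun - (\<Sum>k\<in>{k}. S k o\<^sub>L S k))" if k: "k \<in> \<Lambda>" for k
    proof -
      have "(\<Sum>j\<in>\<Lambda>. S j o\<^sub>L S j) = (S k o\<^sub>L S k) + (\<Sum>j\<in>\<Lambda> - {k}. S j o\<^sub>L S j)"
        using k \<Lambda> by (simp add: sum.remove)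
      then have "id_blinfun - (\<Sum>k\<in>{k}. S k o\<^sub>L S k)
          = (id_blinfun - (\<Sum>j\<in>\<Lambda>. S j o\<^sub>L S j)) + (\<Sum>j\<in>\<Lambda> - {k}. S j o\<^sub>L S j)" by simp
      then show ?thesis
        using pos_op_add[OF S_le pos_op_sum[of "\<Lambda> - {k}" "\<lambda>j. S j o\<^sub>L S j", OF pos_op_square[OF S_symm]]] by (simp only:)
    qed
    \<comment> \<open>An element \<open>a\<close> of finite trace within \<open>d / 2\<close> of
      \<open>Z.J f\<close>, compressed by \<open>S k\<close>, dominates \<open>d / 2\<close> times
      \<open>S k o\<^sub>L S k\<close>, because \<open>f > d\<close> wherever \<open>s k\<close> is
      nonzero. By \<open>trace_sandwich_sum\<close> the compression of \<open>a\<close> has finite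
      trace.\<close>
    have SS_fin: "\<tau> (S k o\<^sub>L S k) < \<infinity>" if k: "k \<in> \<Lambda>" for k
    proof -
      have "Z.J f \<in> closure {a\<in>pos_part A. \<tau> a < \<infinity>}" using dense fZ by (auto simp: pos_part_iff)
      then obtain a where a: "a \<in> A" "pos_op a" "\<tau> a < \<infinity>" "norm (a - Z.J f) < d / 2"
        using d unfolding closure_approachable by (auto simp: dist_norm pos_part_iff dest!: spec[of _ "d / 2"])
      have "pos_op ((d / 2) *\<^sub>R id_blinfun - (Z.J f - a))"
        by (rule pos_op_norm_minus)
          (use a fZ in \<open>auto intro: symm_op_diff pos_op_symm less_imp_le simp: norm_minus_commute\<close>)
      then have p1: "pos_op (S k o\<^sub>L ((d / 2) *\<^sub>R id_blinfun - (Z.J f - a)) o\<^sub>L S k)"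
        by (rule pos_op_sandwich[OF S_symm])
      have p2: "pos_op (S k o\<^sub>L Z.J (\<lambda>t. f t - d) o\<^sub>L S k)"
      proof (subst SJS)
        show "pos_op (Z.J (\<lambda>t. s k t * (f t - d) * s k t))"
        proof (rule Z.J_pos)
          show "0 \<le> s k t * (f t - d) * s k t" if "t \<in> L" for t
            by (rule sq) (use s_supp[OF that, of k] in auto)
        qed (intro gZ continuous_intros sc f)
      qed (intro continuous_intros f)
      have "Z.J (\<lambda>t. f t - d) = Z.J f - d *\<^sub>R id_blinfun"
        by (simp add: Z.J_diff gZ f Z.good_const Z.J_const)
      then have "((d / 2) *\<^sub>R id_blinfun - (Z.J f - a)) + Z.J (\<lambda>t. f t - d) = a - (d / 2) *\<^sub>R id_blinfun"
        by (simp only: half[of d]) simp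
      then have "(S k o\<^sub>L ((d / 2) *\<^sub>R id_blinfun - (Z.J f - a)) o\<^sub>L S k) + (S k o\<^sub>L Z.J (\<lambda>t. f t - d) o\<^sub>L S k)
          = S k o\<^sub>L (a - (d / 2) *\<^sub>R id_blinfun) o\<^sub>L S k"
        by (simp only: blinfun_compose_simps(1,2)[symmetric])
      also have "\<dots> = (S k o\<^sub>L a o\<^sub>L S k) - (d / 2) *\<^sub>R (S k o\<^sub>L S k)"
        by (simp add: blinfun_compose_simps)
      finally have "(S k o\<^sub>L ((d / 2) *\<^sub>R id_blinfun - (Z.J f - a)) o\<^sub>L S k) + (S k o\<^sub>L Z.J (\<lambda>t. f t - d) o\<^sub>L S k)
          = (S k o\<^sub>L a o\<^sub>L S k) - (d / 2) *\<^sub>R (S k o\<^sub>L S k)" .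
      then have "pos_op ((S k o\<^sub>L a o\<^sub>L S k) - (d / 2) *\<^sub>R (S k o\<^sub>L S k))"
        using pos_op_add[OF p1 p2] by simp
      then have "\<tau> ((d / 2) *\<^sub>R (S k o\<^sub>L S k)) \<le> \<tau> (S k o\<^sub>L a o\<^sub>L S k)"
        using d a by (intro trace_mono) (auto intro!: A_scaleR A_comp pos_op_scaleR pos_op_square S_symm S_A)
      also have "\<dots> \<le> \<tau> a"
        using trace_sandwich_sum[OF _ S_A S_symm S_le1[OF k] a(1,2)] by simp
      also have "\<dots> < \<infinity>" by (rule a)
      finally have "ennreal (d / 2) * \<tau> (S k o\<^sub>L S k) < \<infinity>"
        using d by (subst (asm) trace_scaleR) (auto intro!: A_comp pos_op_square S_symm S_A)
      then show ?thesis using d by (auto simp: ennreal_mult_less_top)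
    qed

    \<comment> \<open>The approximating element and its trace\<close>
    define G where "G = (\<Sum>k\<in>\<Lambda>. S k o\<^sub>L Z.J (l k) o\<^sub>L S k)"
    have SlS_pos: "pos_op (S k o\<^sub>L Z.J (l k) o\<^sub>L S k)" for k
    proof (subst SJS[OF lc])
      show "pos_op (Z.J (\<lambda>t. s k t * l k t * s k t))"
      proof (rule Z.J_pos)
        show "0 \<le> s k t * l k t * s k t" if "t \<in> L" for t
          by (rule sq) (use s_supp[OF that, of k] d in auto)
      qed (intro gZ continuous_intros sc lc)
    qed
    \<comment> \<open>An affine \<open>T\<close> may lie outside \<open>A\<close> through its
      constant part; compression turns that part into \<open>c\<close> times
      \<open>S k o\<^sub>L S k\<close>, which is in \<open>A\<close>.\<close>
    have sand: "S k o\<^sub>L T o\<^sub>L S k \<in> A" if "T = c *\<^sub>R id_blinfun + T'" "T' \<in> A" for k T c T'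
      using S_A[of k] that by (simp add: blinfun_compose_simps A_add A_scaleR A_comp)
    have lX: "X.J (l k) = fst k *\<^sub>R id_blinfun + X.J (\<lambda>t. snd k \<bullet> t)"
      and lY: "Y.J (l k) = fst k *\<^sub>R id_blinfun + Y.J (\<lambda>t. snd k \<bullet> t)"
      and lZ: "Z.J (l k) = fst k *\<^sub>R id_blinfun + Z.J (\<lambda>t. snd k \<bullet> t)" for k
      unfolding l_def
      by (subst X.J_add Y.J_add Z.J_add; auto intro!: gX gY gZ continuous_intros X.good_const Y.good_const Z.good_const
          simp: X.J_const Y.J_const Z.J_const)+
    have SlS_A: "S k o\<^sub>L Z.J (l k) o\<^sub>L S k \<in> A" for k by (rule sand[OF lZ Z_lin_mem])
    \<comment> \<open>\<open>l k\<close> may be negative somewhere on \<open>L\<close>, and then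
      \<open>\<tau>\<close> says nothing about the compression of \<open>X.J (l k)\<close>. After
      the addition of \<open>C\<close> everything is positive; the surplus \<open>N\<close> appears
      on both sides, on the right with total weight \<open>u + v = 1\<close>, and being finite it is
      cancelled at the end.\<close>
    have step: "\<tau> (S k o\<^sub>L Z.J (l k) o\<^sub>L S k)
        \<le> ennreal u * \<tau> (S k o\<^sub>L X.J f o\<^sub>L S k) + ennreal v * \<tau> (S k o\<^sub>L Y.J f o\<^sub>L S k)" if k: "k \<in> \<Lambda>" for k
    proof -
      obtain C where C: "0 \<le> C" "\<And>t. t \<in> L \<Longrightarrow> 0 \<le> l k t + C"
      proof -
        obtain C where "\<forall>t\<in>L. \<bar>l k t\<bar> \<le> C"
          using compact_imp_bounded[OF compact_continuous_image[OF lc[of k] L]] by (force simp: bounded_iff)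
        then have "\<And>t. t \<in> L \<Longrightarrow> 0 \<le> l k t + \<bar>C\<bar>" by fastforce
        then show ?thesis using that[of "\<bar>C\<bar>"] by simp
      qed
      define N where "N = ennreal C * \<tau> (S k o\<^sub>L S k)"
      have N: "N < \<infinity>" using SS_fin[OF k] by (simp add: N_def ennreal_mult_less_top)
      have SCS: "S k o\<^sub>L (T + C *\<^sub>R id_blinfun) o\<^sub>L S k = (S k o\<^sub>L T o\<^sub>L S k) + C *\<^sub>R (S k o\<^sub>L S k)" for T
        by (simp add: blinfun_compose_simps)
      have CS: "C *\<^sub>R (S k o\<^sub>L S k) \<in> A" "pos_op (C *\<^sub>R (S k o\<^sub>L S k))" "\<tau> (C *\<^sub>R (S k o\<^sub>L S k)) = N"
        unfolding N_def
        by (intro A_scaleR A_comp S_A pos_op_scaleR pos_op_square S_symm C(1) trace_scaleR)+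
      have main: "\<tau> (S k o\<^sub>L (T + C *\<^sub>R id_blinfun) o\<^sub>L S k) \<le> \<tau> (S k o\<^sub>L F o\<^sub>L S k) + N"
        "S k o\<^sub>L (T + C *\<^sub>R id_blinfun) o\<^sub>L S k \<in> A" "pos_op (S k o\<^sub>L (T + C *\<^sub>R id_blinfun) o\<^sub>L S k)"
        if T: "T = c *\<^sub>R id_blinfun + T'" "T' \<in> A" and F: "F \<in> A" "pos_op F" "pos_op (F - T)"
          and TC: "pos_op (T + C *\<^sub>R id_blinfun)" for T F c T'
      proof -
        have mem: "S k o\<^sub>L T o\<^sub>L S k \<in> A" by (rule sand[OF T])
        then show A1: "S k o\<^sub>L (T + C *\<^sub>R id_blinfun) o\<^sub>L S k \<in> A" unfolding SCS by (intro A_add CS)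
        show P1: "pos_op (S k o\<^sub>L (T + C *\<^sub>R id_blinfun) o\<^sub>L S k)" by (rule pos_op_sandwich[OF S_symm TC])
        have FA: "S k o\<^sub>L F o\<^sub>L S k \<in> A" "pos_op (S k o\<^sub>L F o\<^sub>L S k)"
          using F by (auto intro!: A_comp pos_op_sandwich S_symm S_A)
        have "\<tau> (S k o\<^sub>L (T + C *\<^sub>R id_blinfun) o\<^sub>L S k) \<le> \<tau> ((S k o\<^sub>L F o\<^sub>L S k) + C *\<^sub>R (S k o\<^sub>L S k))"
        proof (rule trace_mono[OF A1 _ P1])
          have "(S k o\<^sub>L F o\<^sub>L S k) + C *\<^sub>R (S k o\<^sub>L S k) - (S k o\<^sub>L (T + C *\<^sub>R id_blinfun) o\<^sub>L S k)
              = S k o\<^sub>L (F - T) o\<^sub>L S k" unfolding SCS by (simp add: blinfun_compose_simps)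
          then show "pos_op ((S k o\<^sub>L F o\<^sub>L S k) + C *\<^sub>R (S k o\<^sub>L S k) - (S k o\<^sub>L (T + C *\<^sub>R id_blinfun) o\<^sub>L S k))"
            using pos_op_sandwich[OF S_symm F(3)] by simp
        qed (intro A_add FA CS)
        also have "\<dots> = \<tau> (S k o\<^sub>L F o\<^sub>L S k) + N" using trace_add[OF FA CS(1,2)] CS(3) by simp
        finally show "\<tau> (S k o\<^sub>L (T + C *\<^sub>R id_blinfun) o\<^sub>L S k) \<le> \<tau> (S k o\<^sub>L F o\<^sub>L S k) + N" .
      qed
      have "pos_op (X.J f - X.J (l k))" "pos_op (Y.J f - Y.J (l k))"
        by (auto intro!: X.J_mono Y.J_mono gX gY lc f l_le k)
      moreover have "pos_op (X.J (l k) + C *\<^sub>R id_blinfun)" "pos_op (Y.J (l k) + C *\<^sub>R id_blinfun)"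
        using X.J_pos[OF X.good_add[OF gX[OF lc] X.good_const] C(2)] Y.J_pos[OF Y.good_add[OF gY[OF lc] Y.good_const] C(2)]
        by (auto simp: X.J_add Y.J_add gX gY lc X.good_const Y.good_const X.J_const Y.J_const)
      ultimately have mX: "\<tau> (S k o\<^sub>L (X.J (l k) + C *\<^sub>R id_blinfun) o\<^sub>L S k) \<le> \<tau> (S k o\<^sub>L X.J f o\<^sub>L S k) + N"
          "S k o\<^sub>L (X.J (l k) + C *\<^sub>R id_blinfun) o\<^sub>L S k \<in> A" "pos_op (S k o\<^sub>L (X.J (l k) + C *\<^sub>R id_blinfun) o\<^sub>L S k)"
        and mY: "\<tau> (S k o\<^sub>L (Y.J (l k) + C *\<^sub>R id_blinfun) o\<^sub>L S k) \<le> \<tau> (S k o\<^sub>L Y.J f o\<^sub>L S k) + N"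
          "S k o\<^sub>L (Y.J (l k) + C *\<^sub>R id_blinfun) o\<^sub>L S k \<in> A" "pos_op (S k o\<^sub>L (Y.J (l k) + C *\<^sub>R id_blinfun) o\<^sub>L S k)"
        using main[OF lX X_lin fX] main[OF lY Y_lin fY] by auto
      have eq: "u *\<^sub>R (S k o\<^sub>L (X.J (l k) + C *\<^sub>R id_blinfun) o\<^sub>L S k) + v *\<^sub>R (S k o\<^sub>L (Y.J (l k) + C *\<^sub>R id_blinfun) o\<^sub>L S k)
          = (S k o\<^sub>L Z.J (l k) o\<^sub>L S k) + C *\<^sub>R (S k o\<^sub>L S k)"
      proof -
        have c1: "C *\<^sub>R (S k o\<^sub>L S k) = u *\<^sub>R C *\<^sub>R (S k o\<^sub>L S k) + v *\<^sub>R C *\<^sub>R (S k o\<^sub>L S k)"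
          using uv(3) by (metis scaleR_add_left scaleR_one)
        have z1: "Z.J (l k) = u *\<^sub>R X.J (l k) + v *\<^sub>R Y.J (l k)" unfolding l_def by (rule Z_affine)
        have "(S k o\<^sub>L Z.J (l k) o\<^sub>L S k) + C *\<^sub>R (S k o\<^sub>L S k)
            = (S k o\<^sub>L (u *\<^sub>R X.J (l k) + v *\<^sub>R Y.J (l k)) o\<^sub>L S k)
              + (u *\<^sub>R C *\<^sub>R (S k o\<^sub>L S k) + v *\<^sub>R C *\<^sub>R (S k o\<^sub>L S k))"
          by (simp only: z1 flip: c1)
        also have "\<dots> = u *\<^sub>R ((S k o\<^sub>L X.J (l k) o\<^sub>L S k) + C *\<^sub>R (S k o\<^sub>L S k))
            + v *\<^sub>R ((S k o\<^sub>L Y.J (l k) o\<^sub>L S k) + C *\<^sub>R (S k o\<^sub>L S k))"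
          by (simp only: blinfun_compose_simps scaleR_add_right ac_simps)
        finally show ?thesis by (simp only: SCS)
      qed
      have "\<tau> (S k o\<^sub>L Z.J (l k) o\<^sub>L S k) + N
          = ennreal u * \<tau> (S k o\<^sub>L (X.J (l k) + C *\<^sub>R id_blinfun) o\<^sub>L S k)
          + ennreal v * \<tau> (S k o\<^sub>L (Y.J (l k) + C *\<^sub>R id_blinfun) o\<^sub>L S k)"
        using trace_add[OF SlS_A SlS_pos CS(1,2), of k] mX(2,3) mY(2,3) uv CS(3)
        by (simp add: trace_add trace_scaleR A_scaleR pos_op_scaleR flip: eq)
      also have "\<dots> \<le> ennreal u * (\<tau> (S k o\<^sub>L X.J f o\<^sub>L S k) + N) + ennreal v * (\<tau> (S k o\<^sub>L Y.J f o\<^sub>L S k) + N)"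
        by (intro add_mono mult_left_mono mX mY) auto
      also have "\<dots> = (ennreal u * \<tau> (S k o\<^sub>L X.J f o\<^sub>L S k) + ennreal v * \<tau> (S k o\<^sub>L Y.J f o\<^sub>L S k)) + N"
      proof -
        have "N = ennreal u * N + ennreal v * N"
          using uv by (simp flip: distrib_right ennreal_plus)
        then show ?thesis by (simp add: distrib_left ac_simps)
      qed
      finally show ?thesis using N
        by (metis add.commute ennreal_add_left_cancel_le infinity_ennreal_def less_irrefl)
    qed
    have "\<tau> G = (\<Sum>k\<in>\<Lambda>. \<tau> (S k o\<^sub>L Z.J (l k) o\<^sub>L S k))"
      unfolding G_def by (rule trace_sum) (rule SlS_A SlS_pos)+
    also have "\<dots> \<le> (\<Sum>k\<in>\<Lambda>. ennreal u * \<tau> (S k o\<^sub>L X.J f o\<^sub>L S k) + ennreal v * \<tau> (S k o\<^sub>L Y.J f o\<^sub>L S k))"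
      by (rule sum_mono) (rule step)
    also have "\<dots> = ennreal u * (\<Sum>k\<in>\<Lambda>. \<tau> (S k o\<^sub>L X.J f o\<^sub>L S k)) + ennreal v * (\<Sum>k\<in>\<Lambda>. \<tau> (S k o\<^sub>L Y.J f o\<^sub>L S k))"
      by (simp add: sum.distrib sum_distrib_left)
    also have "\<dots> \<le> R"
      unfolding R_def
      by (intro add_mono mult_left_mono trace_sandwich_sum[OF \<Lambda> S_A S_symm S_le] fX fY) auto
    finally have "\<tau> G \<le> R" .
    moreover have "G \<in> pos_part A"
      unfolding pos_part_iff G_def by (intro conjI A_sum pos_op_sum SlS_A SlS_pos)
    \<comment> \<open>Since \<open>f - d < l k \<le> f\<close> where \<open>s k\<close> is nonzero,
      \<open>f * g - d * g \<le> h \<le> f * g\<close>; and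
      \<open>f - 2 * d \<le> f * g \<le> f\<close>, because \<open>g = 1\<close> for
      \<open>f \<ge> 2 * d\<close>.\<close>
    moreover have "norm (G - Z.J f) \<le> 3 * d"
    proof -
      define h where "h t = (\<Sum>k\<in>\<Lambda>. s k t * l k t * s k t)" for t
      have hc: "continuous_on L h" unfolding h_def by (intro continuous_intros sc lc)
      have "G = Z.J h"
        unfolding G_def h_def SJS[OF lc] by (rule Z.J_sum[symmetric]) (intro gZ continuous_intros sc lc)
      moreover have "\<bar>h t - f t\<bar> \<le> 3 * d" if t: "t \<in> L" for t
      proof -
        have "h t \<le> (\<Sum>k\<in>\<Lambda>. f t * (s k t * s k t))"
          unfolding h_def
        proof (rule sum_mono)
          fix k assume "k \<in> \<Lambda>"
          then have "l k t * (s k t * s k t) \<le> f t * (s k t * s k t)"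
            by (intro mult_right_mono l_le t zero_le_square)
          then show "s k t * l k t * s k t \<le> f t * (s k t * s k t)" by (simp add: ac_simps)
        qed
        also have "\<dots> = f t * g t" by (simp add: s_sum[OF t] flip: sum_distrib_left)
        finally have up: "h t \<le> f t * g t" .
        have "(f t - d) * g t = (\<Sum>k\<in>\<Lambda>. (f t - d) * (s k t * s k t))"
          by (simp add: s_sum[OF t] flip: sum_distrib_left)
        also have "\<dots> \<le> h t"
          unfolding h_def
        proof (rule sum_mono)
          fix k assume "k \<in> \<Lambda>"
          have "(f t - d) * (s k t * s k t) \<le> l k t * (s k t * s k t)"
            using s_supp[OF t, of k] by (cases "s k t = 0") (auto intro!: mult_right_mono)
          then show "(f t - d) * (s k t * s k t) \<le> s k t * l k t * s k t" by (simp add: ac_simps)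
        qed
        finally have lo: "f t * g t - d * g t \<le> h t" by (simp add: left_diff_distrib)
        have 1: "f t * g t \<le> f t" "d * g t \<le> d"
          using g01[of t] nonneg[OF t] d by (auto intro: mult_left_le)
        have 2: "f t - 2 * d \<le> f t * g t"
        proof (cases "2 * d \<le> f t")
          case True
          then show ?thesis using d by (simp add: g_one)
        next
          case False
          then show ?thesis using mult_nonneg_nonneg[OF nonneg[OF t] g01(1)[of t]] by linarith
        qed
        show ?thesis using up lo 1 2 d by linarith
      qed
      ultimately show ?thesis
        using d by (simp add: gZ hc f Z.good_diff Z.J_norm_le flip: Z.J_diff)
    qed
    ultimately show ?thesis by blast
  qed

  \<comment> \<open>Passage to the limit by lower semicontinuity\<close>
  have "closedin (top_of_set (pos_part A)) {a\<in>pos_part A. \<tau> a \<le> R}"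
    using lsc by (simp add: lower_semicontinuous_on_def)
  then obtain C where C: "closed C" "{a\<in>pos_part A. \<tau> a \<le> R} = pos_part A \<inter> C"
    by (auto simp: closedin_closed)
  have "\<exists>G. G \<in> C \<and> norm (G - Z.J f) \<le> 3 * inverse (real (Suc n))" for n
    using approx[of "inverse (real (Suc n))"] C(2) by auto
  then obtain G where G: "\<And>n. G n \<in> C" "\<And>n. norm (G n - Z.J f) \<le> 3 * inverse (real (Suc n))" by metis
  have "(\<lambda>n. G n - Z.J f) \<longlonglongrightarrow> 0"
  proof (rule Lim_null_comparison)
    show "\<forall>\<^sub>F n in sequentially. norm (G n - Z.J f) \<le> 3 * inverse (real (Suc n))" using G(2) by simp
    show "(\<lambda>n. 3 * inverse (real (Suc n))) \<longlonglongrightarrow> 0"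
      by (rule tendsto_mult_right_zero) (rule LIMSEQ_inverse_real_of_nat)
  qed
  then have "G \<longlonglongrightarrow> Z.J f" by (rule LIM_zero_cancel)
  then have "Z.J f \<in> C" by (rule closed_sequentially[OF C(1) G(1)])
  moreover have "Z.J f \<in> pos_part A" using fZ by (simp add: pos_part_iff)
  ultimately show ?thesis using C(2) unfolding R_def by blast
qed

end

section \<open>Finite traces\<close>

locale finite_traced = traced A \<tau> for A :: "('h::complex_hilbert_space \<Rightarrow>\<^sub>L 'h) set" and \<tau> +
  assumes finite: "\<And>a. a \<in> A \<Longrightarrow> pos_op a \<Longrightarrow> \<tau> a < \<infinity>"
begin

definition tr :: "('h \<Rightarrow>\<^sub>L 'h) \<Rightarrow> real" where "tr a = enn2real (\<tau> a)"

lemma \<tau>_eq_tr: "a \<in> A \<Longrightarrow> pos_op a \<Longrightarrow> \<tau> a = ennreal (tr a)"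
  using finite[of a] by (simp add: tr_def)

lemma tr_nonneg [simp]: "0 \<le> tr a"
  by (simp add: tr_def)

lemma tr_add: "a \<in> A \<Longrightarrow> pos_op a \<Longrightarrow> b \<in> A \<Longrightarrow> pos_op b \<Longrightarrow> tr (a + b) = tr a + tr b"
  using trace_add[of a b] finite[of a] finite[of b] by (simp add: tr_def enn2real_plus)

lemma tr_scaleR: "a \<in> A \<Longrightarrow> pos_op a \<Longrightarrow> 0 \<le> r \<Longrightarrow> tr (r *\<^sub>R a) = r * tr a"
  using trace_scaleR[of a r] by (simp add: tr_def enn2real_mult)

lemma tr_mono: "a \<in> A \<Longrightarrow> b \<in> A \<Longrightarrow> pos_op a \<Longrightarrow> pos_op (b - a) \<Longrightarrow> tr a \<le> tr b"
  using tr_add[of a "b - a"] A_diff[of b a] tr_nonneg[of "b - a"] by simp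

text \<open>If \<open>\<tau>\<close> were unbounded, some \<open>\<Sum>\<^sub>k 2\<^sup>-\<^sup>k a\<^sub>k\<close> with \<open>\<tau>(a\<^sub>k) \<ge> 4\<^sup>k\<close> and \<open>\<parallel>a\<^sub>k\<parallel> \<le> 1\<close> would have infinite trace.\<close>

lemma tr_bounded:
  obtains M where "0 \<le> M" "\<And>a. a \<in> A \<Longrightarrow> pos_op a \<Longrightarrow> tr a \<le> M * norm a"
proof -
  have "\<exists>M. \<forall>a\<in>A. pos_op a \<longrightarrow> norm a \<le> 1 \<longrightarrow> tr a \<le> M"
  proof (rule ccontr)
    assume "\<not> ?thesis"
    then have "\<forall>k. \<exists>a\<in>A. pos_op a \<and> norm a \<le> 1 \<and> 4 ^ k < tr a" by (meson not_le)
    then obtain a where a: "\<And>k. a k \<in> A" "\<And>k. pos_op (a k)" "\<And>k. norm (a k) \<le> 1" "\<And>k. 4 ^ k < tr (a k)"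
      by metis
    have summ: "summable (\<lambda>k. (1/2::real) ^ k *\<^sub>R a k)"
      by (rule summable_comparison_test'[of "\<lambda>k. (1/2) ^ k" 0])
        (use a(3) in \<open>auto intro: summable_geometric simp: mult_left_le\<close>)
    define s where "s = (\<Sum>k. (1/2::real) ^ k *\<^sub>R a k)"
    have s_sums: "(\<lambda>k. (1/2::real) ^ k *\<^sub>R a k) sums s" unfolding s_def by (rule summable_sums[OF summ])
    have pA: "(\<Sum>k<n. (1/2::real) ^ k *\<^sub>R a k) \<in> A" for n by (intro A_sum A_scaleR a)
    have sA: "s \<in> A" using closed_sequentially[OF A_closed pA] s_sums by (simp add: sums_def)
    have inner: "(\<lambda>k. (1/2) ^ k * (a k \<xi> \<bullet> \<eta>)) sums (s \<xi> \<bullet> \<eta>)" for \<xi> \<eta>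
      using bounded_linear.sums[OF bounded_linear_inner_left bounded_linear.sums[OF blinfun.bounded_linear_left s_sums], of \<xi> \<eta>]
      by (simp add: blinfun.scaleR_left)
    have "s \<xi> \<bullet> \<eta> = s \<eta> \<bullet> \<xi>" for \<xi> \<eta>
    proof (rule sums_unique2[OF inner[of \<xi> \<eta>]])
      have "a k \<xi> \<bullet> \<eta> = a k \<eta> \<bullet> \<xi>" for k
        using symm_opD[OF pos_op_symm[OF a(2)], of k \<xi> \<eta>] by (simp only: inner_commute)
      then show "(\<lambda>k. (1/2) ^ k * (a k \<xi> \<bullet> \<eta>)) sums (s \<eta> \<bullet> \<xi>)" using inner[of \<eta> \<xi>] by (simp only:)
    qed
    then have s_symm: "symm_op s" by (simp add: symm_op_def inner_commute)
    have s_ge: "pos_op (s - (1/2::real) ^ k *\<^sub>R a k)" for k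
      unfolding pos_op_def
    proof
      show "symm_op (s - (1/2::real) ^ k *\<^sub>R a k)" by (intro symm_op_diff s_symm symm_op_scaleR pos_op_symm a)
      show "\<forall>\<xi>. 0 \<le> (s - (1/2::real) ^ k *\<^sub>R a k) \<xi> \<bullet> \<xi>"
      proof
        fix \<xi>
        have "(\<Sum>j\<in>{k}. (1/2) ^ j * (a j \<xi> \<bullet> \<xi>)) \<le> s \<xi> \<bullet> \<xi>"
          unfolding sums_unique[OF inner[of \<xi> \<xi>]]
          by (rule sum_le_suminf[OF sums_summable[OF inner]]) (use pos_opD[OF a(2)] in auto)
        then show "0 \<le> (s - (1/2::real) ^ k *\<^sub>R a k) \<xi> \<bullet> \<xi>"
          by (simp add: blinfun.diff_left blinfun.scaleR_left inner_diff_left)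
      qed
    qed
    have "2 ^ k \<le> tr s" for k
    proof -
      have "(2::real) ^ k = (1/2) ^ k * 4 ^ k" by (simp flip: power_mult_distrib)
      also have "\<dots> \<le> (1/2) ^ k * tr (a k)" using a(4)[of k] by (intro mult_left_mono) auto
      also have "\<dots> = tr ((1/2) ^ k *\<^sub>R a k)" using a by (subst tr_scaleR) auto
      also have "\<dots> \<le> tr s" by (rule tr_mono) (use a sA s_ge in \<open>auto intro: A_scaleR pos_op_scaleR\<close>)
      finally show ?thesis .
    qed
    moreover obtain n where "tr s < 2 ^ n" using real_arch_pow[of 2 "tr s"] by auto
    ultimately show False by (metis not_le)
  qed
  then obtain M where M: "\<And>a. a \<in> A \<Longrightarrow> pos_op a \<Longrightarrow> norm a \<le> 1 \<Longrightarrow> tr a \<le> M" by blast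
  show ?thesis
  proof (rule that[of "\<bar>M\<bar>"])
    fix a assume a: "a \<in> A" "pos_op a"
    show "tr a \<le> \<bar>M\<bar> * norm a"
    proof (cases "a = 0")
      case True
      then show ?thesis by (simp add: tr_def trace_zero)
    next
      case False
      then have n: "0 < norm a" by simp
      have "tr ((1 / norm a) *\<^sub>R a) \<le> M"
        using a n by (intro M A_scaleR pos_op_scaleR) auto
      then have "(1 / norm a) * tr a \<le> M" using tr_scaleR[OF a, of "1 / norm a"] n by simp
      then have "tr a \<le> M * norm a" using n by (simp add: field_simps)
      also have "\<dots> \<le> \<bar>M\<bar> * norm a" using n by (intro mult_right_mono) auto
      finally show ?thesis .
    qed
  qed simp
qed

text \<open>With \<open>a - b = p - q\<close>, additivity on \<open>a + q = b + p\<close> gives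
  \<open>tr a - tr b \<le> tr p\<close>, and boundedness turns this into a Lipschitz estimate with
  constant \<open>M\<close>.\<close>

lemma lower_semicontinuous: "lower_semicontinuous_on (pos_part A) \<tau>"
proof -
  obtain M where M: "0 \<le> M" "\<And>a. a \<in> A \<Longrightarrow> pos_op a \<Longrightarrow> tr a \<le> M * norm a" by (rule tr_bounded) (rule that)
  have le: "tr a - tr b \<le> M * norm (a - b)" if a: "a \<in> pos_part A" and b: "b \<in> pos_part A" for a b
  proof -
    have ab: "a \<in> A" "pos_op a" "b \<in> A" "pos_op b" using a b by (auto simp: pos_part_iff)
    obtain p q where pq: "p \<in> pos_part A" "q \<in> pos_part A" "a - b = p - q" "norm p \<le> norm (a - b)"
      by (rule pos_neg_parts[of "a - b"]) (use ab in \<open>auto intro: A_diff symm_op_diff pos_op_symm\<close>)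
    have "a + q = b + p" using pq(3) by (simp add: algebra_simps)
    then have "tr a + tr q = tr b + tr p"
      using tr_add[of a q] tr_add[of b p] ab pq by (simp add: pos_part_iff)
    then have "tr a - tr b \<le> tr p" using tr_nonneg[of q] by linarith
    also have "\<dots> \<le> M * norm p" using M pq by (simp add: pos_part_iff)
    also have "\<dots> \<le> M * norm (a - b)" using M pq by (intro mult_left_mono) auto
    finally show ?thesis .
  qed
  have "M-lipschitz_on (pos_part A) tr"
  proof (rule lipschitz_onI[OF _ M(1)])
    show "dist (tr a) (tr b) \<le> M * dist a b" if "a \<in> pos_part A" "b \<in> pos_part A" for a b
      using le[OF that] le[OF that(2,1)] by (simp add: dist_real_def dist_norm norm_minus_commute abs_le_iff)
  qed
  then have cont: "continuous_on (pos_part A) tr" by (rule lipschitz_on_continuous_on)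
  have "closedin (top_of_set (pos_part A)) {a\<in>pos_part A. \<tau> a \<le> t}" for t
  proof (cases t)
    case (real r)
    have "{a\<in>pos_part A. \<tau> a \<le> t} = pos_part A \<inter> tr -` {..r}"
      using real by (auto simp: pos_part_iff \<tau>_eq_tr)
    then show ?thesis using continuous_closedin_preimage[OF cont, of "{..r}"] by simp
  next
    case top
    then show ?thesis by simp
  qed
  then show ?thesis by (simp add: lower_semicontinuous_on_def)
qed

abbreviation "tf \<equiv> trace_functional A \<tau>"

text \<open>Well-definedness of \<open>THE\<close> in \<open>trace_functional\<close>: two
  decompositions are compared in the form \<open>p + q' = p' + q\<close>, to which additivity on
  positive elements applies.\<close>

lemma tf_diff:
  assumes p: "p \<in> pos_part A" and q: "q \<in> pos_part A"
  shows "tf (p - q) = tr p - tr q"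
  unfolding trace_functional_def tr_def[symmetric]
proof (rule the_equality)
  show "\<exists>p'\<in>pos_part A. \<exists>q'\<in>pos_part A. p - q = p' - q' \<and> tr p - tr q = tr p' - tr q'"
    using p q by blast
  fix r assume "\<exists>p'\<in>pos_part A. \<exists>q'\<in>pos_part A. p - q = p' - q' \<and> r = tr p' - tr q'"
  then obtain p' q' where *: "p' \<in> pos_part A" "q' \<in> pos_part A" "p - q = p' - q'" "r = tr p' - tr q'" by blast
  have "p + q' = p' + q" using *(3) by (simp add: algebra_simps)
  then have "tr p + tr q' = tr p' + tr q"
    using tr_add[of p q'] tr_add[of p' q] p q * by (simp add: pos_part_iff)
  then show "r = tr p - tr q" using *(4) by simp
qed

lemma tf_pos: "a \<in> A \<Longrightarrow> pos_op a \<Longrightarrow> tf a = tr a"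
  using tf_diff[of a 0] by (simp add: pos_part_iff A_zero tr_def trace_zero)

lemma tf_add:
  assumes "a \<in> A" "symm_op a" "b \<in> A" "symm_op b"
  shows "tf (a + b) = tf a + tf b"
proof -
  obtain p q where pq: "p \<in> pos_part A" "q \<in> pos_part A" "a = p - q" by (rule pos_neg_parts[OF assms(1,2)]) (rule that)
  obtain p' q' where pq': "p' \<in> pos_part A" "q' \<in> pos_part A" "b = p' - q'" by (rule pos_neg_parts[OF assms(3,4)]) (rule that)
  have "a + b = (p + p') - (q + q')" by (simp add: pq pq')
  moreover have "p + p' \<in> pos_part A" "q + q' \<in> pos_part A"
    using pq pq' by (auto simp: pos_part_iff A_add pos_op_add)
  ultimately have "tf (a + b) = tr (p + p') - tr (q + q')" by (simp only: tf_diff)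
  also have "\<dots> = tf a + tf b"
    using pq pq' tr_add[of p p'] tr_add[of q q'] tf_diff[of p q] tf_diff[of p' q'] by (simp add: pos_part_iff)
  finally show ?thesis .
qed

lemma tf_scaleR:
  assumes "a \<in> A" "symm_op a" "0 \<le> r"
  shows "tf (r *\<^sub>R a) = r * tf a"
proof -
  obtain p q where pq: "p \<in> pos_part A" "q \<in> pos_part A" "a = p - q" by (rule pos_neg_parts[OF assms(1,2)]) (rule that)
  have "r *\<^sub>R a = r *\<^sub>R p - r *\<^sub>R q" by (simp add: pq scaleR_diff_right)
  moreover have "r *\<^sub>R p \<in> pos_part A" "r *\<^sub>R q \<in> pos_part A"
    using pq assms(3) by (auto simp: pos_part_iff A_scaleR pos_op_scaleR)
  ultimately have "tf (r *\<^sub>R a) = tr (r *\<^sub>R p) - tr (r *\<^sub>R q)" by (simp only: tf_diff)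
  also have "\<dots> = r * tf a"
    using pq assms(3) tf_diff[of p q] by (simp add: pos_part_iff tr_scaleR right_diff_distrib)
  finally show ?thesis .
qed

end

context convex_triple
begin

text \<open>Reduction to the nonnegative case for \<open>F = max f l - l\<close> with
  \<open>l\<close> affine. The maximum keeps \<open>F\<close> nonnegative although \<open>l\<close>
  may exceed \<open>f\<close> by up to \<open>d\<close>. Convex combinations preserve the affine
  part exactly, and \<open>F + l\<close> exceeds \<open>f\<close> by at most \<open>d\<close>, which
  a bounded trace turns into an error \<open>M * d\<close>.\<close>

lemma trace_functional_convex:
  assumes fin: "finite_traced A \<tau>" and f: "continuous_on L f" "convex_on L f"
    and f0: "id_blinfun \<in> A \<or> f 0 = 0"
  shows "trace_functional A \<tau> (Z.J f) \<le> u * trace_functional A \<tau> (X.J f) + v * trace_functional A \<tau> (Y.J f)"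
proof -
  interpret finite_traced A \<tau> by (rule fin)
  note gX = X.good_continuous[OF L] and gY = Y.good_continuous[OF L] and gZ = Z.good_continuous[OF L]
  obtain M where M: "0 \<le> M" "\<And>a. a \<in> A \<Longrightarrow> pos_op a \<Longrightarrow> tr a \<le> M * norm a" by (rule tr_bounded) (rule that)
  have *: "tf (Z.J f) \<le> u * tf (X.J f) + v * tf (Y.J f) + M * d" if d: "0 < d" for d
  proof -
    \<comment> \<open>If the identity is not in \<open>A\<close>, then \<open>l\<close> has to
      vanish at \<open>0\<close>. A minorant of \<open>f\<close> with this property may not exist,
      but one within \<open>d\<close> of \<open>f 0 = 0\<close> at the origin does, and dropping its
      constant term, which is above \<open>- d\<close>, costs at most \<open>d\<close>.\<close>
    obtain c w where l: "\<And>t. t \<in> L \<Longrightarrow> c + w \<bullet> t \<le> f t + d" and c0: "id_blinfun \<in> A \<or> c = 0"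
    proof (cases "id_blinfun \<in> A")
      case True
      obtain C where "\<forall>t\<in>L. \<bar>f t\<bar> \<le> C"
        using compact_imp_bounded[OF compact_continuous_image[OF f(1) L]] by (force simp: bounded_iff)
      then have "- C + 0 \<bullet> t \<le> f t + d" if "t \<in> L" for t using that d by (fastforce simp: abs_le_iff)
      then show ?thesis using that True by blast
    next
      case False
      then have 0: "0 \<in> L" "f 0 = 0" using unit f0 by auto
      obtain c w where cw: "\<And>s. s \<in> L \<Longrightarrow> c + w \<bullet> s \<le> f s" "f 0 - d < c + w \<bullet> 0"
        by (rule affine_minorant[OF L f(2,1) 0(1) d]) (rule that)
      have "0 + w \<bullet> t \<le> f t + d" if "t \<in> L" for t using cw(1)[OF that] cw(2) 0(2) by simp
      then show ?thesis using that[of 0 w] by blast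
    qed
    define l where "l t = c + w \<bullet> t" for t
    define F where "F t = max (f t) (l t) - l t" for t
    have lc: "continuous_on L l" unfolding l_def by (intro continuous_intros)
    have Fc: "continuous_on L F" unfolding F_def by (intro continuous_intros f lc)
    have l0: "id_blinfun \<in> A \<or> l 0 = 0" using c0 by (simp add: l_def)
    have F0: "id_blinfun \<in> A \<or> F 0 = 0" using l0 f0 by (auto simp: F_def)
    have cL: "convex L" using f(2) by (rule convex_on_imp_convex)
    have "convex_on L F"
    proof -
      have "convex_on L l" unfolding l_def
        by (rule convex_onI[OF _ cL]) (simp add: inner_add_right algebra_simps)
      then have 1: "convex_on L (\<lambda>t. max (f t) (l t))"
        using f(2) cL by (intro convex_onI[OF _ cL]) (smt (verit) convex_onD mult_left_mono max_def)
      have "convex_on L (\<lambda>t. - l t)" unfolding l_def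
        by (rule convex_onI[OF _ cL]) (simp add: inner_add_right algebra_simps)
      from convex_on_add[OF 1 this] show ?thesis by (simp add: F_def[abs_def])
    qed
    moreover have "pos_part A \<subseteq> closure {a\<in>pos_part A. \<tau> a < \<infinity>}"
    proof -
      have "{a\<in>pos_part A. \<tau> a < \<infinity>} = pos_part A" using finite by (auto simp: pos_part_iff)
      then show ?thesis by (simp add: closure_subset)
    qed
    ultimately have "\<tau> (Z.J F) \<le> ennreal u * \<tau> (X.J F) + ennreal v * \<tau> (Y.J F)"
      by (intro trace_convex_nonneg Fc F0 lower_semicontinuous) (auto simp: F_def)
    moreover have FA: "X.J F \<in> A" "Y.J F \<in> A" "Z.J F \<in> A" by (rule J_in_A[OF Fc F0])+
    moreover have Fp: "pos_op (X.J F)" "pos_op (Y.J F)" "pos_op (Z.J F)"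
      by (rule X.J_pos Y.J_pos Z.J_pos, rule gX[OF Fc] gY[OF Fc] gZ[OF Fc], simp add: F_def)+
    ultimately have "ennreal (tr (Z.J F)) \<le> ennreal (u * tr (X.J F) + v * tr (Y.J F))"
      using uv by (simp add: \<tau>_eq_tr ennreal_mult ennreal_plus)
    moreover have "0 \<le> u * tr (X.J F) + v * tr (Y.J F)" using uv by simp
    ultimately have "tr (Z.J F) \<le> u * tr (X.J F) + v * tr (Y.J F)" by (simp only: ennreal_le_iff)
    then have F_ineq: "tf (Z.J F) \<le> u * tf (X.J F) + v * tf (Y.J F)"
      using FA Fp by (simp add: tf_pos)
    have fA: "X.J f \<in> A" "Y.J f \<in> A" "Z.J f \<in> A" by (rule J_in_A[OF f(1) f0])+
    have lA: "X.J l \<in> A" "Y.J l \<in> A" "Z.J l \<in> A" by (rule J_in_A[OF lc l0])+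
    have sym: "symm_op (X.J h)" "symm_op (Y.J h)" "symm_op (Z.J h)" if "continuous_on L h" for h
      by (rule X.J_symm Y.J_symm Z.J_symm, rule gX[OF that] gY[OF that] gZ[OF that])+
    have l_lin: "tf (Z.J l) = u * tf (X.J l) + v * tf (Y.J l)"
    proof -
      have "Z.J l = u *\<^sub>R X.J l + v *\<^sub>R Y.J l" unfolding l_def by (rule Z_affine)
      then show ?thesis
        using lA sym[OF lc] uv by (simp add: tf_add tf_scaleR A_scaleR symm_op_scaleR)
    qed
    have fF: "0 \<le> F t + l t - f t \<and> F t + l t - f t \<le> d" if "t \<in> L" for t
      using l[OF that] d by (auto simp: F_def l_def)
    define D where "D t = F t + l t - f t" for t
    have Db: "0 \<le> D t" "D t \<le> d" if "t \<in> L" for t using fF[OF that] by (simp_all add: D_def)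
    have Dc: "continuous_on L D" unfolding D_def by (intro continuous_intros Fc lc f)
    have D0: "id_blinfun \<in> A \<or> D 0 = 0" using F0 l0 f0 by (auto simp: D_def)
    have DA: "X.J D \<in> A" "Y.J D \<in> A" "Z.J D \<in> A" by (rule J_in_A[OF Dc D0])+
    have Dp: "pos_op (X.J D)" "pos_op (Y.J D)" "pos_op (Z.J D)"
      by (rule X.J_pos Y.J_pos Z.J_pos, rule gX[OF Dc] gY[OF Dc] gZ[OF Dc], erule Db)+
    have Dn: "norm (X.J D) \<le> d" "norm (Y.J D) \<le> d"
      by (rule X.J_norm_le Y.J_norm_le, rule gX[OF Dc] gY[OF Dc],
          use Db d in auto)+
    have Dtf: "tf (X.J D) \<le> M * d" "tf (Y.J D) \<le> M * d" "0 \<le> tf (Z.J D)"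
      using M(2)[OF DA(1) Dp(1)] M(2)[OF DA(2) Dp(2)] mult_left_mono[OF Dn(1) M(1)] mult_left_mono[OF Dn(2) M(1)]
      by (simp_all add: tf_pos DA Dp)
    have split: "tf (X.J F) + tf (X.J l) = tf (X.J f) + tf (X.J D)"
      "tf (Y.J F) + tf (Y.J l) = tf (Y.J f) + tf (Y.J D)" "tf (Z.J F) + tf (Z.J l) = tf (Z.J f) + tf (Z.J D)"
    proof -
      have "X.J F + X.J l = X.J f + X.J D" "Y.J F + Y.J l = Y.J f + Y.J D" "Z.J F + Z.J l = Z.J f + Z.J D"
        unfolding X.J_add[OF gX gX, OF Fc lc, symmetric] Y.J_add[OF gY gY, OF Fc lc, symmetric] Z.J_add[OF gZ gZ, OF Fc lc, symmetric]
          X.J_add[OF gX gX, OF f(1) Dc, symmetric] Y.J_add[OF gY gY, OF f(1) Dc, symmetric] Z.J_add[OF gZ gZ, OF f(1) Dc, symmetric]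
        by (rule X.J_cong Y.J_cong Z.J_cong, simp add: D_def)+
      then show "tf (X.J F) + tf (X.J l) = tf (X.J f) + tf (X.J D)"
        "tf (Y.J F) + tf (Y.J l) = tf (Y.J f) + tf (Y.J D)" "tf (Z.J F) + tf (Z.J l) = tf (Z.J f) + tf (Z.J D)"
        using FA lA fA DA sym[OF Fc] sym[OF lc] sym[OF f(1)] sym[OF Dc] by (simp_all flip: tf_add)
    qed
    have "tf (Z.J f) \<le> tf (Z.J F) + tf (Z.J l)" using split(3) Dtf(3) by simp
    also have "\<dots> \<le> u * (tf (X.J F) + tf (X.J l)) + v * (tf (Y.J F) + tf (Y.J l))"
      using F_ineq l_lin by (simp add: distrib_left)
    also have "\<dots> \<le> u * (tf (X.J f) + M * d) + v * (tf (Y.J f) + M * d)"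
      unfolding split using uv Dtf by (intro add_mono mult_left_mono) auto
    also have "\<dots> = u * tf (X.J f) + v * tf (Y.J f) + (u + v) * (M * d)" by (simp add: algebra_simps)
    finally show ?thesis using uv by simp
  qed
  show ?thesis
  proof (rule field_le_epsilon)
    fix e :: real assume e: "0 < e"
    \<comment> \<open>The denominator \<open>M + 1\<close> instead of \<open>M\<close> covers
      \<open>M = 0\<close>.\<close>
    have "M * (e / (M + 1)) \<le> e" using M(1) e by (simp add: field_simps)
    then show "tf (Z.J f) \<le> u * tf (X.J f) + v * tf (Y.J f) + e"
      using *[of "e / (M + 1)"] M(1) e by (simp add: add_nonneg_pos)
  qed
qed

end

section \<open>Tuples of commuting operators\<close>

lemma bpvm_superset:
  assumes P: "bpvm P L" and sub: "L \<subseteq> L'" "L' \<in> sets borel"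
  shows "bpvm P L'"
proof -
  interpret bpvm P L by (rule P)
  have "P (L \<inter> L') = P L o\<^sub>L P L'" by (rule Int) (auto simp: sub)
  then have "P L' = id_blinfun" using sub(1) by (simp add: E_K Int_absorb2)
  then show ?thesis using sub(2) pvm_axioms by (simp add: bpvm_def bpvm_axioms_def)
qed

lemma bpvm_J_superset:
  fixes P :: "'a::euclidean_space set \<Rightarrow> 'h::{real_inner,banach} \<Rightarrow>\<^sub>L 'h"
  assumes P: "bpvm P L" and sub: "L \<subseteq> L'" "compact L'" and g: "continuous_on L' g"
  shows "bpvm.J P L' g = bpvm.J P L g"
proof -
  interpret A: bpvm P L by (rule P)
  interpret B: bpvm P L' by (rule bpvm_superset[OF P sub(1) borel_compact[OF sub(2)]])
  have m: "(\<lambda>t. indicat_real L' t * g t) \<in> borel_measurable borel"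
    using B.good_continuous[OF sub(2) g] by (simp add: B.good_def)
  have eq: "indicat_real L t * (indicat_real L' t * g t) = indicat_real L t * g t" for t
    using sub(1) by (auto simp: indicator_def)
  have "B.quad g = A.quad g"
    using A.indicator_support(2)[OF A.K_borel A.E_K m] by (simp add: fun_eq_iff A.quad_def B.quad_def eq)
  then show ?thesis by (simp only: A.J_def B.J_def)
qed

text \<open>If \<open>L\<close> stays away from \<open>0\<close>, the function
  \<open>min 1 (norm t / e)\<close> vanishes at \<open>0\<close> and equals \<open>1\<close> on
  \<open>L\<close>, so that its operator is the identity. The point \<open>0\<close> is adjoined to
  the support to make \<open>J_mem\<close> applicable.\<close>

lemma (in cstar) unit_or_zero_mem:
  fixes P :: "'a::euclidean_space set \<Rightarrow> 'h \<Rightarrow>\<^sub>L 'h"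
  assumes P: "bpvm P L" and L: "compact L" and coord: "\<And>b. b \<in> Basis \<Longrightarrow> bpvm.J P L (\<lambda>t. t \<bullet> b) \<in> A"
  shows "id_blinfun \<in> A \<or> 0 \<in> L"
proof (rule disjCI)
  assume 0: "0 \<notin> L"
  interpret bpvm P L by (rule P)
  have L': "L \<subseteq> insert 0 L" "compact (insert 0 L)" using L by auto
  have P': "bpvm P (insert 0 L)" by (rule bpvm_superset[OF P L'(1) borel_compact[OF L'(2)]])
  obtain e where e: "0 < e" "\<And>t. t \<in> L \<Longrightarrow> e \<le> norm t"
    using separate_point_closed[OF compact_imp_closed[OF L] 0] by (auto simp: dist_norm)
  define g where "g t = min 1 (norm t / e)" for t :: 'a
  have gc: "continuous_on (insert 0 L) g" unfolding g_def using e by (intro continuous_intros) auto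
  have "bpvm.J P (insert 0 L) g \<in> A"
  proof (rule J_mem[OF P' L'(2) gc])
    show "bpvm.J P (insert 0 L) (\<lambda>t. t \<bullet> b) \<in> A" if "b \<in> Basis" for b
      using coord[OF that] bpvm_J_superset[OF P L', of "\<lambda>t. t \<bullet> b"] by (simp add: continuous_intros)
  qed (simp add: g_def)
  also have "bpvm.J P (insert 0 L) g = J g" by (rule bpvm_J_superset[OF P L' gc])
  also have "J g = J (\<lambda>_. 1)" by (rule J_cong) (use e in \<open>auto simp: g_def field_simps\<close>)
  finally show "id_blinfun \<in> A" by (simp add: J_const)
qed

lemma J_inner_vec:
  fixes P :: "(real^'n::finite) set \<Rightarrow> 'h::{real_inner,banach} \<Rightarrow>\<^sub>L 'h"
  assumes P: "bpvm P L" and L: "compact L"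
  shows "bpvm.J P L (\<lambda>t. w \<bullet> t) = (\<Sum>i\<in>UNIV. w $ i *\<^sub>R bpvm.J P L (\<lambda>t. t $ i))"
proof -
  interpret bpvm P L by (rule P)
  have g: "good (\<lambda>t. t $ i)" "good (\<lambda>t. w $ i * t $ i)" for i
    by (rule good_continuous[OF L], intro continuous_intros)+
  show ?thesis by (simp add: inner_vec_def J_sum J_scale g)
qed

text \<open>One box must serve all three tuples. Its ends are minima and maxima of the bounds for
  \<open>x\<close> and \<open>y\<close>, so they belong to \<open>I i\<close> again, and the convex
  combination obeys the same bounds.\<close>

lemma convex_triple_exists:
  fixes I :: "'n::finite \<Rightarrow> real set" and A :: "('h::complex_hilbert_space \<Rightarrow>\<^sub>L 'h) set"
  assumes I: "\<And>i. is_interval (I i)" and tr: "traced A \<tau>"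
    and B: "\<And>i. cstar_subalgebra (B i) A" and comm: "mutually_commuting B" and nt: "(\<zeta>::'h) \<noteq> 0"
    and x: "x \<in> sa_tuples B I" and y: "y \<in> sa_tuples B I"
    and uv: "0 \<le> u" "0 \<le> v" "u + v = 1"
  obtains PX PY PZ L where "u *\<^sub>R x + v *\<^sub>R y \<in> sa_tuples B I" "L \<subseteq> cube I" "convex L"
    "convex_triple A \<tau> PX PY PZ L u v"
    "\<And>f. continuous_on (cube I) f \<Longrightarrow> fun_calc I f x = bpvm.J PX L f \<and> fun_calc I f y = bpvm.J PY L f \<and>
      fun_calc I f (u *\<^sub>R x + v *\<^sub>R y) = bpvm.J PZ L f"
proof -
  interpret traced A \<tau> by (rule tr)
  have BA: "B i \<subseteq> A" and Bc: "cstar (B i)" for i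
    using B by (auto simp: cstar_subalgebra_def cstar_def)
  have Bb: "B i \<subseteq> bounded_ops" for i using BA A_bounded_ops by blast
  define z where "z = u *\<^sub>R x + v *\<^sub>R y"
  have zi: "z $ i = u *\<^sub>R x $ i + v *\<^sub>R y $ i" for i by (simp add: z_def)
  have iff: "T \<in> sa_part (B i) (I i) \<longleftrightarrow> T \<in> B i \<and> symm_op T \<and>
    (\<exists>a\<in>I i. \<exists>b\<in>I i. \<forall>\<xi>. a * (norm \<xi>)\<^sup>2 \<le> T \<xi> \<bullet> \<xi> \<and> T \<xi> \<bullet> \<xi> \<le> b * (norm \<xi>)\<^sup>2)" for i T
    by (rule sa_part_iff[OF Bb I nt])
  have x': "x $ i \<in> sa_part (B i) (I i)" and y': "y $ i \<in> sa_part (B i) (I i)" for i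
    using x y by (simp_all add: sa_tuples_def)
  have xB: "x $ i \<in> B i" and xs: "symm_op (x $ i)" and yB: "y $ i \<in> B i" and ys: "symm_op (y $ i)" for i
    using x'[of i] y'[of i] unfolding iff by blast+
  obtain ax bx where ab_x: "\<And>i. ax i \<in> I i" "\<And>i. bx i \<in> I i"
      "\<And>i \<xi>. ax i * (norm \<xi>)\<^sup>2 \<le> (x $ i) \<xi> \<bullet> \<xi>" "\<And>i \<xi>. (x $ i) \<xi> \<bullet> \<xi> \<le> bx i * (norm \<xi>)\<^sup>2"
    using x' unfolding iff by metis
  obtain ay b_y where ab_y: "\<And>i. ay i \<in> I i" "\<And>i. b_y i \<in> I i"
      "\<And>i \<xi>. ay i * (norm \<xi>)\<^sup>2 \<le> (y $ i) \<xi> \<bullet> \<xi>" "\<And>i \<xi>. (y $ i) \<xi> \<bullet> \<xi> \<le> b_y i * (norm \<xi>)\<^sup>2"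
    using y' unfolding iff by metis
  define a where "a = (\<chi> i. min (ax i) (ay i))"
  define b where "b = (\<chi> i. max (bx i) (b_y i))"
  have abI: "a $ i \<in> I i" "b $ i \<in> I i" for i
    using ab_x(1,2) ab_y(1,2) by (auto simp: a_def b_def min_def max_def)
  have xa: "a $ i * (norm \<xi>)\<^sup>2 \<le> (x $ i) \<xi> \<bullet> \<xi>" and xb: "(x $ i) \<xi> \<bullet> \<xi> \<le> b $ i * (norm \<xi>)\<^sup>2"
    and ya: "a $ i * (norm \<xi>)\<^sup>2 \<le> (y $ i) \<xi> \<bullet> \<xi>" and yb: "(y $ i) \<xi> \<bullet> \<xi> \<le> b $ i * (norm \<xi>)\<^sup>2" for i \<xi>
    by (rule order_trans[OF mult_right_mono ab_x(3)] order_trans[OF ab_x(4) mult_right_mono]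
        order_trans[OF mult_right_mono ab_y(3)] order_trans[OF ab_y(4) mult_right_mono]; simp add: a_def b_def)+
  have quad_z: "(z $ i) \<xi> \<bullet> \<xi> = u * ((x $ i) \<xi> \<bullet> \<xi>) + v * ((y $ i) \<xi> \<bullet> \<xi>)" for i \<xi>
    by (simp add: zi blinfun.add_left blinfun.scaleR_left inner_add_left)
  have za: "a $ i * (norm \<xi>)\<^sup>2 \<le> (z $ i) \<xi> \<bullet> \<xi>" for i \<xi>
  proof -
    have "a $ i * (norm \<xi>)\<^sup>2 = u * (a $ i * (norm \<xi>)\<^sup>2) + v * (a $ i * (norm \<xi>)\<^sup>2)"
      using uv(3) by (metis distrib_right mult_1)
    also have "\<dots> \<le> (z $ i) \<xi> \<bullet> \<xi>" unfolding quad_z by (intro add_mono mult_left_mono xa ya uv)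
    finally show ?thesis .
  qed
  have zb: "(z $ i) \<xi> \<bullet> \<xi> \<le> b $ i * (norm \<xi>)\<^sup>2" for i \<xi>
  proof -
    have "(z $ i) \<xi> \<bullet> \<xi> \<le> u * (b $ i * (norm \<xi>)\<^sup>2) + v * (b $ i * (norm \<xi>)\<^sup>2)"
      unfolding quad_z by (intro add_mono mult_left_mono xb yb uv)
    also have "\<dots> = b $ i * (norm \<xi>)\<^sup>2" using uv(3) by (metis distrib_right mult_1)
    finally show ?thesis .
  qed
  have zB: "z $ i \<in> B i" and zs: "symm_op (z $ i)" for i
    unfolding zi
    by (intro cstar.A_add[OF Bc] cstar.A_scaleR[OF Bc] xB yB, intro symm_op_add symm_op_scaleR xs ys)
  have z': "z \<in> sa_tuples B I"
    unfolding sa_tuples_def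
  proof (intro CollectI allI)
    show "z $ i \<in> sa_part (B i) (I i)" for i
      unfolding iff using zB zs abI[of i] za[of i] zb[of i] by blast
  qed
  have commute: "w $ i o\<^sub>L w $ j = w $ j o\<^sub>L w $ i" if "\<And>i. w $ i \<in> B i" for w i j
  proof (cases "i = j")
    case False
    with comm that show ?thesis unfolding mutually_commuting_def by metis
  qed simp
  have bo: "w $ i \<in> bounded_ops" if "\<And>i. w $ i \<in> B i" for w i using that Bb by blast
  obtain PX where PX: "bpvm PX (cbox a b)" "\<And>i. bpvm.J PX (cbox a b) (\<lambda>v. v $ i) = x $ i"
    "\<And>f I. (\<And>i. is_interval (I i)) \<Longrightarrow> cbox a b \<subseteq> cube I \<Longrightarrow> continuous_on (cube I) f \<Longrightarrow>
      fun_calc I f x = bpvm.J PX (cbox a b) f"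
    by (rule tuple_calculus[OF bo xs commute xa xb]) (use xB in auto)
  obtain PY where PY: "bpvm PY (cbox a b)" "\<And>i. bpvm.J PY (cbox a b) (\<lambda>v. v $ i) = y $ i"
    "\<And>f I. (\<And>i. is_interval (I i)) \<Longrightarrow> cbox a b \<subseteq> cube I \<Longrightarrow> continuous_on (cube I) f \<Longrightarrow>
      fun_calc I f y = bpvm.J PY (cbox a b) f"
    by (rule tuple_calculus[OF bo ys commute ya yb]) (use yB in auto)
  obtain PZ where PZ: "bpvm PZ (cbox a b)" "\<And>i. bpvm.J PZ (cbox a b) (\<lambda>v. v $ i) = z $ i"
    "\<And>f I. (\<And>i. is_interval (I i)) \<Longrightarrow> cbox a b \<subseteq> cube I \<Longrightarrow> continuous_on (cube I) f \<Longrightarrow>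
      fun_calc I f z = bpvm.J PZ (cbox a b) f"
    by (rule tuple_calculus[OF bo zs commute za zb]) (use zB in auto)
  have sub: "cbox a b \<subseteq> cube I"
    by (auto simp: mem_box_cart cube_def intro: mem_is_interval_1_I[OF I abI])
  have lin: "bpvm.J P (cbox a b) (\<lambda>t. w \<bullet> t) = (\<Sum>i\<in>UNIV. w $ i *\<^sub>R q $ i)"
    if "bpvm P (cbox a b)" "\<And>i. bpvm.J P (cbox a b) (\<lambda>v. v $ i) = q $ i" for P q w
    using J_inner_vec[OF that(1) compact_cbox] that(2) by simp
  have memX: "bpvm.J PX (cbox a b) (\<lambda>t. w \<bullet> t) \<in> A" for w
    unfolding lin[OF PX(1,2)] using xB BA by (auto intro!: A_sum A_scaleR)
  have memY: "bpvm.J PY (cbox a b) (\<lambda>t. w \<bullet> t) \<in> A" for w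
    unfolding lin[OF PY(1,2)] using yB BA by (auto intro!: A_sum A_scaleR)
  have "bpvm.J PX (cbox a b) (\<lambda>t. t \<bullet> w) \<in> A" for w
    using memX[of w] by (simp only: inner_commute[of w])
  then have unit: "id_blinfun \<in> A \<or> 0 \<in> cbox a b"
    by (intro unit_or_zero_mem[OF PX(1) compact_cbox])
  have "convex_triple A \<tau> PX PY PZ (cbox a b) u v"
  proof (intro convex_triple.intro convex_triple_axioms.intro tr PX(1) PY(1) PZ(1) compact_cbox uv memX memY unit)
    show "bpvm.J PZ (cbox a b) (\<lambda>t. w \<bullet> t) = u *\<^sub>R bpvm.J PX (cbox a b) (\<lambda>t. w \<bullet> t) + v *\<^sub>R bpvm.J PY (cbox a b) (\<lambda>t. w \<bullet> t)" for w
      unfolding lin[OF PX(1,2)] lin[OF PY(1,2)] lin[OF PZ(1,2)]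
      by (simp add: zi scaleR_add_right sum.distrib scaleR_sum_right mult.commute)
  qed
  moreover have "fun_calc I f x = bpvm.J PX (cbox a b) f \<and> fun_calc I f y = bpvm.J PY (cbox a b) f \<and>
      fun_calc I f (u *\<^sub>R x + v *\<^sub>R y) = bpvm.J PZ (cbox a b) f" if "continuous_on (cube I) f" for f
    using PX(3)[OF I sub that] PY(3)[OF I sub that] PZ(3)[OF I sub that] by (simp add: z_def)
  ultimately show ?thesis using that[of "cbox a b" PX PY PZ] z' sub convex_box(1) by (simp add: z_def)
qed

text \<open>\<open>f - f 0\<close> vanishes at \<open>0\<close> and is represented in
  \<open>A\<close> in any case; together with \<open>X.J f \<in> A\<close> this puts
  \<open>f 0\<close> times the identity into \<open>A\<close>.\<close>

lemma (in convex_triple) unit_or_f0: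
  assumes f: "continuous_on L f" and fA: "X.J f \<in> A"
  shows "id_blinfun \<in> A \<or> f 0 = 0"
proof (rule disjCI)
  assume f0: "f 0 \<noteq> 0"
  show "id_blinfun \<in> A"
  proof (rule ccontr)
    assume n: "id_blinfun \<notin> A"
    have "X.J (\<lambda>t. f t - f 0) \<in> A" by (rule J_in_A(1)) (auto intro!: continuous_intros f)
    then have "X.J f - f 0 *\<^sub>R id_blinfun \<in> A"
      by (simp add: X.J_diff X.good_continuous[OF L f] X.good_const X.J_const)
    from A_diff[OF fA this] have "f 0 *\<^sub>R id_blinfun \<in> A" by simp
    then have "(1 / f 0) *\<^sub>R f 0 *\<^sub>R id_blinfun \<in> A" by (rule A_scaleR)
    then show False using n f0 by simp
  qed
qed

text \<open>The last assumption renders that \<open>f(x)\<close> is regarded as an element of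
  \<open>A\<close>. For a given tuple, \<open>unit_or_f0\<close> extracts from it the alternative
  between the identity lying in \<open>A\<close> and \<open>f 0 = 0\<close>.\<close>

theorem theorem2:
  fixes I :: "'n::finite \<Rightarrow> real set"
    and f :: "real^'n \<Rightarrow> real"
    and A :: "('h::complex_hilbert_space \<Rightarrow>\<^sub>L 'h) set"
    and B :: "'n \<Rightarrow> ('h \<Rightarrow>\<^sub>L 'h) set"
    and \<tau> :: "('h \<Rightarrow>\<^sub>L 'h) \<Rightarrow> ennreal"
  assumes "\<And>i. is_interval (I i)"
    and "continuous_on (cube I) f"
    and "convex_on (cube I) f"
    and "cstar_algebra A"
    and "\<And>i. cstar_subalgebra (B i) A"
    and "mutually_commuting B"
    and "\<And>x. x \<in> sa_tuples B I \<Longrightarrow> fun_calc I f x \<in> A"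
  shows "(finite_trace A \<tau> \<longrightarrow>
            convex_on (sa_tuples B I) (\<lambda>x. trace_functional A \<tau> (fun_calc I f x))) \<and>
         (densely_defined_trace A \<tau> \<and> lower_semicontinuous_on (pos_part A) \<tau> \<and>
            (\<forall>v\<in>cube I. 0 \<le> f v) \<longrightarrow>
            ennreal_convex_on (sa_tuples B I) (\<lambda>x. \<tau> (fun_calc I f x)))"
proof -
  note I = assms(1) and fA = assms(7)
  have ennreal_comb: "c = ennreal u * c + ennreal v * c" if "0 \<le> u" "0 \<le> v" "u + v = 1" for u v c
    using that by (simp flip: distrib_right ennreal_plus)
  have real_comb: "c = u * c + v * c" if "u + v = 1" for u v c :: real
    using that by (simp flip: distrib_right)
  have main: "u *\<^sub>R x + v *\<^sub>R y \<in> sa_tuples B I \<and>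
      (finite_trace A \<tau> \<longrightarrow> trace_functional A \<tau> (fun_calc I f (u *\<^sub>R x + v *\<^sub>R y))
        \<le> u * trace_functional A \<tau> (fun_calc I f x) + v * trace_functional A \<tau> (fun_calc I f y)) \<and>
      (densely_defined_trace A \<tau> \<and> lower_semicontinuous_on (pos_part A) \<tau> \<and> (\<forall>v\<in>cube I. 0 \<le> f v) \<longrightarrow>
        \<tau> (fun_calc I f (u *\<^sub>R x + v *\<^sub>R y)) \<le> ennreal u * \<tau> (fun_calc I f x) + ennreal v * \<tau> (fun_calc I f y))"
    if tr: "is_trace A \<tau>" and x: "x \<in> sa_tuples B I" and y: "y \<in> sa_tuples B I"
      and uv: "0 \<le> u" "0 \<le> v" "u + v = 1" for x y u v
  proof (cases "\<exists>\<zeta>::'h. \<zeta> \<noteq> 0")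
    \<comment> \<open>On the zero space the spectrum is empty and gives no bounds, but all operators
      coincide, so both inequalities are trivial.\<close>
    case False
    then have "S = T" for S T :: "'h \<Rightarrow>\<^sub>L 'h" by (intro blinfun_eqI) metis
    then have "u *\<^sub>R x + v *\<^sub>R y = x" "y = x" by (auto simp: vec_eq_iff)
    then show ?thesis using x real_comb[OF uv(3)] ennreal_comb[OF uv] by auto
  next
    case True
    then obtain \<zeta> :: 'h where nt: "\<zeta> \<noteq> 0" by blast
    have traced: "traced A \<tau>" using assms(4) tr by (simp add: traced_def cstar_def traced_axioms_def)
    obtain PX PY PZ L where z: "u *\<^sub>R x + v *\<^sub>R y \<in> sa_tuples B I" and sub: "L \<subseteq> cube I" "convex L"
      and triple: "convex_triple A \<tau> PX PY PZ L u v"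
      and calc: "\<And>f. continuous_on (cube I) f \<Longrightarrow> fun_calc I f x = bpvm.J PX L f \<and> fun_calc I f y = bpvm.J PY L f \<and>
        fun_calc I f (u *\<^sub>R x + v *\<^sub>R y) = bpvm.J PZ L f"
      by (rule convex_triple_exists[OF I traced assms(5,6) nt x y uv]) (rule that)
    interpret convex_triple A \<tau> PX PY PZ L u v by (rule triple)
    have fL: "continuous_on L f" "convex_on L f"
      using continuous_on_subset[OF assms(2) sub(1)] convex_on_subset[OF assms(3) sub] by auto
    note calc = calc[OF assms(2)]
    have f0: "id_blinfun \<in> A \<or> f 0 = 0"
      by (rule unit_or_f0[OF fL(1)]) (use fA[OF x] calc in simp)
    have "trace_functional A \<tau> (fun_calc I f (u *\<^sub>R x + v *\<^sub>R y))
        \<le> u * trace_functional A \<tau> (fun_calc I f x) + v * trace_functional A \<tau> (fun_calc I f y)"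
      if "finite_trace A \<tau>"
    proof -
      have "finite_traced A \<tau>"
        using traced that by (simp add: finite_traced_def finite_traced_axioms_def finite_trace_def pos_part_iff)
      then show ?thesis using trace_functional_convex[OF _ fL f0] calc by simp
    qed
    moreover have "\<tau> (fun_calc I f (u *\<^sub>R x + v *\<^sub>R y)) \<le> ennreal u * \<tau> (fun_calc I f x) + ennreal v * \<tau> (fun_calc I f y)"
      if "densely_defined_trace A \<tau>" "lower_semicontinuous_on (pos_part A) \<tau>" "\<forall>v\<in>cube I. 0 \<le> f v"
      using trace_convex_nonneg[OF fL _ f0 _ that(2)] that sub(1) calc by (auto simp: densely_defined_trace_def)
    ultimately show ?thesis using z by blast
  qed
  show ?thesis
  proof (intro conjI impI)
    assume fin: "finite_trace A \<tau>"
    then have "is_trace A \<tau>" by (simp add: finite_trace_def)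
    note main = main[OF this]
    have "convex (sa_tuples B I)" unfolding convex_def using main by blast
    then show "convex_on (sa_tuples B I) (\<lambda>x. trace_functional A \<tau> (fun_calc I f x))"
      unfolding convex_on_def using main fin by blast
  next
    assume d: "densely_defined_trace A \<tau> \<and> lower_semicontinuous_on (pos_part A) \<tau> \<and> (\<forall>v\<in>cube I. 0 \<le> f v)"
    then have "is_trace A \<tau>" by (simp add: densely_defined_trace_def)
    note main = main[OF this]
    have "convex (sa_tuples B I)" unfolding convex_def using main by blast
    then show "ennreal_convex_on (sa_tuples B I) (\<lambda>x. \<tau> (fun_calc I f x))"
      unfolding ennreal_convex_on_def using main d by blast
  qed
qed

end
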